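(* Let $k$ be an algebraically closed field of characteristic $0$ and let $H$ be a semisimple weak Hopf algebra over $k$ such that $H_t=H_s$. Then $H^*$ is semisimple.
   Context: A weak Hopf algebra over a field $k$ is a $k$-vector space $H$ with an associative unital algebra structure $(m,1)$, a coassociative counital coalgebra structure $(\Delta,\epsilon)$ (Sweedler notation $\Delta(h)=h_{(1)}\otimes h_{(2)}$) and a linear map $S:H\to H$ (antipode) such that for all $f,g,h\in H$: $\Delta(hg)=\Delta(h)\Delta(g)$; $(\Delta\otimes\mathrm{id})\Delta(1)=(\Delta(1)\otimes1)(1\otimes\Delta(1))=(1\otimes\Delta(1))(\Delta(1)\otimes1)$; $\epsilon(fgh)=\epsilon(fg_{(1)})\epsilon(g_{(2)}h)=\epsilon(fg_{(2)})\epsilon(g_{(1)}h)$; $m(\mathrm{id}\otimes S)\Delta(h)=(\epsilon\otimes\mathrm{id})(\Delta(1)(h\otimes1))$; $m(S\otimes\mathrm{id})\Delta(h)=(\mathrm{id}\otimes\epsilon)((1\otimes h)\Delta(1))$; $S(h)=S(h_{(1)})h_{(2)}S(h_{(3)})$. ($\Delta(1)\neq1\otimes1$ in general.) Bases: $H_t=\varepsilon_t(H)$, $H_s=\varepsilon_s(H)$, where $\varepsilon_t(h)=\epsilon(1_{(1)}h)1_{(2)}$, $\varepsilon_s(h)=1_{(1)}\epsilon(h1_{(2)})$; they are commuting separable subalgebras. A semisimple weak Hopf algebra (semisimple as an algebra) is automatically finite dimensional. For finite dimensional $H$, $H^*$ is a weak Hopf algebra via $\langle\phi\psi,h\rangle=\langle\phi\otimes\psi,\Delta(h)\rangle$,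 $\langle\Delta(\phi),h\otimes g\rangle=\langle\phi,hg\rangle$, $\langle S(\phi),h\rangle=\langle\phi,S(h)\rangle$, with unit $\epsilon$ and counit $\phi\mapsto\langle\phi,1\rangle$. *)

theory Defs
  imports
    "HOL-Algebra.Ideal"
    "HOL-Computational_Algebra.Polynomial"
    "HOL-Library.Function_Algebras"
begin

section \<open>Semisimple rings\<close>

definition left_ideal :: "'a set \<Rightarrow> ('a, 'm) ring_scheme \<Rightarrow> bool" where
  "left_ideal I R \<longleftrightarrow>
     additive_subgroup I R \<and> (\<forall>r\<in>carrier R. \<forall>x\<in>I. r \<otimes>\<^bsub>R\<^esub> x \<in> I)"

text \<open>A ring is semisimple if its left regular module is, i.e. if every left ideal is a direct
  summand. In a unital algebra over a field every left ideal is a linear subspace, so for algebras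
  there is no difference between the ring-theoretic and the algebra-theoretic notion.\<close>

locale semisimple_ring = ring R for R (structure) +
  assumes complemented:
    "left_ideal I R \<Longrightarrow> \<exists>J. left_ideal J R \<and> I \<inter> J = {\<zero>} \<and> I <+>\<^bsub>R\<^esub> J = carrier R"

text \<open>The sort \<open>{ring, monoid_mult}\<close> is that of unital rings in which \<open>0 = 1\<close> is
  not excluded.\<close>

definition ring_of_type :: "'a::{ring, monoid_mult} ring" where
  "ring_of_type = \<lparr>carrier = UNIV, monoid.mult = (*), one = 1, zero = 0, add = (+)\<rparr>"


section \<open>Tensor square and tensor cube of a vector space\<close>

text \<open>The pure tensor of \<open>x\<close> and \<open>y\<close> is the functional \<open>\<beta> \<mapsto> \<beta> x y\<close> on the space of bilinear
  forms, and the tensor square consists of the finite sums of pure tensors; similarly for the cube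
  and trilinear forms. Over a field this is the algebraic tensor product: every bilinear
  (trilinear) map factors through it, see \<open>lift2_sum\<close> and \<open>lift3_sum\<close> below. Functionals are
  extended by 0 to functions that are not multilinear.\<close>

type_synonym ('k, 'v) tensor2 = "('v \<Rightarrow> 'v \<Rightarrow> 'k) \<Rightarrow> 'k"
type_synonym ('k, 'v) tensor3 = "('v \<Rightarrow> 'v \<Rightarrow> 'v \<Rightarrow> 'k) \<Rightarrow> 'k"

definition fun_scale :: "'k::field \<Rightarrow> ('f \<Rightarrow> 'k) \<Rightarrow> ('f \<Rightarrow> 'k)" where
  "fun_scale c t = (\<lambda>\<beta>. c * t \<beta>)"

locale tensor_powers = vector_space scale
  for scale :: "'k::field \<Rightarrow> 'v::ab_group_add \<Rightarrow> 'v" (infixr \<open>*s\<close> 75)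
begin

definition bilinear_map :: "('k \<Rightarrow> 'c \<Rightarrow> 'c) \<Rightarrow> ('v \<Rightarrow> 'v \<Rightarrow> 'c::ab_group_add) \<Rightarrow> bool" where
  "bilinear_map s f \<longleftrightarrow>
     (\<forall>y. Vector_Spaces.linear scale s (\<lambda>x. f x y)) \<and>
     (\<forall>x. Vector_Spaces.linear scale s (\<lambda>y. f x y))"

definition trilinear_map :: "('k \<Rightarrow> 'c \<Rightarrow> 'c) \<Rightarrow> ('v \<Rightarrow> 'v \<Rightarrow> 'v \<Rightarrow> 'c::ab_group_add) \<Rightarrow> bool" where
  "trilinear_map s f \<longleftrightarrow>
     (\<forall>y z. Vector_Spaces.linear scale s (\<lambda>x. f x y z)) \<and>
     (\<forall>x z. Vector_Spaces.linear scale s (\<lambda>y. f x y z)) \<and>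
     (\<forall>x y. Vector_Spaces.linear scale s (\<lambda>z. f x y z))"

definition pure2 :: "'v \<Rightarrow> 'v \<Rightarrow> ('k, 'v) tensor2" where
  "pure2 x y = (\<lambda>\<beta>. if bilinear_map (*) \<beta> then \<beta> x y else 0)"

definition pure3 :: "'v \<Rightarrow> 'v \<Rightarrow> 'v \<Rightarrow> ('k, 'v) tensor3" where
  "pure3 x y z = (\<lambda>\<tau>. if trilinear_map (*) \<tau> then \<tau> x y z else 0)"

definition tensor_square :: "('k, 'v) tensor2 set" where
  "tensor_square = range (\<lambda>ps. \<Sum>(x, y)\<leftarrow>ps. pure2 x y)"

text \<open>\<open>lift2 f t\<close> is the value at the tensor \<open>t\<close> of the linear map induced by the bilinear map
  \<open>f\<close>; in Sweedler notation it is \<open>f t\<^sub>1 t\<^sub>2\<close>.\<close>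

definition lift2 :: "('v \<Rightarrow> 'v \<Rightarrow> 'c::comm_monoid_add) \<Rightarrow> ('k, 'v) tensor2 \<Rightarrow> 'c" where
  "lift2 f t = (SOME v. \<exists>ps. t = (\<Sum>(x, y)\<leftarrow>ps. pure2 x y) \<and> v = (\<Sum>(x, y)\<leftarrow>ps. f x y))"

definition lift3 :: "('v \<Rightarrow> 'v \<Rightarrow> 'v \<Rightarrow> 'c::comm_monoid_add) \<Rightarrow> ('k, 'v) tensor3 \<Rightarrow> 'c" where
  "lift3 f t =
     (SOME v. \<exists>ps. t = (\<Sum>(x, y, z)\<leftarrow>ps. pure3 x y z) \<and> v = (\<Sum>(x, y, z)\<leftarrow>ps. f x y z))"

text \<open>The maps \<open>(V \<otimes> V) \<times> V \<rightarrow> V \<otimes> V \<otimes> V\<close> and \<open>V \<times> (V \<otimes> V) \<rightarrow> V \<otimes> V \<otimes> V\<close>.\<close>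

definition tensor_right :: "('k, 'v) tensor2 \<Rightarrow> 'v \<Rightarrow> ('k, 'v) tensor3" where
  "tensor_right t z = lift2 (\<lambda>x y. pure3 x y z) t"

definition tensor_left :: "'v \<Rightarrow> ('k, 'v) tensor2 \<Rightarrow> ('k, 'v) tensor3" where
  "tensor_left x t = lift2 (\<lambda>y z. pure3 x y z) t"

lemma pure2_apply: "bilinear_map (*) \<beta> \<Longrightarrow> pure2 x y \<beta> = \<beta> x y"
  by (simp add: pure2_def)

lemma pure3_apply: "trilinear_map (*) \<tau> \<Longrightarrow> pure3 x y z \<tau> = \<tau> x y z"
  by (simp add: pure3_def)

lemma sum_pure2_apply:
  "bilinear_map (*) \<beta> \<Longrightarrow> (\<Sum>(x, y)\<leftarrow>ps. pure2 x y) \<beta> = (\<Sum>(x, y)\<leftarrow>ps. \<beta> x y)"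
  by (induction ps) (auto simp: pure2_apply)

lemma sum_pure3_apply:
  "trilinear_map (*) \<tau> \<Longrightarrow> (\<Sum>(x, y, z)\<leftarrow>ps. pure3 x y z) \<tau> = (\<Sum>(x, y, z)\<leftarrow>ps. \<tau> x y z)"
  by (induction ps) (auto simp: pure3_apply)

lemma exists_separating_functional:
  assumes "vector_space s" and "v \<noteq> w"
  shows "\<exists>\<phi>. Vector_Spaces.linear s (*) \<phi> \<and> \<phi> v \<noteq> (\<phi> w :: 'k)"
proof -
  have vs: "vector_space ((*) :: 'k \<Rightarrow> 'k \<Rightarrow> 'k)"
    by unfold_locales (auto simp: algebra_simps)
  interpret p: vector_space_pair s "(*) :: 'k \<Rightarrow> 'k \<Rightarrow> 'k"
    using assms(1) vs by (simp add: vector_space_pair_def)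
  have ind: "p.vs1.independent {v - w}"
    using assms(2) by (simp add: p.vs1.dependent_single)
  let ?\<phi> = "p.construct {v - w} (\<lambda>_. 1)"
  have lin: "Vector_Spaces.linear s (*) ?\<phi>"
    by (rule p.linear_construct[OF ind])
  then interpret l: Vector_Spaces.linear s "(*)" ?\<phi> .
  have "?\<phi> (v - w) = 1"
    by (rule p.construct_basis[OF ind]) simp
  then have "?\<phi> v \<noteq> ?\<phi> w"
    by (auto simp: l.diff)
  with lin show ?thesis
    by blast
qed

lemma linear_sum_list:
  "Vector_Spaces.linear s s' \<phi> \<Longrightarrow> \<phi> (sum_list vs) = sum_list (map \<phi> vs)"
  by (induction vs) (simp_all add: linear_iff_module_hom module_hom.add module_hom.zero)

lemma lift2_sum:
  assumes "vector_space s" and f: "bilinear_map s f"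
  shows "lift2 f (\<Sum>(x, y)\<leftarrow>ps. pure2 x y) = (\<Sum>(x, y)\<leftarrow>ps. f x y)"
proof -
  have uniq: "(\<Sum>(x, y)\<leftarrow>qs. f x y) = (\<Sum>(x, y)\<leftarrow>ps. f x y)"
    if eq: "(\<Sum>(x, y)\<leftarrow>ps. pure2 x y) = (\<Sum>(x, y)\<leftarrow>qs. pure2 x y)" for qs
  proof (rule ccontr)
    assume "\<not> ?thesis"
    from exists_separating_functional[OF assms(1) this] obtain \<phi>
      where \<phi>: "Vector_Spaces.linear s (*) \<phi>"
        and ne: "\<phi> (\<Sum>(x, y)\<leftarrow>qs. f x y) \<noteq> \<phi> (\<Sum>(x, y)\<leftarrow>ps. f x y)"
      by blast
    have b: "bilinear_map (*) (\<lambda>x y. \<phi> (f x y))"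
      using f Vector_Spaces.linear_compose[OF _ \<phi>]
      unfolding bilinear_map_def by (auto simp: o_def)
    have "(\<Sum>(x, y)\<leftarrow>rs. pure2 x y) (\<lambda>x y. \<phi> (f x y)) = \<phi> (\<Sum>(x, y)\<leftarrow>rs. f x y)" for rs
      unfolding sum_pure2_apply[OF b]
      by (simp add: linear_sum_list[OF \<phi>] o_def case_prod_unfold)
    with eq ne show False
      by metis
  qed
  show ?thesis
    unfolding lift2_def by (rule some_equality) (use uniq in blast)+
qed

lemma lift3_sum:
  assumes "vector_space s" and f: "trilinear_map s f"
  shows "lift3 f (\<Sum>(x, y, z)\<leftarrow>ps. pure3 x y z) = (\<Sum>(x, y, z)\<leftarrow>ps. f x y z)"
proof -
  have uniq: "(\<Sum>(x, y, z)\<leftarrow>qs. f x y z) = (\<Sum>(x, y, z)\<leftarrow>ps. f x y z)"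
    if eq: "(\<Sum>(x, y, z)\<leftarrow>ps. pure3 x y z) = (\<Sum>(x, y, z)\<leftarrow>qs. pure3 x y z)" for qs
  proof (rule ccontr)
    assume "\<not> ?thesis"
    from exists_separating_functional[OF assms(1) this] obtain \<phi>
      where \<phi>: "Vector_Spaces.linear s (*) \<phi>"
        and ne: "\<phi> (\<Sum>(x, y, z)\<leftarrow>qs. f x y z) \<noteq> \<phi> (\<Sum>(x, y, z)\<leftarrow>ps. f x y z)"
      by blast
    have b: "trilinear_map (*) (\<lambda>x y z. \<phi> (f x y z))"
      using f Vector_Spaces.linear_compose[OF _ \<phi>]
      unfolding trilinear_map_def by (auto simp: o_def)
    have "(\<Sum>(x, y, z)\<leftarrow>rs. pure3 x y z) (\<lambda>x y z. \<phi> (f x y z)) = \<phi> (\<Sum>(x, y, z)\<leftarrow>rs. f x y z)" for rs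
      unfolding sum_pure3_apply[OF b]
      by (simp add: linear_sum_list[OF \<phi>] o_def case_prod_unfold)
    with eq ne show False
      by metis
  qed
  show ?thesis
    unfolding lift3_def by (rule some_equality) (use uniq in blast)+
qed

end


section \<open>Weak Hopf algebras\<close>

locale unital_algebra = tensor_powers scale
  for scale :: "'k::field \<Rightarrow> 'h::{ring, monoid_mult} \<Rightarrow> 'h" (infixr \<open>*s\<close> 75) +
  assumes scale_mult_left: "(c *s x) * y = c *s (x * y)"
    and scale_mult_right: "x * (c *s y) = c *s (x * y)"
begin

definition mult2 :: "('k, 'h) tensor2 \<Rightarrow> ('k, 'h) tensor2 \<Rightarrow> ('k, 'h) tensor2" (infixl \<open>\<cdot>\<^sub>2\<close> 70) where
  "t \<cdot>\<^sub>2 u = lift2 (\<lambda>a b. lift2 (\<lambda>c d. pure2 (a * c) (b * d)) u) t"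

definition mult3 :: "('k, 'h) tensor3 \<Rightarrow> ('k, 'h) tensor3 \<Rightarrow> ('k, 'h) tensor3" (infixl \<open>\<cdot>\<^sub>3\<close> 70) where
  "t \<cdot>\<^sub>3 u = lift3 (\<lambda>a b c. lift3 (\<lambda>d e f. pure3 (a * d) (b * e) (c * f)) u) t"

end

locale weak_hopf_algebra = unital_algebra scale
  for scale :: "'k::field \<Rightarrow> 'h::{ring, monoid_mult} \<Rightarrow> 'h" (infixr \<open>*s\<close> 75) +
  fixes \<Delta> :: "'h \<Rightarrow> ('k, 'h) tensor2"
    and \<epsilon> :: "'h \<Rightarrow> 'k"
    and S :: "'h \<Rightarrow> 'h"
  assumes comult_in_tensor_square: "\<Delta> h \<in> tensor_square"
    and linear_comult: "Vector_Spaces.linear scale fun_scale \<Delta>"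
    and linear_counit: "Vector_Spaces.linear scale (*) \<epsilon>"
    and linear_antipode: "Vector_Spaces.linear scale scale S"
    and coassoc:
      "lift2 (\<lambda>x y. tensor_right (\<Delta> x) y) (\<Delta> h) = lift2 (\<lambda>x y. tensor_left x (\<Delta> y)) (\<Delta> h)"
    and counit_left: "lift2 (\<lambda>x y. \<epsilon> x *s y) (\<Delta> h) = h"
    and counit_right: "lift2 (\<lambda>x y. \<epsilon> y *s x) (\<Delta> h) = h"
    and comult_mult: "\<Delta> (h * g) = \<Delta> h \<cdot>\<^sub>2 \<Delta> g"
    and comult_one1:
      "lift2 (\<lambda>x y. tensor_right (\<Delta> x) y) (\<Delta> 1) = tensor_right (\<Delta> 1) 1 \<cdot>\<^sub>3 tensor_left 1 (\<Delta> 1)"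
    and comult_one2:
      "lift2 (\<lambda>x y. tensor_right (\<Delta> x) y) (\<Delta> 1) = tensor_left 1 (\<Delta> 1) \<cdot>\<^sub>3 tensor_right (\<Delta> 1) 1"
    and counit_mult1: "\<epsilon> (f * g * h) = lift2 (\<lambda>x y. \<epsilon> (f * x) * \<epsilon> (y * h)) (\<Delta> g)"
    and counit_mult2: "\<epsilon> (f * g * h) = lift2 (\<lambda>x y. \<epsilon> (f * y) * \<epsilon> (x * h)) (\<Delta> g)"
    and antipode_right:
      "lift2 (\<lambda>x y. x * S y) (\<Delta> h) = lift2 (\<lambda>x y. \<epsilon> x *s y) (\<Delta> 1 \<cdot>\<^sub>2 pure2 h 1)"
    and antipode_left:
      "lift2 (\<lambda>x y. S x * y) (\<Delta> h) = lift2 (\<lambda>x y. \<epsilon> y *s x) (pure2 1 h \<cdot>\<^sub>2 \<Delta> 1)"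
    and antipode_sandwich:
      "S h = lift3 (\<lambda>x y z. S x * y * S z) (lift2 (\<lambda>x y. tensor_right (\<Delta> x) y) (\<Delta> h))"
begin

definition target_counital :: "'h \<Rightarrow> 'h" (\<open>\<epsilon>\<^sub>t\<close>) where
  "\<epsilon>\<^sub>t h = lift2 (\<lambda>x y. \<epsilon> (x * h) *s y) (\<Delta> 1)"

definition source_counital :: "'h \<Rightarrow> 'h" (\<open>\<epsilon>\<^sub>s\<close>) where
  "\<epsilon>\<^sub>s h = lift2 (\<lambda>x y. \<epsilon> (h * y) *s x) (\<Delta> 1)"

definition target_base :: "'h set" where
  "target_base = range \<epsilon>\<^sub>t"

definition source_base :: "'h set" where
  "source_base = range \<epsilon>\<^sub>s"

text \<open>The algebra underlying the dual: linear functionals with the convolution product.\<close>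

definition dual_algebra :: "('h \<Rightarrow> 'k) ring" where
  "dual_algebra =
     \<lparr>carrier = {\<phi>. Vector_Spaces.linear scale (*) \<phi>},
      monoid.mult = (\<lambda>\<phi> \<psi> h. lift2 (\<lambda>x y. \<phi> x * \<psi> y) (\<Delta> h)),
      one = \<epsilon>,
      zero = (\<lambda>_. 0),
      add = (\<lambda>\<phi> \<psi> h. \<phi> h + \<psi> h)\<rparr>"

end

end

theory Submission
  imports Defs Complex_Main
begin

text \<open>Write \<open>L\<close> for the common base. Its elements may be moved to either side of either leg of \<open>\<Delta> 1\<close>;
  this makes \<open>L\<close> commutative, makes the antipode the identity on \<open>L\<close>, and makes \<open>\<Delta> 1\<close> a separability
  idempotent of \<open>L\<close>. Over an algebraically closed field \<open>L\<close> is therefore spanned by a set \<open>E\<close> of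
  orthogonal idempotents, and \<open>\<Delta> 1 = (\<Sum>e\<in>E. e \<otimes> e)\<close> (\<open>comult_one_diagonal\<close>). So \<open>H\<close> is a category with
  object set \<open>E\<close> whose morphism spaces \<open>e H f\<close> are coalgebras and whose corners \<open>e H e\<close> are Hopf
  algebras, and the theorem of Larson and Radford for Hopf algebras can be adapted.

  Semisimplicity of \<open>H\<close> provides a left integral \<open>\<Lambda>\<close> with counit 1 in each corner \<open>e H e\<close>
  (\<open>left_integral_exists\<close>). The map \<open>\<phi> \<mapsto> \<Lambda>\<^sub>1 \<phi> \<Lambda>\<^sub>2\<close> from the dual to \<open>H\<close> is bijective, and
  \<open>H\<close> is spanned by the legs of \<open>\<Lambda>\<close>, hence finite-dimensional. The preimage \<open>\<lambda>\<^sub>0\<close> of 1 is an integral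
  of the dual. If \<open>\<lambda>\<^sub>0 e \<noteq> 0\<close> for all \<open>e\<close>, then \<open>\<lambda>\<^sub>0\<close> can be normalised and Maschke's averaging
  argument applies to the dual (\<open>dual_algebra_semisimple\<close>). Evaluating a trace with the legs of \<open>\<Lambda>\<close> as
  dual bases gives \<open>\<lambda>\<^sub>0 e\<close> as the trace of the square of the antipode on \<open>e H e\<close>
  (\<open>trace_antipode_square\<close>).

  Semisimplicity is used once more, now together with characteristic 0, to show that this trace does not
  vanish. The square of the antipode is the Nakayama automorphism of \<open>\<lambda>\<^sub>0\<close>. As the trace form of \<open>H\<close> is symmetric and
  nondegenerate, the Nakayama automorphism is the conjugation by some \<open>u\<close>. The fourth power of the
  antipode is the conjugation by an element that is group-like in each corner, which therefore has
  finite order there, and \<open>u\<close> can be chosen to have finite order in each corner as well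
  (\<open>antipode_square_inner\<close>, \<open>modular_finite_order\<close>). The trace of the conjugation by \<open>u\<close> is the sum over
  the simple blocks of \<open>tr u * tr (inverse u)\<close>. For complex numbers this is a sum of squares
  of absolute values to which the trivial representation contributes a positive term. It is an
  integral polynomial in a root of unity, so its nonvanishing carries over to the field at hand
  (\<open>trace_conjugation_nonzero\<close>).\<close>



section \<open>Conjugate roots of unity\<close>

definition rat_eval :: "rat poly \<Rightarrow> 'a::field_char_0 \<Rightarrow> 'a" where
  "rat_eval p x = poly (map_poly of_rat p) x"

lemma rat_eval_pCons [simp]: "rat_eval (pCons a p) x = of_rat a + x * rat_eval p x"
  by (simp add: rat_eval_def map_poly_pCons)

lemma rat_eval_0 [simp]: "rat_eval 0 x = 0"
  by (simp add: rat_eval_def)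

lemma rat_eval_add [simp]: "rat_eval (p + q) x = rat_eval p x + rat_eval q x"
  by (induction p q rule: poly_induct2) (simp_all add: of_rat_add algebra_simps)

lemma rat_eval_smult [simp]: "rat_eval (smult c p) x = of_rat c * rat_eval p x"
  by (induction p) (simp_all add: of_rat_mult algebra_simps)

lemma rat_eval_mult [simp]: "rat_eval (p * q) x = rat_eval p x * rat_eval q x"
  by (induction p) (simp_all add: algebra_simps)

lemma rat_eval_1 [simp]: "rat_eval 1 x = 1"
  by (simp add: one_pCons)

lemma rat_eval_diff [simp]: "rat_eval (p - q) x = rat_eval p x - rat_eval q x"
  using rat_eval_add[of "p - q" q x] by (simp add: algebra_simps)

lemma rat_eval_sum [simp]: "rat_eval (\<Sum>i\<in>I. p i) x = (\<Sum>i\<in>I. rat_eval (p i) x)"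
  by (induction I rule: infinite_finite_induct) simp_all

lemma rat_eval_monom [simp]: "rat_eval (monom c n) x = of_rat c * x ^ n"
  by (induction n) (simp_all add: monom_0 monom_Suc)

text \<open>Division with remainder by a nonzero annihilating polynomial of least degree.\<close>

lemma minimal_polynomial_exists:
  fixes x :: "'a::field_char_0"
  assumes "q \<noteq> 0" and "rat_eval q x = 0"
  shows "\<exists>m. m \<noteq> 0 \<and> (\<forall>p. rat_eval p x = 0 \<longleftrightarrow> m dvd p)"
proof -
  obtain m where m: "m \<noteq> 0 \<and> rat_eval m x = 0"
    and min: "\<And>p. p \<noteq> 0 \<and> rat_eval p x = 0 \<Longrightarrow> degree m \<le> degree p"
    using ex_has_least_nat[of "\<lambda>p. p \<noteq> 0 \<and> rat_eval p x = 0" q degree] assms by blast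
  have "m dvd p" if p: "rat_eval p x = 0" for p
  proof -
    have "rat_eval p x = rat_eval (p div m * m) x + rat_eval (p mod m) x"
      by (metis rat_eval_add div_mult_mod_eq)
    then have "rat_eval (p mod m) x = 0"
      using p m by simp
    then have "p mod m = 0"
      using min[of "p mod m"] degree_mod_less[of m p] m by force
    then show ?thesis by auto
  qed
  moreover have "rat_eval p x = 0" if "m dvd p" for p
    using that m by (auto simp: dvd_def)
  ultimately show ?thesis using m by blast
qed

text \<open>The minimal polynomial over the rationals of an algebraic complex number has a root in
  every algebraically closed field of characteristic 0, and by irreducibility that root satisfies
  exactly the same rational equations. This replaces complex conjugation and positivity, which
  make no sense in an abstract field.\<close>

lemma conjugate_root_exists:
  fixes \<omega> :: complex
  assumes q: "q \<noteq> 0" "rat_eval q \<omega> = 0"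
  shows "\<exists>\<zeta>::'k::{alg_closed_field, field_char_0}. \<forall>p. rat_eval p \<zeta> = 0 \<longleftrightarrow> rat_eval p \<omega> = 0"
proof -
  obtain m where m: "m \<noteq> 0" and m_iff: "\<And>p. rat_eval p \<omega> = 0 \<longleftrightarrow> m dvd p"
    using minimal_polynomial_exists[OF q] by blast
  have "degree m > 0"
  proof (rule ccontr)
    assume "\<not> degree m > 0"
    then have "m dvd 1" using m by (metis gr0I is_unit_iff_degree)
    then show False using m_iff[of 1] by simp
  qed
  then have "degree (map_poly (of_rat :: rat \<Rightarrow> 'k) m) > 0"
    by (subst map_poly_degree_eq) (use m in auto)
  then obtain \<zeta> :: 'k where "poly (map_poly of_rat m) \<zeta> = 0"
    using alg_closed_imp_poly_has_root by blast
  then have \<zeta>: "rat_eval m \<zeta> = 0" by (simp add: rat_eval_def)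
  obtain m' where m': "m' \<noteq> 0" and m'_iff: "\<And>p. rat_eval p \<zeta> = 0 \<longleftrightarrow> m' dvd p"
    using minimal_polynomial_exists[OF m \<zeta>] by blast
  obtain h where h: "m = m' * h" using m'_iff \<zeta> by (auto simp: dvd_def)
  have "degree m' > 0"
  proof (rule ccontr)
    assume "\<not> degree m' > 0"
    then have "m' dvd 1" using m' by (metis gr0I is_unit_iff_degree)
    then show False using m'_iff[of 1] by simp
  qed
  moreover have "h \<noteq> 0" using h m by auto
  ultimately have "degree h < degree m"
    using m' by (simp add: h degree_mult_eq)
  then have "\<not> m dvd h" using \<open>h \<noteq> 0\<close> by (meson dvd_imp_degree_le not_less)
  then have "rat_eval m' \<omega> = 0"
    using m_iff[of h] m_iff[of m] h by simp
  then have "m dvd m'" using m_iff by simp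
  then have "m dvd p \<longleftrightarrow> m' dvd p" for p
    by (metis dvd_trans dvd_triv_left h)
  then show ?thesis using m_iff m'_iff by blast
qed

lemma sum_powers_root_of_unity:
  fixes z :: "'a::field"
  assumes "z ^ M = 1" and "z \<noteq> 1"
  shows "(\<Sum>a<M. z ^ a) = 0"
  using geometric_sum[of z M] assms by simp

text \<open>For a conjugate \<open>\<zeta>\<close> of \<open>\<omega> = cis (2 * pi / M)\<close>, a sum \<open>\<Sum> m a b * \<zeta> ^ a / \<zeta> ^ b\<close> with natural
  coefficients can vanish only if the same sum in \<open>\<omega>\<close> does. Negative powers are written as
  \<open>\<zeta> ^ (M - b)\<close>.\<close>

lemma primitive_root_of_unity_exists:
  assumes M: "M > (0::nat)"
  shows "\<exists>(\<zeta>::'k::{alg_closed_field, field_char_0}) \<omega>::complex. \<zeta> ^ M = 1 \<and> cmod \<omega> = 1 \<and> \<omega> ^ M = 1 \<and>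
    (\<forall>j. 0 < j \<longrightarrow> j < M \<longrightarrow> \<zeta> ^ j \<noteq> 1) \<and>
    (\<forall>(m :: nat \<Rightarrow> nat \<Rightarrow> nat). (\<Sum>a<M. \<Sum>b<M. of_nat (m a b) * \<zeta> ^ a * \<zeta> ^ (M - b)) = 0 \<longrightarrow>
       (\<Sum>a<M. \<Sum>b<M. of_nat (m a b) * \<omega> ^ a * \<omega> ^ (M - b)) = 0)"
proof -
  let ?\<omega> = "cis (2 * pi / real M)"
  have \<omega>: "?\<omega> ^ M = 1"
    using M by (simp add: DeMoivre)
  let ?q = "\<lambda>j. monom 1 j - 1 :: rat poly"
  have "coeff (?q M) M = 1"
    using M by simp
  then have "?q M \<noteq> 0" by (metis coeff_0 zero_neq_one)
  moreover have "rat_eval (?q M) ?\<omega> = 0" using \<omega> by simp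
  ultimately obtain \<zeta> :: 'k where
    \<zeta>: "\<And>p. rat_eval p \<zeta> = 0 \<longleftrightarrow> rat_eval p ?\<omega> = 0"
    using conjugate_root_exists by blast
  have "\<zeta> ^ M = 1" using \<zeta>[of "?q M"] \<omega> by simp
  moreover have "\<zeta> ^ j \<noteq> 1" if "0 < j" "j < M" for j
  proof
    assume "\<zeta> ^ j = 1"
    then have "?\<omega> ^ j = 1" using \<zeta>[of "?q j"] by simp
    then have "cis (2 * pi * real j / real M) = 1"
      by (simp add: DeMoivre mult_ac)
    then have "cos (2 * pi * real j / real M) = 1"
      by (metis cis.simps(1) one_complex.simps(1))
    then obtain n :: int where "2 * pi * real j / real M = of_int n * 2 * pi"
      using cos_one_2pi_int by blast
    then have "real j = of_int n * real M"
      using M by (simp add: field_simps)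
    then have n: "int j = n * int M"
      by (metis of_int_eq_iff of_int_mult of_int_of_nat_eq)
    have "0 < n * int M" using n that by linarith
    then have "0 < n" by (simp add: zero_less_mult_iff)
    then have "1 * int M \<le> n * int M" by (intro mult_right_mono) auto
    then show False using n that by linarith
  qed
  moreover have "(\<Sum>a<M. \<Sum>b<M. of_nat (m a b) * ?\<omega> ^ a * ?\<omega> ^ (M - b)) = 0"
    if "(\<Sum>a<M. \<Sum>b<M. of_nat (m a b) * \<zeta> ^ a * \<zeta> ^ (M - b)) = 0" for m :: "nat \<Rightarrow> nat \<Rightarrow> nat"
  proof -
    let ?p = "(\<Sum>a<M. \<Sum>b<M. monom (of_nat (m a b)) a * monom 1 (M - b)) :: rat poly"
    show ?thesis
      using \<zeta>[of ?p] that
      by (simp only: rat_eval_sum rat_eval_mult rat_eval_monom of_rat_of_nat_eq of_rat_1 mult_1 simp_thms)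
  qed
  ultimately show ?thesis using \<omega> by (intro exI[of _ \<zeta>] exI[of _ ?\<omega>]) auto
qed

text \<open>The hypothesis holds for symmetric matrices of rank one. It says that the entries are
  \<open>s\<^sub>a * s\<^sub>b\<close> for the square roots \<open>s\<close> of the diagonal, and the conjugate of a root of unity is its
  inverse.\<close>

lemma rank_one_sum_eq_norm:
  fixes m :: "nat \<Rightarrow> nat \<Rightarrow> nat" and \<omega> :: complex
  assumes "cmod \<omega> = 1" and "\<omega> ^ M = 1"
    and "\<And>a b. a < M \<Longrightarrow> b < M \<Longrightarrow> (m a b)\<^sup>2 = m a a * m b b"
  shows "(\<Sum>a<M. \<Sum>b<M. of_nat (m a b) * \<omega> ^ a * \<omega> ^ (M - b)) =
    of_real ((cmod (\<Sum>a<M. of_real (sqrt (m a a)) * \<omega> ^ a))\<^sup>2)"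
proof -
  let ?s = "\<lambda>a. complex_of_real (sqrt (m a a))"
  have m: "of_nat (m a b) = ?s a * ?s b" if "a < M" "b < M" for a b
  proof -
    have "real (m a b) = sqrt (real (m a a * m b b))"
      by (subst assms(3)[OF that, symmetric]) simp
    then have "real (m a b) = sqrt (m a a) * sqrt (m b b)"
      by (simp add: real_sqrt_mult)
    then show ?thesis by (metis of_real_mult of_real_of_nat_eq)
  qed
  have \<omega>: "\<omega> ^ (M - b) = cnj (\<omega> ^ b)" if "b < M" for b
  proof -
    have "\<omega> ^ (M - b) * \<omega> ^ b = 1"
      using that assms(2) by (simp flip: power_add)
    moreover have "cnj (\<omega> ^ b) * \<omega> ^ b = 1"
      using assms(1) complex_norm_square[of "\<omega> ^ b"] by (simp add: norm_power mult.commute)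
    ultimately show ?thesis
      by (metis mult_cancel_right mult_zero_right zero_neq_one)
  qed
  have "(\<Sum>a<M. \<Sum>b<M. of_nat (m a b) * \<omega> ^ a * \<omega> ^ (M - b)) =
      (\<Sum>a<M. \<Sum>b<M. (?s a * \<omega> ^ a) * cnj (?s b * \<omega> ^ b))"
    by (intro sum.cong refl) (simp add: m \<omega>)
  also have "\<dots> = (\<Sum>a<M. ?s a * \<omega> ^ a) * cnj (\<Sum>b<M. ?s b * \<omega> ^ b)"
    by (simp only: cnj_sum sum_product)
  finally show ?thesis by (simp only: complex_norm_square)
qed


section \<open>Linear algebra\<close>

context vector_space
begin

lemma dim_strict_mono:
  assumes "subspace A" and "A \<subset> B" and "subspace B" and "finite F" and "B \<subseteq> span F"
  shows "dim A < dim B"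
proof -
  obtain C where C: "C \<subseteq> A" "independent C" "A \<subseteq> span C"
    using basis_exists[of A] by metis
  obtain D where D: "C \<subseteq> D" "D \<subseteq> B" "independent D" "B \<subseteq> span D"
    using maximal_independent_subset_extend[of C B] C(1,2) assms(2) by (metis psubset_imp_subset subset_trans)
  have "finite D"
    using independent_span_bound[OF assms(4) D(3)] subset_trans[OF D(2) assms(5)] by simp
  moreover have "C \<noteq> D"
    using D(4) span_minimal[OF C(1) assms(1)] assms(2) by (metis subset_trans psubset_eq subset_antisym)
  ultimately have "card C < card D"
    using D(1) by (intro psubset_card_mono) auto
  then show ?thesis
    using basis_card_eq_dim[OF C(1,3,2)] basis_card_eq_dim[OF D(2,4,3)] by simp
qed

lemma family_dependent:
  assumes "finite F" and "finite I" and "card I > card F" and "\<And>i. i \<in> I \<Longrightarrow> w i \<in> span F"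
  shows "\<exists>c. (\<exists>i\<in>I. c i \<noteq> 0) \<and> (\<Sum>i\<in>I. scale (c i) (w i)) = 0"
proof (cases "inj_on w I")
  case False
  then obtain i j where ij: "i \<in> I" "j \<in> I" "i \<noteq> j" "w i = w j"
    by (auto simp: inj_on_def)
  have "(\<Sum>k\<in>I. scale (if k = i then 1 else if k = j then - 1 else 0) (w k)) =
      (\<Sum>k\<in>I. (if k = i then w i else 0) + (if k = j then - w j else 0))"
    by (rule sum.cong) (use ij in auto)
  also have "\<dots> = 0"
    using ij assms(2) by (simp add: sum.distrib)
  finally show ?thesis
    using ij by (intro exI[of _ "\<lambda>k. if k = i then 1 else if k = j then - 1 else 0"]) auto
next
  case True
  have "dependent (w ` I)"
  proof (rule ccontr)
    assume "\<not> dependent (w ` I)"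
    then have "card (w ` I) \<le> card F"
      using independent_span_bound[OF assms(1), of "w ` I"] assms(4) by blast
    then show False using True assms(3) by (simp add: card_image)
  qed
  then obtain u where "\<exists>v\<in>w ` I. u v \<noteq> 0" "(\<Sum>v\<in>w ` I. scale (u v) v) = 0"
    using assms(2) by (auto simp: dependent_finite)
  then show ?thesis
    using True by (intro exI[of _ "u \<circ> w"]) (auto simp: sum.reindex)
qed

end

lemma linear_sum':
  "Vector_Spaces.linear s s' \<phi> \<Longrightarrow> \<phi> (sum v I) = (\<Sum>i\<in>I. \<phi> (v i))"
  by (simp add: linear_iff_module_hom module_hom.sum)

context finite_dimensional_vector_space
begin

definition trace :: "('b \<Rightarrow> 'b) \<Rightarrow> 'a" where
  "trace f = (\<Sum>b\<in>Basis. representation Basis (f b) b)"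

lemma representation_Basis_linear:
  "Vector_Spaces.linear scale (*) (\<lambda>x. representation Basis x b)"
  by (intro linear_representation) (simp_all add: independent_Basis span_Basis)

lemma representation_Basis_sum: "(\<Sum>b\<in>Basis. scale (representation Basis x b) b) = x"
  by (rule sum_representation_eq) (auto simp: independent_Basis span_Basis finite_Basis)

text \<open>A trace can be read off from any expression as a sum of rank-one maps, not only from the
  expansion in a basis.\<close>

lemma trace_rank_one_sum:
  assumes \<xi>: "\<And>i. i \<in> I \<Longrightarrow> Vector_Spaces.linear scale (*) (\<xi> i)"
    and f: "\<And>x. f x = (\<Sum>i\<in>I. scale (\<xi> i x) (v i))"
  shows "trace f = (\<Sum>i\<in>I. \<xi> i (v i))"
proof -
  have rep: "representation Basis (\<Sum>i\<in>I. scale (c i) (v i)) b = (\<Sum>i\<in>I. c i * representation Basis (v i) b)"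
    for c b
    by (subst linear_sum'[OF representation_Basis_linear])
      (simp add: representation_scale[OF independent_Basis] span_Basis)
  have \<xi>v: "\<xi> i (v i) = (\<Sum>b\<in>Basis. \<xi> i b * representation Basis (v i) b)" if "i \<in> I" for i
  proof -
    interpret \<xi>: Vector_Spaces.linear scale "(*)" "\<xi> i" by (rule \<xi>[OF that])
    have "\<xi> i (v i) = \<xi> i (\<Sum>b\<in>Basis. scale (representation Basis (v i) b) b)"
      by (simp only: representation_Basis_sum)
    then show ?thesis
      by (simp add: \<xi>.sum \<xi>.scale mult.commute)
  qed
  have "trace f = (\<Sum>b\<in>Basis. \<Sum>i\<in>I. \<xi> i b * representation Basis (v i) b)"
    by (simp add: trace_def f rep)
  also have "\<dots> = (\<Sum>i\<in>I. \<Sum>b\<in>Basis. \<xi> i b * representation Basis (v i) b)"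
    by (rule sum.swap)
  finally show ?thesis by (simp add: \<xi>v)
qed

lemma trace_dual_family:
  assumes "\<And>i. i \<in> I \<Longrightarrow> Vector_Spaces.linear scale (*) (\<xi> i)"
    and v: "\<And>x. x = (\<Sum>i\<in>I. scale (\<xi> i x) (v i))"
    and f: "Vector_Spaces.linear scale scale f"
  shows "trace f = (\<Sum>i\<in>I. \<xi> i (f (v i)))"
proof (rule trace_rank_one_sum[OF assms(1)])
  interpret f: Vector_Spaces.linear scale scale f by (rule f)
  show "f x = (\<Sum>i\<in>I. scale (\<xi> i x) (f (v i)))" for x
    by (subst v[of x]) (simp add: f.sum f.scale)
qed

lemma trace_commute:
  assumes f: "Vector_Spaces.linear scale scale f" and g: "Vector_Spaces.linear scale scale g"
  shows "trace (\<lambda>x. f (g x)) = trace (\<lambda>x. g (f x))"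
proof -
  interpret f: Vector_Spaces.linear scale scale f by (rule f)
  have "f (g x) = (\<Sum>b\<in>Basis. scale (representation Basis (g x) b) (f b))" for x
    by (subst representation_Basis_sum[of "g x", symmetric]) (simp only: f.sum f.scale)
  moreover have "Vector_Spaces.linear scale (*) (\<lambda>x. representation Basis (g x) b)" for b
    using Vector_Spaces.linear_compose[OF g representation_Basis_linear] by (simp add: o_def)
  ultimately have "trace (\<lambda>x. f (g x)) = (\<Sum>b\<in>Basis. representation Basis (g (f b)) b)"
    by (intro trace_rank_one_sum) auto
  then show ?thesis by (simp add: trace_def)
qed

lemma trace_sum: "trace (\<lambda>x. \<Sum>i\<in>I. f i x) = (\<Sum>i\<in>I. trace (f i))"
proof -
  have "trace (\<lambda>x. \<Sum>i\<in>I. f i x) = (\<Sum>b\<in>Basis. \<Sum>i\<in>I. representation Basis (f i b) b)"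
    by (simp add: trace_def linear_sum'[OF representation_Basis_linear])
  also have "\<dots> = (\<Sum>i\<in>I. trace (f i))"
    unfolding trace_def by (rule sum.swap)
  finally show ?thesis .
qed

lemma trace_scale: "trace (\<lambda>x. scale c (f x)) = c * trace f"
  by (simp add: trace_def sum_distrib_left representation_scale[OF independent_Basis] span_Basis)

lemma trace_add: "trace (\<lambda>x. f x + g x) = trace f + trace g"
  by (simp add: trace_def sum.distrib representation_add[OF independent_Basis] span_Basis)

text \<open>An idempotent fixes a basis of its range pointwise, so its trace is the number of elements of that
  basis.\<close>

lemma trace_idempotent:
  assumes f: "Vector_Spaces.linear scale scale f" and ff: "\<And>x. f (f x) = f x"
  shows "\<exists>n. trace f = of_nat n \<and> (n = 0 \<longrightarrow> (\<forall>x. f x = 0))"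
proof -
  interpret f: Vector_Spaces.linear scale scale f by (rule f)
  obtain B where B: "B \<subseteq> range f" "independent B" "range f \<subseteq> span B"
    using basis_exists[of "range f"] by metis
  have fB: "finite B" using B(2) by (rule finiteI_independent)
  have "span B = range f"
    using B by (intro antisym span_minimal f.subspace_image subspace_UNIV)
  have lin: "Vector_Spaces.linear scale (*) (\<lambda>x. representation B (f x) b)" for b
  proof (subst Vector_Spaces.linear_iff, intro conjI allI)
    show "vector_space ((*) :: 'a \<Rightarrow> 'a \<Rightarrow> 'a)"
      by unfold_locales (auto simp: algebra_simps)
    show "vector_space scale" by (rule vector_space_axioms)
  qed (use B(2,3) in \<open>auto simp: f.add f.scale representation_add representation_scale image_subset_iff\<close>)
  have fx: "f x = (\<Sum>b\<in>B. scale (representation B (f x) b) b)" for x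
  proof -
    have "f x \<in> span B" using B(3) by blast
    then show ?thesis using sum_representation_eq[OF B(2) _ fB order_refl] by simp
  qed
  have "trace f = (\<Sum>b\<in>B. representation B (f b) b)"
    by (rule trace_rank_one_sum[OF lin fx])
  also have "\<dots> = (\<Sum>b\<in>B. 1)"
  proof (rule sum.cong[OF refl])
    fix b assume b: "b \<in> B"
    then obtain y where "b = f y" using B(1) by blast
    then have "f b = b" using ff by simp
    then show "representation B (f b) b = 1"
      using representation_basis[OF B(2) b] by simp
  qed
  finally have "trace f = of_nat (card B)" by simp
  moreover have "card B = 0 \<longrightarrow> (\<forall>x. f x = 0)"
    using fB by (subst fx) simp
  ultimately show ?thesis by (intro exI conjI)
qed

end

section \<open>Algebras over a field\<close>

definition orthogonal_idempotents :: "'a::ring set \<Rightarrow> bool" where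
  "orthogonal_idempotents E \<longleftrightarrow> finite E \<and> 0 \<notin> E \<and> (\<forall>e\<in>E. \<forall>f\<in>E. e * f = (if e = f then e else 0))"

lemma orthogonal_idempotents_mult:
  "orthogonal_idempotents E \<Longrightarrow> e \<in> E \<Longrightarrow> f \<in> E \<Longrightarrow> e * f = (if e = f then e else 0)"
  by (simp add: orthogonal_idempotents_def)

lemma orthogonal_idempotents_sum_mult:
  assumes "orthogonal_idempotents E" and "e \<in> E"
  shows "\<Sum>E * e = e"
proof -
  have "\<Sum>E * e = (\<Sum>f\<in>E. if f = e then e else 0)"
    unfolding sum_distrib_right
    by (rule sum.cong) (use assms in \<open>auto simp: orthogonal_idempotents_mult\<close>)
  then show ?thesis using assms by (simp add: orthogonal_idempotents_def)
qed

lemma orthogonal_idempotents_Un: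
  assumes "orthogonal_idempotents E" and "orthogonal_idempotents F"
    and "\<And>e f. e \<in> E \<Longrightarrow> f \<in> F \<Longrightarrow> e * f = 0" "\<And>e f. e \<in> E \<Longrightarrow> f \<in> F \<Longrightarrow> f * e = 0"
  shows "orthogonal_idempotents (E \<union> F)"
proof -
  have "e \<notin> F" if "e \<in> E" for e
    using assms(3)[OF that, of e] orthogonal_idempotents_mult[OF assms(1) that that] assms(1) that
    by (auto simp: orthogonal_idempotents_def)
  then have "e * f = (if e = f then e else 0)" if "e \<in> E \<union> F" "f \<in> E \<union> F" for e f
    using that assms(3,4) orthogonal_idempotents_mult[OF assms(1)] orthogonal_idempotents_mult[OF assms(2)]
    by (metis UnE)
  then show ?thesis using assms(1,2) unfolding orthogonal_idempotents_def by blast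
qed

context unital_algebra
begin

lemma linear_mult_left: "Vector_Spaces.linear scale scale (\<lambda>x. x * a)"
  by (simp add: Vector_Spaces.linear_iff vector_space_axioms distrib_right scale_mult_left)

lemma linear_mult_right: "Vector_Spaces.linear scale scale (\<lambda>x. a * x)"
  by (simp add: Vector_Spaces.linear_iff vector_space_axioms distrib_left scale_mult_right)

lemma orthogonal_idempotents_unit:
  assumes "orthogonal_idempotents E" and "x \<in> span E"
  shows "\<Sum>E * x = x"
  using assms(2)
  by (induction rule: span_induct_alt)
    (simp_all add: distrib_left scale_mult_right orthogonal_idempotents_sum_mult[OF assms(1)])

lemma orthogonal_idempotents_coordinate:
  assumes E: "orthogonal_idempotents E" and e: "e \<in> E" and x: "x \<in> span E"
  shows "\<exists>c. e * x = c *s e"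
  using x
proof (induction rule: span_induct_alt)
  case base
  show ?case by (rule exI[of _ 0]) simp
next
  case (step c x y)
  then obtain d where "e * y = d *s e" by blast
  then show ?case
    using step(1) orthogonal_idempotents_mult[OF E e step(1)]
    by (intro exI[of _ "(if e = x then c else 0) + d"])
      (simp add: distrib_left scale_mult_right scale_left_distrib)
qed

end

locale alg_closed_algebra = unital_algebra scale
  for scale :: "'k::alg_closed_field \<Rightarrow> 'h::{ring, monoid_mult} \<Rightarrow> 'h" (infixr \<open>*s\<close> 75)
begin

text \<open>The vectors \<open>z ^ i * x\<close> are linearly dependent, so some nonzero polynomial in \<open>z\<close> kills \<open>x\<close>. Splitting off
  its roots one after the other, the last nonzero vector on the way is an eigenvector.\<close>

lemma eigenvector_exists:
  assumes K: "subspace K" "finite F" "K \<subseteq> span F" and x: "x \<in> K" "x \<noteq> 0"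
    and z: "\<And>x. x \<in> K \<Longrightarrow> z * x \<in> K"
  shows "\<exists>v\<in>K. v \<noteq> 0 \<and> (\<exists>c. z * v = c *s v)"
proof -
  define ev where "ev N p v = (\<Sum>i\<le>N. coeff p i *s (z ^ i * v))" for N p v
  have ev_in: "ev N p v \<in> K" if "v \<in> K" for N p v
  proof -
    have "z ^ i * v \<in> K" for i
      by (induction i) (use that z in \<open>auto simp: mult.assoc\<close>)
    then show ?thesis unfolding ev_def
      by (intro subspace_sum K subspace_scale)
  qed
  have step: "\<exists>v\<in>K. v \<noteq> 0 \<and> (\<exists>c. z * v = c *s v)"
    if "degree p \<le> N" "p \<noteq> 0" "ev N p v = 0" "v \<in> K" "v \<noteq> 0" for N p v
    using that
  proof (induction N arbitrary: p)
    case 0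
    then obtain a where "p = [:a:]" by (metis degree_0_id le_zero_eq)
    with 0 show ?case by (auto simp: ev_def)
  next
    case (Suc N)
    show ?case
    proof (cases "degree p \<le> N")
      case True
      then have "ev (Suc N) p v = ev N p v" by (simp add: ev_def coeff_eq_0)
      with True Suc show ?thesis by auto
    next
      case False
      then have "degree p > 0" by auto
      then obtain c where "poly p c = 0" using alg_closed_imp_poly_has_root by blast
      then obtain q where pq: "p = [:- c, 1:] * q" by (auto simp: poly_eq_0_iff_dvd)
      have q0: "q \<noteq> 0" using pq Suc.prems by auto
      have "degree p = Suc (degree q)"
        using q0 by (subst pq, subst degree_mult_eq) auto
      then have dq: "degree q \<le> N" using Suc.prems by auto
      have "ev (Suc N) p v = (\<Sum>i\<le>Suc N. coeff (pCons 0 q) i *s (z ^ i * v)) - c *s ev (Suc N) q v"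
        by (simp add: ev_def pq scale_left_distrib sum.distrib scale_sum_right scale_left_diff_distrib sum_subtractf sum_negf
            scale_right_distrib)
      also have "(\<Sum>i\<le>Suc N. coeff (pCons 0 q) i *s (z ^ i * v)) = z * ev N q v"
        by (subst sum.atMost_Suc_shift) (simp add: ev_def sum_distrib_left scale_mult_right mult.assoc)
      also have "ev (Suc N) q v = ev N q v"
        using dq by (simp add: ev_def coeff_eq_0)
      finally have eig: "z * ev N q v = c *s ev N q v"
        using Suc.prems by simp
      show ?thesis
      proof (cases "ev N q v = 0")
        case True
        then show ?thesis using Suc.IH[OF dq q0] Suc.prems by blast
      next
        case False
        then show ?thesis using eig ev_in Suc.prems by blast
      qed
    qed
  qed
  have zx: "z ^ i * x \<in> K" for i
    by (induction i) (use x z in \<open>auto simp: mult.assoc\<close>)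
  obtain c where c: "\<exists>i\<in>{..card F}. c i \<noteq> 0" "(\<Sum>i\<in>{..card F}. c i *s (z ^ i * x)) = 0"
    using family_dependent[of F "{..card F}" "\<lambda>i. z ^ i * x"] K zx by auto
  define p where "p = (\<Sum>i\<le>card F. monom (c i) i)"
  have cp: "coeff p i = (if i \<le> card F then c i else 0)" for i
    by (simp add: p_def coeff_sum)
  then have "p \<noteq> 0" using c(1) by (metis atMost_iff coeff_0)
  moreover have "degree p \<le> card F" by (rule degree_le) (simp add: cp)
  moreover have "ev (card F) p x = 0"
    using c(2) by (simp add: ev_def cp)
  ultimately show ?thesis using step x by blast
qed

text \<open>If some \<open>z\<close> does not act by a scalar, an eigenspace of \<open>z\<close> is a proper nonzero ideal. By
  induction that ideal has a unit, which splits the algebra into two smaller ones. If all elements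
  act by scalars, the algebra is a line, spanned by an idempotent because there are no
  nilpotents.\<close>

lemma idempotent_basis_exists:
  assumes "subspace L" and "finite F" and "L \<subseteq> span F"
    and "\<And>x y. x \<in> L \<Longrightarrow> y \<in> L \<Longrightarrow> x * y \<in> L"
    and "\<And>x y. x \<in> L \<Longrightarrow> y \<in> L \<Longrightarrow> x * y = y * x"
    and "\<And>x. x \<in> L \<Longrightarrow> x * x = 0 \<Longrightarrow> x = 0"
  shows "\<exists>E. orthogonal_idempotents E \<and> span E = L"
  using assms
proof (induction "dim L" arbitrary: L rule: less_induct)
  case less
  note sub = less.prems(1) and mult = less.prems(4) and comm = less.prems(5)
    and red = less.prems(6)
  have IH: "\<exists>E. orthogonal_idempotents E \<and> span E = A"
    if A: "subspace A" "A \<subset> L" and m: "\<And>x y. x \<in> A \<Longrightarrow> y \<in> A \<Longrightarrow> x * y \<in> A" for A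
  proof (rule less.hyps[OF dim_strict_mono[OF A sub less.prems(2,3)] A(1) less.prems(2)])
    show "A \<subseteq> span F" using A(2) less.prems(3) by blast
    show "x * y \<in> A" if "x \<in> A" "y \<in> A" for x y using that by (rule m)
    show "x * y = y * x" if "x \<in> A" "y \<in> A" for x y using comm that A(2) by blast
    show "x = 0" if "x \<in> A" "x * x = 0" for x using red that A(2) by blast
  qed
  show ?case
  proof (cases "\<exists>z\<in>L. \<forall>c. \<exists>x\<in>L. z * x \<noteq> c *s x")
    case True
    then obtain z where z: "z \<in> L" and nonscalar: "\<And>c. \<exists>x\<in>L. z * x \<noteq> c *s x" by blast
    then obtain x0 where "x0 \<in> L" "x0 \<noteq> 0" by fastforce
    then obtain v c where v: "v \<in> L" "v \<noteq> 0" "z * v = c *s v"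
      using eigenvector_exists[OF sub less.prems(2,3), of x0 z] mult z by blast
    define I where "I = {x \<in> L. z * x = c *s x}"
    have subI: "subspace I" using sub
      by (auto simp: I_def subspace_def distrib_left scale_right_distrib scale_mult_right scale_left_commute)
    have IL: "I \<subset> L" using nonscalar[of c] by (auto simp: I_def)
    have ideal: "x * y \<in> I" if "x \<in> L" "y \<in> I" for x y
    proof -
      have "z * (x * y) = x * (z * y)"
        using that comm[OF z that(1)] by (metis mult.assoc)
      then show ?thesis using that mult by (auto simp: I_def scale_mult_right)
    qed
    have "x * y \<in> I" if "x \<in> I" "y \<in> I" for x y using ideal that IL by blast
    note IH_I = IH[OF subI IL this]
    obtain E where E: "orthogonal_idempotents E" "span E = I"
      using IH_I by blast
    define u where "u = \<Sum>E"
    have EI: "E \<subseteq> I" using E(2) span_superset by blast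
    have u: "u \<in> I" unfolding u_def using EI by (intro subspace_sum subI) auto
    have uI: "u * x = x" if "x \<in> I" for x
      unfolding u_def by (rule orthogonal_idempotents_unit[OF E(1)]) (simp add: E(2) that)
    define L' where "L' = {x \<in> L. u * x = 0}"
    have uL: "u \<in> L" using u IL by auto
    have "v \<in> I" using v by (auto simp: I_def)
    then have u0: "u \<noteq> 0" using uI v by force
    have subL': "subspace L'" using sub
      by (auto simp: L'_def subspace_def distrib_left scale_mult_right)
    have "u \<notin> L'" using uI[OF u] u0 by (auto simp: L'_def)
    then have L'L: "L' \<subset> L" using uL by (auto simp: L'_def)
    have "x * y \<in> L'" if "x \<in> L'" "y \<in> L'" for x y
      using that mult by (auto simp: L'_def mult.assoc[symmetric])
    note IH_L' = IH[OF subL' L'L this]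
    obtain E' where E': "orthogonal_idempotents E'" "span E' = L'"
      using IH_L' by blast
    have E'L': "E' \<subseteq> L'" using E'(2) span_superset by blast
    have orth: "e * f = 0" "f * e = 0" if "e \<in> E" "f \<in> E'" for e f
    proof -
      have "e \<in> L" "f \<in> L" using that EI IL E'L' L'L by auto
      then have "e * f = f * (u * e)" using comm uI[OF subsetD[OF EI that(1)]] by simp
      also have "\<dots> = (u * f) * e"
        using comm uL \<open>f \<in> L\<close> by (simp add: mult.assoc[symmetric])
      also have "\<dots> = 0" using that E'L' by (auto simp: L'_def)
      finally show "e * f = 0" .
      then show "f * e = 0" using comm \<open>e \<in> L\<close> \<open>f \<in> L\<close> by simp
    qed
    have "span (E \<union> E') = L"
    proof
      show "span (E \<union> E') \<subseteq> L"
        using EI IL E'L' L'L by (intro span_minimal sub) auto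
      show "L \<subseteq> span (E \<union> E')"
      proof
        fix x assume x: "x \<in> L"
        have "u * x \<in> I" using ideal[OF x u] comm[OF x uL] by simp
        moreover have "x - u * x \<in> L'"
          using x uI[OF u] subspace_diff[OF sub x mult[OF uL x]]
          by (auto simp: L'_def right_diff_distrib mult.assoc[symmetric])
        ultimately have "u * x + (x - u * x) \<in> span (E \<union> E')"
          using E(2) E'(2) span_mono[of E "E \<union> E'"] span_mono[of E' "E \<union> E'"]
          by (intro span_add) auto
        then show "x \<in> span (E \<union> E')" by simp
      qed
    qed
    then show ?thesis
      using orthogonal_idempotents_Un[OF E(1) E'(1) orth] by blast
  next
    case False
    then have scalar: "\<And>z. z \<in> L \<Longrightarrow> \<exists>c. \<forall>x\<in>L. z * x = c *s x" by blast
    show ?thesis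
    proof (cases "L = {0}")
      case True
      then show ?thesis by (intro exI[of _ "{}"]) (simp add: orthogonal_idempotents_def)
    next
      case False
      then obtain v where v: "v \<in> L" "v \<noteq> 0"
        using sub subspace_0 by blast
      obtain d where d: "\<And>x. x \<in> L \<Longrightarrow> v * x = d *s x" using scalar[OF v(1)] by blast
      have d0: "d \<noteq> 0" using d[OF v(1)] red[OF v(1)] v(2) by auto
      define e where "e = inverse d *s v"
      have ee: "e * e = e"
        using d[OF v(1)] d0 by (simp add: e_def scale_mult_left scale_mult_right)
      have "x \<in> span {e}" if x: "x \<in> L" for x
      proof -
        obtain c where c: "\<And>y. y \<in> L \<Longrightarrow> x * y = c *s y" using scalar[OF x] by blast
        have "d *s x = c *s v" using c[OF v(1)] d[OF x] comm[OF x v(1)] by simp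
        then have "x = inverse d *s c *s v"
          using d0 by (metis scale_scale left_inverse scale_one)
        also have "\<dots> = c *s e" by (simp add: e_def scale_left_commute)
        finally show ?thesis by (simp add: span_base span_scale)
      qed
      moreover have "e \<in> L" using v sub by (simp add: e_def subspace_scale)
      ultimately have "span {e} = L"
        using span_minimal[of "{e}" L] sub by blast
      moreover have "e \<noteq> 0" using d0 v by (simp add: e_def)
      ultimately show ?thesis using ee by (intro exI[of _ "{e}"]) (simp add: orthogonal_idempotents_def)
    qed
  qed
qed

end


section \<open>Symmetric and semisimple algebras\<close>

locale finite_dim_algebra = unital_algebra scale + finite_dimensional_vector_space scale Basis
  for scale :: "'k::field \<Rightarrow> 'h::{ring, monoid_mult} \<Rightarrow> 'h" (infixr \<open>*s\<close> 75)
    and Basis :: "'h set"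
begin

text \<open>An injective map from the algebra to its dual is onto for dimension reasons.\<close>

lemma functional_representable:
  assumes \<tau>: "Vector_Spaces.linear scale (*) \<tau>"
    and nondeg: "\<And>w. (\<And>y. \<tau> (w * y) = 0) \<Longrightarrow> w = 0"
    and \<phi>: "Vector_Spaces.linear scale (*) \<phi>"
  shows "\<exists>w. \<forall>y. \<phi> y = \<tau> (w * y)"
proof -
  interpret \<tau>: Vector_Spaces.linear scale "(*)" \<tau> by (rule \<tau>)
  interpret \<phi>: Vector_Spaces.linear scale "(*)" \<phi> by (rule \<phi>)
  define T where "T w = (\<Sum>b\<in>Basis. \<tau> (w * b) *s b)" for w
  have expand: "\<psi> y = (\<Sum>b\<in>Basis. representation Basis y b * \<psi> b)"
    if "Vector_Spaces.linear scale (*) \<psi>" for \<psi> :: "'h \<Rightarrow> 'k" and y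
  proof -
    interpret \<psi>: Vector_Spaces.linear scale "(*)" \<psi> by (rule that)
    have "\<psi> y = \<psi> (\<Sum>b\<in>Basis. representation Basis y b *s b)"
      by (simp only: representation_Basis_sum)
    then show ?thesis by (simp add: \<psi>.sum \<psi>.scale)
  qed
  have \<tau>w: "Vector_Spaces.linear scale (*) (\<lambda>y. \<tau> (w * y))" for w
    using Vector_Spaces.linear_compose[OF linear_mult_right \<tau>] by (simp add: o_def)
  have T: "Vector_Spaces.linear scale scale T"
    by (simp add: Vector_Spaces.linear_iff vector_space_axioms T_def distrib_right \<tau>.add
        scale_left_distrib sum.distrib scale_mult_left \<tau>.scale scale_sum_right)
  have coeff: "c b = d b" if "(\<Sum>b\<in>Basis. c b *s b) = (\<Sum>b\<in>Basis. d b *s b)" "b \<in> Basis" for c d b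
  proof -
    have "(\<Sum>b\<in>Basis. (c b - d b) *s b) = 0"
      using that(1) by (simp add: scale_left_diff_distrib sum_subtractf)
    then show ?thesis
      using independent_Basis that(2) finite_Basis
      unfolding dependent_finite[OF finite_Basis]
      by (metis eq_iff_diff_eq_0)
  qed
  have "inj T"
  proof (rule injI)
    fix w v assume "T w = T v"
    then have "\<tau> (w * b) = \<tau> (v * b)" if "b \<in> Basis" for b
      using coeff that unfolding T_def by metis
    then have "\<tau> (w * y) = \<tau> (v * y)" for y
      by (simp add: expand[OF \<tau>w, of _ y])
    then have "w - v = 0"
      by (intro nondeg) (simp add: left_diff_distrib \<tau>.diff)
    then show "w = v" by simp
  qed
  then obtain w where "T w = (\<Sum>b\<in>Basis. \<phi> b *s b)"
    using linear_inj_imp_surj[OF T] by (metis surjD)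
  then have "\<tau> (w * b) = \<phi> b" if "b \<in> Basis" for b
    using coeff that unfolding T_def by metis
  then have "\<phi> y = \<tau> (w * y)" for y
    by (simp add: expand[OF \<tau>w, of _ y] expand[OF \<phi>, of y])
  then show ?thesis by blast
qed

lemma right_cancellable_imp_invertible:
  fixes w :: 'h
  assumes "\<And>x. x * w = 0 \<Longrightarrow> x = 0"
  shows "\<exists>w'. w' * w = 1 \<and> w * w' = 1"
proof -
  have "inj (\<lambda>x. x * w)"
  proof (rule injI)
    fix x y assume "x * w = y * w"
    then have "(x - y) * w = 0" by (simp add: left_diff_distrib)
    then show "x = y" using assms[of "x - y"] by simp
  qed
  then obtain w' where w': "w' * w = 1"
    using linear_inj_imp_surj[OF linear_mult_left] by (metis surjD)
  have "(w * w' - 1) * w = 0"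
    by (simp add: left_diff_distrib mult.assoc w')
  then have "w * w' - 1 = 0" by (rule assms)
  then show ?thesis using w' by auto
qed

end

locale symmetric_algebra = finite_dim_algebra scale Basis
  for scale :: "'k::field \<Rightarrow> 'h::{ring, monoid_mult} \<Rightarrow> 'h" (infixr \<open>*s\<close> 75)
    and Basis :: "'h set" +
  fixes \<tau> :: "'h \<Rightarrow> 'k"
  assumes \<tau>_linear: "Vector_Spaces.linear scale (*) \<tau>"
    and \<tau>_commute: "\<tau> (x * y) = \<tau> (y * x)"
    and \<tau>_nondegenerate: "(\<And>y. \<tau> (x * y) = 0) \<Longrightarrow> x = 0"
begin

sublocale \<tau>: Vector_Spaces.linear scale "(*)" \<tau> by (rule \<tau>_linear)

definition dual_basis :: "'h \<Rightarrow> 'h" where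
  "dual_basis b = (SOME w. \<forall>x. representation Basis x b = \<tau> (w * x))"

lemma dual_basis: "representation Basis x b = \<tau> (x * dual_basis b)"
proof -
  have "\<forall>x. representation Basis x b = \<tau> (dual_basis b * x)"
    unfolding dual_basis_def
    by (rule someI_ex) (rule functional_representable[OF \<tau>_linear \<tau>_nondegenerate representation_Basis_linear])
  then show ?thesis by (simp add: \<tau>_commute)
qed

lemma expansion: "(\<Sum>b\<in>Basis. \<tau> (x * dual_basis b) *s b) = x"
  using representation_Basis_sum[of x] by (simp add: dual_basis)

lemma dual_expansion: "(\<Sum>b\<in>Basis. \<tau> (b * y) *s dual_basis b) = y"
proof -
  have "\<tau> (((\<Sum>b\<in>Basis. \<tau> (b * y) *s dual_basis b) - y) * x) = 0" for x
  proof -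
    have "\<tau> (y * x) = \<tau> (y * (\<Sum>b\<in>Basis. \<tau> (x * dual_basis b) *s b))"
      by (simp only: expansion)
    also have "\<dots> = (\<Sum>b\<in>Basis. \<tau> (x * dual_basis b) * \<tau> (b * y))"
      by (simp add: sum_distrib_left scale_mult_right \<tau>.sum \<tau>.scale \<tau>_commute[of y])
    also have "\<dots> = \<tau> ((\<Sum>b\<in>Basis. \<tau> (b * y) *s dual_basis b) * x)"
      by (simp add: sum_distrib_right scale_mult_left \<tau>.sum \<tau>.scale \<tau>_commute[of x] mult.commute)
    finally show ?thesis by (simp add: left_diff_distrib \<tau>.diff)
  qed
  then show ?thesis using \<tau>_nondegenerate eq_iff_diff_eq_0 by blast
qed

definition casimir :: "'h \<Rightarrow> 'h" where
  "casimir q = (\<Sum>b\<in>Basis. b * q * dual_basis b)"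

text \<open>Expanding in the two dual bases shows \<open>a b \<otimes> b\<^sup>* = b \<otimes> b\<^sup>* a\<close>, summed over the basis.\<close>

lemma casimir_central: "a * casimir q = casimir q * a"
proof -
  have "a * casimir q = (\<Sum>b\<in>Basis. (a * b) * q * dual_basis b)"
    by (simp add: casimir_def sum_distrib_left mult.assoc)
  also have "\<dots> = (\<Sum>b\<in>Basis. (\<Sum>c\<in>Basis. \<tau> (a * b * dual_basis c) *s c) * q * dual_basis b)"
    by (simp only: expansion)
  also have "\<dots> = (\<Sum>b\<in>Basis. \<Sum>c\<in>Basis. \<tau> (a * b * dual_basis c) *s (c * q * dual_basis b))"
    by (simp add: sum_distrib_right scale_mult_left)
  also have "\<dots> = (\<Sum>c\<in>Basis. \<Sum>b\<in>Basis. \<tau> (a * b * dual_basis c) *s (c * q * dual_basis b))"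
    by (rule sum.swap)
  also have "\<dots> = (\<Sum>c\<in>Basis. c * q * (\<Sum>b\<in>Basis. \<tau> (b * (dual_basis c * a)) *s dual_basis b))"
    by (simp add: sum_distrib_left scale_mult_right \<tau>_commute[of a] mult.assoc)
  also have "\<dots> = casimir q * a"
    by (simp add: dual_expansion casimir_def sum_distrib_right mult.assoc)
  finally show ?thesis .
qed

lemma linear_sandwich: "Vector_Spaces.linear scale scale (\<lambda>x. p * x * q)"
  using Vector_Spaces.linear_compose[OF linear_mult_right linear_mult_left] by (simp add: o_def)

lemma trace_sandwich: "trace (\<lambda>x. p * x * q) = \<tau> (p * casimir q)"
proof -
  have "trace (\<lambda>x. p * x * q) = (\<Sum>b\<in>Basis. \<tau> (p * b * q * dual_basis b))"
    by (simp add: trace_def dual_basis)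
  then show ?thesis
    by (simp add: casimir_def sum_distrib_left \<tau>.sum mult.assoc)
qed

text \<open>As the form is symmetric, the dual basis and the basis may exchange their roles.\<close>

lemma trace_sandwich_commute: "trace (\<lambda>x. p * x * q) = trace (\<lambda>x. q * x * p)"
proof -
  have "trace (\<lambda>x. q * x * p) = (\<Sum>b\<in>Basis. \<tau> (b * (q * dual_basis b * p)))"
  proof (rule trace_dual_family)
    show "Vector_Spaces.linear scale (*) (\<lambda>x. \<tau> (b * x))" for b
      using Vector_Spaces.linear_compose[OF linear_mult_right \<tau>_linear] by (simp add: o_def)
    show "x = (\<Sum>b\<in>Basis. \<tau> (b * x) *s dual_basis b)" for x
      by (simp only: dual_expansion)
  qed (rule linear_sandwich)
  also have "\<dots> = (\<Sum>b\<in>Basis. \<tau> (p * b * q * dual_basis b))"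
    by (rule sum.cong[OF refl]) (metis \<tau>_commute mult.assoc)
  also have "\<dots> = trace (\<lambda>x. p * x * q)"
    by (simp add: trace_def dual_basis)
  finally show ?thesis by simp
qed

end

lemma ring_of_type_simps:
  "carrier (ring_of_type :: 'a::{ring, monoid_mult} ring) = UNIV"
  "\<zero>\<^bsub>ring_of_type\<^esub> = (0 :: 'a)" "x \<oplus>\<^bsub>ring_of_type\<^esub> y = x + (y :: 'a)"
  "x \<otimes>\<^bsub>ring_of_type\<^esub> y = x * (y :: 'a)"
  by (simp_all add: ring_of_type_def)

text \<open>The component of 1 in the ideal, along a complement, is a right unit of the ideal.\<close>

lemma left_ideal_idempotent:
  fixes I :: "'a::{ring, monoid_mult} set"
  assumes "semisimple_ring (ring_of_type :: 'a ring)"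
    and "0 \<in> I" and "\<And>x y. x \<in> I \<Longrightarrow> y \<in> I \<Longrightarrow> x + y \<in> I" and "\<And>a x. x \<in> I \<Longrightarrow> a * x \<in> I"
  shows "\<exists>f\<in>I. \<forall>x\<in>I. x * f = x"
proof -
  interpret semisimple_ring "ring_of_type :: 'a ring" by (rule assms(1))
  have minus: "inv\<^bsub>add_monoid ring_of_type\<^esub> x = - x" for x :: 'a
    using minus_equality[of "- x" x] by (simp add: ring_of_type_def a_inv_def)
  have "subgroup I (add_monoid ring_of_type)"
  proof (rule add.subgroupI)
    show "I \<noteq> {}" using assms(2) by blast
    show "\<ominus>\<^bsub>ring_of_type\<^esub> x \<in> I" if "x \<in> I" for x
      using assms(4)[OF that, of "- 1"] minus[of x] by (simp add: a_inv_def)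
  qed (use assms(3) in \<open>auto simp: ring_of_type_def\<close>)
  then have "left_ideal I ring_of_type"
    using assms(4) by (auto simp: left_ideal_def additive_subgroup_def ring_of_type_def)
  then obtain J where J: "left_ideal J (ring_of_type :: 'a ring)" "I \<inter> J = {0}"
      "I <+>\<^bsub>ring_of_type\<^esub> J = UNIV"
    using complemented[of I] by (auto simp: ring_of_type_simps)
  have "1 \<in> I <+>\<^bsub>ring_of_type\<^esub> J" using J(3) by simp
  then obtain f j where fj: "f \<in> I" "j \<in> J" "1 = f + j"
    by (auto simp: set_add_def set_mult_def ring_of_type_def)
  have "x * f = x" if x: "x \<in> I" for x
  proof -
    have e: "x * j = x + - 1 * (x * f)"
      using arg_cong[OF fj(3), of "\<lambda>y. x * y"] by (simp add: distrib_left eq_diff_eq add.commute)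
    have "x * j \<in> I" unfolding e by (rule assms(3)[OF x assms(4)[OF assms(4)[OF fj(1)]]])
    moreover have "x * j \<in> J"
      using J(1) fj(2) by (auto simp: left_ideal_def ring_of_type_def)
    ultimately have "x * j = 0" using J(2) by blast
    then show ?thesis using e by simp
  qed
  then show ?thesis using fj(1) by blast
qed


locale semisimple_algebra = alg_closed_algebra scale + finite_dim_algebra scale Basis
  for scale :: "'k::{alg_closed_field, field_char_0} \<Rightarrow> 'h::{ring, monoid_mult} \<Rightarrow> 'h" (infixr \<open>*s\<close> 75)
    and Basis :: "'h set" +
  assumes semisimple: "semisimple_ring (ring_of_type :: 'h ring)"
begin

definition regular_character :: "'h \<Rightarrow> 'k" where
  "regular_character x = trace (\<lambda>y. y * x)"

text \<open>The radical of the trace form is a left ideal, hence generated by an idempotent \<open>f\<close>, and the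
  trace of right multiplication by \<open>f\<close> is the dimension of the ideal. In characteristic 0 it vanishes only if
  the ideal does.\<close>

lemma regular_character_nondegenerate:
  assumes "\<And>y. regular_character (x * y) = 0"
  shows "x = 0"
proof -
  let ?\<chi> = regular_character
  have add: "?\<chi> (x + y) = ?\<chi> x + ?\<chi> y" for x y
    by (simp add: regular_character_def distrib_left trace_add)
  have comm: "?\<chi> (x * y) = ?\<chi> (y * x)" for x y
    using trace_commute[OF linear_mult_left[of y] linear_mult_left[of x]]
    by (simp add: regular_character_def mult.assoc)
  define I where "I = {x. \<forall>y. ?\<chi> (x * y) = 0}"
  have "?\<chi> 0 = 0" using add[of 0 0] by simp
  then have "0 \<in> I" by (simp add: I_def)
  moreover have "x + y \<in> I" if "x \<in> I" "y \<in> I" for x y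
    using that by (simp add: I_def distrib_right add)
  moreover have "a * x \<in> I" if "x \<in> I" for a x
  proof -
    have "?\<chi> (a * x * y) = ?\<chi> (x * (y * a))" for y
      using comm[of a "x * y"] by (simp add: mult.assoc)
    then show ?thesis using that by (simp add: I_def)
  qed
  ultimately obtain f where f: "f \<in> I" "\<And>x. x \<in> I \<Longrightarrow> x * f = x"
    using left_ideal_idempotent[OF semisimple, of I] by blast
  have "y * f * f = y * f" for y
    using f by (simp add: mult.assoc)
  then obtain n where n: "trace (\<lambda>y. y * f) = of_nat n" "n = 0 \<longrightarrow> (\<forall>y. y * f = 0)"
    using trace_idempotent[OF linear_mult_left[of f]] by blast
  have "?\<chi> (f * 1) = 0" using f(1) unfolding I_def by blast
  then have "n = 0" using n(1) by (simp add: regular_character_def)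
  then have "f = 0" using n(2) by (metis mult_1)
  moreover have "x \<in> I" using assms by (simp add: I_def)
  ultimately show ?thesis using f(2) by force
qed

sublocale symmetric_algebra scale Basis regular_character
proof unfold_locales
  show "regular_character (x + y) = regular_character x + regular_character y" for x y
    by (simp add: regular_character_def distrib_left trace_add)
  show "regular_character (c *s x) = c * regular_character x" for c x
    by (simp add: regular_character_def scale_mult_right trace_scale)
  show "regular_character (x * y) = regular_character (y * x)" for x y
    using trace_commute[OF linear_mult_left[of y] linear_mult_left[of x]]
    by (simp add: regular_character_def mult.assoc)
qed (simp_all add: algebra_simps regular_character_nondegenerate)

definition center :: "'h set" where
  "center = {z. \<forall>x. z * x = x * z}"

lemma centerD: "z \<in> center \<Longrightarrow> z * x = x * z"
  unfolding center_def by blast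

text \<open>The centre has no nilpotents: if \<open>z\<close> is central and \<open>z * z = 0\<close>, then the left ideal generated by \<open>z\<close> has a right
  unit \<open>y * z\<close>, so that \<open>z = z * (y * z) = y * (z * z) = 0\<close>.\<close>

lemma central_idempotents_exist:
  "\<exists>C. orthogonal_idempotents C \<and> span C = center"
proof (rule idempotent_basis_exists)
  show "subspace center"
    by (simp add: center_def subspace_def distrib_left distrib_right scale_mult_left scale_mult_right)
  show "finite Basis" by (rule finite_Basis)
  show "center \<subseteq> span Basis" by (simp add: span_Basis)
  show "x * y \<in> center"
    if "x \<in> center" "y \<in> center" for x y
    using that unfolding center_def mem_Collect_eq by (metis mult.assoc)
  show "x * y = y * x"
    if "x \<in> center" "y \<in> center" for x y
    using that(1) by (rule centerD)
  show "z = 0" if z: "z \<in> center" "z * z = 0" for z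
  proof -
    have zz: "x * z = z * x" for x using centerD[OF z(1), of x] by (rule sym)
    have "\<exists>f\<in>range (\<lambda>y. y * z). \<forall>x\<in>range (\<lambda>y. y * z). x * f = x"
    proof (rule left_ideal_idempotent[OF semisimple])
      show "0 \<in> range (\<lambda>y. y * z)" by (rule range_eqI[of _ _ 0]) simp
      show "x + y \<in> range (\<lambda>y. y * z)" if "x \<in> range (\<lambda>y. y * z)" "y \<in> range (\<lambda>y. y * z)" for x y
        using that by (auto simp flip: distrib_right)
      show "a * x \<in> range (\<lambda>y. y * z)" if "x \<in> range (\<lambda>y. y * z)" for a x
        using that by (auto simp flip: mult.assoc)
    qed
    then obtain y where "\<And>x. x * z * (y * z) = x * z" by auto
    from this[of 1] have "z = z * (y * z)" by simp
    also have "\<dots> = y * (z * z)" using zz by (metis mult.assoc)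
    finally show ?thesis using z by simp
  qed
qed

text \<open>With \<open>p a\<close> the spectral idempotents of \<open>e * u\<close>, whose eigenvalues are roots of unity, the trace is
  the sum of \<open>\<zeta> ^ a / \<zeta> ^ b\<close> times the dimension of \<open>p a * H * p b\<close>. On each simple block \<open>E\<close> these dimensions form
  a symmetric matrix of rank one, because the Casimir operator takes values in the scalar
  multiples of \<open>E\<close>. For the primitive idempotent \<open>l\<close>, on which \<open>e * H\<close> acts by scalars, only one entry of the
  matrix of its block is nonzero, so the total is nonzero.\<close>

lemma trace_conjugation_nonzero:
  assumes M: "M > (0::nat)" and ee: "e * e = e" and eu: "e * u = u * e"
    and uu': "u * u' = 1" "u' * u = 1" and euM: "e * u ^ M = e"
    and l: "l \<noteq> 0" "e * l = l" "l * l = l" and act: "\<And>x. \<exists>c. e * x * l = c *s l"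
  shows "trace (\<lambda>x. e * (u * x * u') * e) \<noteq> 0"
proof
  assume trace0: "trace (\<lambda>x. e * (u * x * u') * e) = 0"
  obtain \<zeta> :: 'k and \<omega> :: complex where \<zeta>: "\<zeta> ^ M = 1" "\<And>j. 0 < j \<Longrightarrow> j < M \<Longrightarrow> \<zeta> ^ j \<noteq> 1"
    and \<omega>: "cmod \<omega> = 1" "\<omega> ^ M = 1"
    and transfer: "\<And>m :: nat \<Rightarrow> nat \<Rightarrow> nat. (\<Sum>a<M. \<Sum>b<M. of_nat (m a b) * \<zeta> ^ a * \<zeta> ^ (M - b)) = 0 \<Longrightarrow>
       (\<Sum>a<M. \<Sum>b<M. of_nat (m a b) * \<omega> ^ a * \<omega> ^ (M - b)) = 0"
    using primitive_root_of_unity_exists[OF M, where 'k = 'k] by blast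
  define \<iota> where "\<iota> = inverse \<zeta>"
  have \<zeta>0: "\<zeta> \<noteq> 0" using \<zeta>(1) M by (metis power_0_left zero_neq_one less_irrefl)
  then have \<iota>\<zeta>: "\<iota> * \<zeta> = 1" "\<zeta> * \<iota> = 1" by (simp_all add: \<iota>_def)
  have \<iota>M: "\<iota> ^ M = 1" by (simp add: \<iota>_def power_inverse \<zeta>(1))
  have \<iota>\<zeta>n: "\<iota> ^ n * \<zeta> ^ n = 1" for n by (simp flip: power_mult_distrib add: \<iota>\<zeta>)
  have \<zeta>inj: "a = b" if "\<zeta> ^ a = \<zeta> ^ b" "a < M" "b < M" for a b
  proof -
    have "False" if "\<zeta> ^ a = \<zeta> ^ b" "a < b" "b < M" for a b
    proof -
      have "\<zeta> ^ b = \<zeta> ^ (a + (b - a))" using that by simp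
      then have "\<zeta> ^ (b - a) = 1" using that(1) \<zeta>0 unfolding power_add by simp
      then show False using \<zeta>(2)[of "b - a"] that by simp
    qed
    then show ?thesis using that by (metis linorder_neqE_nat)
  qed
  have eun: "e * u ^ k = u ^ k * e" for k
    by (induction k) (simp_all, metis eu mult.assoc)
  define g where "g a k = \<iota> ^ (a * k) *s (e * u ^ k)" for a k
  \<comment> \<open>the idempotent of the eigenvalue \<open>\<zeta> ^ a\<close> of \<open>e * u\<close>, by Fourier inversion\<close>
  define p where "p a = inverse (of_nat M) *s (\<Sum>k<M. g a k)" for a
  have M0: "(of_nat M :: 'k) \<noteq> 0" using M by simp
  have ug: "u * g a k = \<zeta> ^ a *s g a (Suc k)" for a k
  proof -
    have "\<zeta> ^ a * \<iota> ^ (a * Suc k) = \<iota> ^ (a * k)"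
      using \<iota>\<zeta>n[of a] by (simp add: power_add mult.left_commute mult.commute[of "\<iota> ^ a"])
    moreover have "u * (e * u ^ k) = e * u ^ Suc k"
      by (simp flip: mult.assoc add: eu)
    ultimately show ?thesis by (simp add: g_def scale_mult_right)
  qed
  have gM: "g a M = g a 0" for a
    by (simp add: g_def euM mult.commute[of a] power_mult \<iota>M)
  have up: "u * p a = \<zeta> ^ a *s p a" for a
  proof -
    have "(\<Sum>k<M. g a (Suc k)) = (\<Sum>k<M. g a k)"
      using sum.lessThan_Suc_shift[of "g a" M] sum.lessThan_Suc[of "g a" M] gM
      by (simp add: add.commute)
    then show ?thesis
      by (simp add: p_def scale_mult_right sum_distrib_left ug scale_left_commute flip: scale_sum_right)
  qed
  have pu: "p a * u = \<zeta> ^ a *s p a" for a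
  proof -
    have "e * u ^ k * u = u * (e * u ^ k)" for k
      by (metis eu mult.assoc power_commutes)
    then have "p a * u = u * p a"
      by (simp add: p_def g_def scale_mult_right scale_mult_left sum_distrib_left sum_distrib_right)
    then show ?thesis by (simp add: up)
  qed
  have u'p: "u' * p a = \<iota> ^ a *s p a" for a
  proof -
    have "p a = u' * (\<zeta> ^ a *s p a)" using up[of a] uu' by (metis mult.assoc mult_1)
    then have "\<iota> ^ a *s p a = \<iota> ^ a *s \<zeta> ^ a *s (u' * p a)" by (simp add: scale_mult_right)
    then show ?thesis by (simp add: \<iota>\<zeta>n)
  qed
  have ep: "e * p a = p a" for a
    by (simp add: p_def g_def scale_mult_right sum_distrib_left flip: mult.assoc) (simp add: ee)
  have unp: "u ^ k * p a = \<zeta> ^ (a * k) *s p a" for a k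
    by (induction k) (simp_all add: mult.assoc scale_mult_right up power_add mult.commute)
  have pp: "p b * p a = (if a = b then p a else 0)" if "a < M" "b < M" for a b
  proof -
    have "p b * p a = inverse (of_nat M) *s (\<Sum>k<M. \<iota> ^ (b * k) *s (e * (u ^ k * p a)))"
      by (simp add: p_def[of b] g_def scale_mult_left sum_distrib_right mult.assoc)
    also have "\<dots> = inverse (of_nat M) *s (\<Sum>k<M. (\<iota> ^ b * \<zeta> ^ a) ^ k) *s p a"
      by (simp add: unp scale_mult_right ep scale_sum_left power_mult power_mult_distrib)
    finally have eq: "p b * p a = inverse (of_nat M) *s (\<Sum>k<M. (\<iota> ^ b * \<zeta> ^ a) ^ k) *s p a" .
    show ?thesis
    proof (cases "a = b")
      case True
      then show ?thesis using eq M0 by (simp add: \<iota>\<zeta>n)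
    next
      case False
      have "(\<iota> ^ b * \<zeta> ^ a) ^ M = (\<iota> ^ M) ^ b * (\<zeta> ^ M) ^ a"
        by (simp add: power_mult_distrib mult.commute flip: power_mult)
      then have "(\<iota> ^ b * \<zeta> ^ a) ^ M = 1" by (simp add: \<iota>M \<zeta>)
      moreover have "\<iota> ^ b * \<zeta> ^ a \<noteq> 1"
      proof
        assume "\<iota> ^ b * \<zeta> ^ a = 1"
        then have "\<zeta> ^ a = \<zeta> ^ b"
          using \<iota>\<zeta>n[of b] by (metis mult_left_cancel mult_zero_left zero_neq_one)
        then show False using \<zeta>inj that False by blast
      qed
      ultimately show ?thesis using eq False by (simp add: sum_powers_root_of_unity)
    qed
  qed
  have sum_p: "(\<Sum>a<M. p a) = e"
  proof -
    have "(\<Sum>a<M. p a) = inverse (of_nat M) *s (\<Sum>k<M. \<Sum>a<M. g a k)"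
      unfolding p_def by (subst sum.swap) (simp add: scale_sum_right)
    also have "(\<Sum>a<M. g a k) = (if k = 0 then of_nat M *s e else 0)" if "k < M" for k
    proof (cases "k = 0")
      case True
      then show ?thesis by (simp add: g_def sum_constant_scale)
    next
      case False
      have "(\<iota> ^ k) ^ M = 1" by (simp add: \<iota>M mult.commute[of k] power_mult flip: power_mult[of \<iota> k M])
      moreover have "\<iota> ^ k \<noteq> 1" using \<zeta>(2)[of k] False that \<iota>\<zeta>n[of k] by auto
      ultimately have "(\<Sum>a<M. (\<iota> ^ k) ^ a) = 0" by (rule sum_powers_root_of_unity)
      then have "(\<Sum>a<M. \<iota> ^ (a * k)) *s (e * u ^ k) = 0"
        by (simp add: mult.commute[of _ k] power_mult)
      then show ?thesis using False by (simp add: g_def scale_sum_left)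
    qed
    then have "(\<Sum>k<M. \<Sum>a<M. g a k) = (\<Sum>k<M. if k = 0 then of_nat M *s e else 0)"
      by simp
    finally show ?thesis using M M0 by simp
  qed
  obtain C where C: "orthogonal_idempotents C" "span C = center"
    using central_idempotents_exist by blast
  have fC: "finite C" using C(1) by (simp add: orthogonal_idempotents_def)
  have central: "E * x = x * E" if "E \<in> C" for E x
    using span_base[OF that] unfolding C(2) by (rule centerD)
  have block: "\<exists>c. E * z = c *s E" if "E \<in> C" "\<And>x. z * x = x * z" for E z
  proof (rule orthogonal_idempotents_coordinate[OF C(1) that(1)])
    show "z \<in> span C" using that(2) unfolding C(2) center_def by blast
  qed
  have sumC: "(\<Sum>E\<in>C. E) = 1"
    using orthogonal_idempotents_unit[OF C(1), of 1] C(2) by (simp add: center_def)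
  have EE: "E * E = E" if "E \<in> C" for E
    using orthogonal_idempotents_mult[OF C(1) that that] by simp
  define c where "c E q = (SOME c. E * casimir q = c *s E)" for E q
  have c: "E * casimir q = c E q *s E" if "E \<in> C" for E q
    unfolding c_def by (rule someI_ex) (rule block[OF that], simp add: casimir_central)
  have trace_block: "trace (\<lambda>x. (q * E) * x * r) = regular_character (q * E) * c E r" if "E \<in> C" for E q r
    unfolding trace_sandwich by (simp add: mult.assoc c[OF that] scale_mult_right \<tau>.scale)
  have idem: "\<exists>n. trace (\<lambda>x. (q * E) * x * r) = of_nat n \<and> (n = 0 \<longrightarrow> (\<forall>x. (q * E) * x * r = 0))"
    if "E \<in> C" "q * q = q" "r * r = r" for E q r
  proof (rule trace_idempotent[OF linear_sandwich])
    show "q * E * (q * E * x * r) * r = q * E * x * r" for x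
      using that EE[OF that(1)] central[OF that(1)] by (metis mult.assoc)
  qed
  \<comment> \<open>the dimension of \<open>p a * (E * H) * p b\<close>\<close>
  define m where "m E a b = (SOME n. trace (\<lambda>x. (p a * E) * x * p b) = of_nat n \<and>
      (n = 0 \<longrightarrow> (\<forall>x. (p a * E) * x * p b = 0)))" for E a b
  have m: "trace (\<lambda>x. (p a * E) * x * p b) = of_nat (m E a b) \<and>
      (m E a b = 0 \<longrightarrow> (\<forall>x. (p a * E) * x * p b = 0))" if "E \<in> C" "a < M" "b < M" for E a b
    unfolding m_def by (rule someI_ex) (rule idem, use that pp in auto)
  have m_prod: "of_nat (m E a b) = regular_character (p a * E) * c E (p b)"
    if "E \<in> C" "a < M" "b < M" for E a b
    using m[OF that] trace_block[OF that(1)] by metis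
  have m_sym: "m E a b = m E b a" if "E \<in> C" "a < M" "b < M" for E a b
  proof -
    have "(\<lambda>x. p b * x * (p a * E)) = (\<lambda>x. (p b * E) * x * p a)"
      by (rule ext) (metis central[OF that(1)] mult.assoc)
    then have "trace (\<lambda>x. (p a * E) * x * p b) = trace (\<lambda>x. (p b * E) * x * p a)"
      using trace_sandwich_commute[of "p a * E" "p b"] by simp
    then show ?thesis using m that by (metis of_nat_eq_iff)
  qed
  have m_square: "(m E a b)\<^sup>2 = m E a a * m E b b" if "E \<in> C" "a < M" "b < M" for E a b
  proof -
    have "(of_nat (m E a b * m E b a) :: 'k) = of_nat (m E a a * m E b b)"
      using that by (simp add: m_prod)
    then show ?thesis using m_sym[OF that] by (simp only: of_nat_eq_iff power2_eq_square)
  qed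
  define s where "s E = (\<Sum>a<M. of_real (sqrt (m E a a)) * \<omega> ^ a)" for E
  have "trace (\<lambda>x. e * (u * x * u') * e) = (\<Sum>a<M. \<Sum>b<M. of_nat (\<Sum>E\<in>C. m E a b) * \<zeta> ^ a * \<zeta> ^ (M - b))"
  proof -
    have eu_sum: "e * u = (\<Sum>a<M. \<zeta> ^ a *s p a)"
      by (simp flip: sum_p pu add: sum_distrib_right)
    have u'e: "u' * e = (\<Sum>b<M. \<iota> ^ b *s p b)"
      by (simp flip: sum_p u'p add: sum_distrib_left)
    have "e * (u * x * u') * e = (\<Sum>a<M. \<zeta> ^ a *s p a) * (\<Sum>b<M. x * (\<iota> ^ b *s p b))" for x
      by (simp only: mult.assoc eu_sum[symmetric] u'e[symmetric] sum_distrib_left[symmetric])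
    then have 1: "e * (u * x * u') * e = (\<Sum>a<M. \<Sum>b<M. (\<iota> ^ b * \<zeta> ^ a) *s (p a * x * p b))" for x
      by (simp only: sum_product scale_mult_left scale_mult_right scale_scale mult.assoc)
    have "p a * x * p b = (\<Sum>E\<in>C. (p a * E) * x * p b)" for a b x
      using sumC by (simp flip: sum_distrib_left sum_distrib_right)
    then have 2: "trace (\<lambda>x. p a * x * p b) = (\<Sum>E\<in>C. of_nat (m E a b))" if "a < M" "b < M" for a b
      using that m by (simp add: trace_sum)
    have "\<iota> ^ b = \<zeta> ^ (M - b)" if "b < M" for b
    proof -
      have "\<zeta> ^ (M - b) * \<zeta> ^ b = \<iota> ^ b * \<zeta> ^ b"
        using that \<zeta>(1) \<iota>\<zeta>n by (simp flip: power_add)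
      then show ?thesis using \<zeta>0 by simp
    qed
    then have 3: "(\<iota> ^ b * \<zeta> ^ a) * trace (\<lambda>x. p a * x * p b) =
        of_nat (\<Sum>E\<in>C. m E a b) * \<zeta> ^ a * \<zeta> ^ (M - b)" if "a < M" "b < M" for a b
      using that 2 by simp
    show ?thesis
      unfolding 1 trace_sum trace_scale by (intro sum.cong refl 3) auto
  qed
  then have "(\<Sum>a<M. \<Sum>b<M. of_nat (\<Sum>E\<in>C. m E a b) * \<omega> ^ a * \<omega> ^ (M - b)) = 0"
    using trace0 by (intro transfer) simp
  moreover have "(\<Sum>a<M. \<Sum>b<M. of_nat (\<Sum>E\<in>C. m E a b) * \<omega> ^ a * \<omega> ^ (M - b)) =
      (\<Sum>E\<in>C. \<Sum>a<M. \<Sum>b<M. of_nat (m E a b) * \<omega> ^ a * \<omega> ^ (M - b))"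
    by (simp add: sum_distrib_right sum.swap[of _ C])
  moreover have "\<dots> = (\<Sum>E\<in>C. of_real ((cmod (s E))\<^sup>2))"
    unfolding s_def by (intro sum.cong refl rank_one_sum_eq_norm \<omega> m_square)
  ultimately have "complex_of_real (\<Sum>E\<in>C. (cmod (s E))\<^sup>2) = 0"
    by simp
  then have s0: "s E = 0" if "E \<in> C" for E
    using that fC by (simp only: of_real_eq_0_iff) (simp add: sum_nonneg_eq_0_iff)
  \<comment> \<open>the block \<open>E\<close> that contains \<open>l\<close>, and the unique eigenvalue of \<open>u\<close> on \<open>l\<close>\<close>
  have "(\<Sum>E\<in>C. E * l) \<noteq> 0"
    using l sumC by (simp flip: sum_distrib_right)
  then obtain E where E: "E \<in> C" "E * l \<noteq> 0"
    by (rule sum.not_neutral_contains_not_neutral)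
  define h where "h a = (SOME c. e * p a * l = c *s l)" for a
  have h: "p a * l = h a *s l" for a
    using someI_ex[OF act[of "p a"]] ep by (simp add: h_def)
  have "(\<Sum>a<M. p a * l) = l" using sum_p l by (simp flip: sum_distrib_right)
  then obtain a0 where a0: "a0 < M" "h a0 \<noteq> 0"
    using l(1) sum.not_neutral_contains_not_neutral[of "\<lambda>a. p a * l" "{..<M}"]
    by (metis h lessThan_iff scale_zero_left)
  have h0: "h a = 0" if "a < M" "a \<noteq> a0" for a
  proof -
    have "p a * (p a0 * l) = 0" using pp[of a0 a] that a0 by (simp flip: mult.assoc)
    then show ?thesis using a0 l by (simp add: h scale_mult_right)
  qed
  have "trace (\<lambda>x. (p a0 * E) * x * l) \<noteq> 0"
  proof -
    have "(p a0 * E) * 1 * l = h a0 *s (E * l)"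
      using central[OF E(1), of "p a0"] by (simp add: mult.assoc h scale_mult_right flip: central[OF E(1), of "p a0"])
    then have "(p a0 * E) * 1 * l \<noteq> 0" using E a0 by simp
    then show ?thesis
      using idem[OF E(1), of "p a0" l] pp[of a0 a0] a0 l by (metis of_nat_eq_0_iff)
  qed
  then have cEl: "c E l \<noteq> 0" using trace_block[OF E(1)] by auto
  have "regular_character (p a * E) = 0" if "a < M" "a \<noteq> a0" for a
  proof -
    have "(p a * E) * x * l = 0" for x
    proof -
      obtain d where "e * (E * x) * l = d *s l" using act by blast
      moreover have "p a * (e * (E * x) * l) = (p a * E) * x * l"
      proof -
        have "e * u ^ k * e = e * u ^ k" for k
          by (metis eun ee mult.assoc)
        then have "p a * e = p a"
          by (simp add: p_def g_def scale_mult_left sum_distrib_right)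
        then show ?thesis by (metis mult.assoc)
      qed
      ultimately show ?thesis using h0[OF that] by (metis h scale_mult_right scale_zero_left scale_zero_right)
    qed
    then have "trace (\<lambda>x. (p a * E) * x * l) = 0" by (simp add: trace_def representation_zero)
    then show ?thesis using trace_block[OF E(1)] cEl by simp
  qed
  then have m0: "m E a a = 0" if "a < M" "a \<noteq> a0" for a
    using m_prod[OF E(1) that(1) that(1)] that by simp
  have "s E = (\<Sum>a<M. if a = a0 then of_real (sqrt (m E a0 a0)) * \<omega> ^ a0 else 0)"
    unfolding s_def by (rule sum.cong) (use m0 in auto)
  then have "m E a0 a0 = 0"
    using s0[OF E(1)] a0(1) \<omega>(1) by auto
  then have "(p a0 * E) * 1 * p a0 = 0" using m[OF E(1) a0(1) a0(1)] by blast
  then have "p a0 * (E * (p a0 * l)) = 0" by (simp add: mult.assoc) (metis mult.assoc mult_zero_left)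
  then have "E * (p a0 * (p a0 * l)) = 0" by (metis central[OF E(1)] mult.assoc)
  then show False using E(2) a0(2) by (simp add: h scale_mult_right)
qed

end


section \<open>Sweedler notation\<close>

context tensor_powers
begin

abbreviation lin :: "('k \<Rightarrow> 'c \<Rightarrow> 'c) \<Rightarrow> ('v \<Rightarrow> 'c::ab_group_add) \<Rightarrow> bool" where
  "lin s f \<equiv> Vector_Spaces.linear scale s f"

lemma vector_space_field: "vector_space ((*) :: 'k \<Rightarrow> 'k \<Rightarrow> 'k)"
  by unfold_locales (auto simp: algebra_simps)

lemma vector_space_fun_scale: "vector_space (fun_scale :: 'k \<Rightarrow> ('f \<Rightarrow> 'k) \<Rightarrow> _)"
  by unfold_locales (auto simp: fun_scale_def algebra_simps)

lemma lin_vector_space: "lin s f \<Longrightarrow> vector_space s"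
  by (simp add: Vector_Spaces.linear_iff)

lemma lin_fun_scale:
  fixes F :: "'v \<Rightarrow> 'f \<Rightarrow> 'k"
  shows "lin fun_scale F \<longleftrightarrow> (\<forall>\<beta>. lin (*) (\<lambda>x. F x \<beta>))"
  unfolding Vector_Spaces.linear_iff using vector_space_field vector_space_fun_scale vector_space_axioms
  by (auto simp: fun_scale_def fun_eq_iff)

lemma lin_fun_scaleI:
  fixes F :: "'v \<Rightarrow> 'f \<Rightarrow> 'k"
  shows "(\<And>\<beta>. lin (*) (\<lambda>x. F x \<beta>)) \<Longrightarrow> lin fun_scale F"
  by (simp add: lin_fun_scale)

lemma lin_zero: 
  assumes "vector_space s"
  shows "lin s (\<lambda>x. 0)"
proof -
  interpret vs: vector_space s by (rule assms)
  show ?thesis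
    by (simp add: Vector_Spaces.linear_iff vector_space_axioms vs.vector_space_axioms)
qed

lemma bilinear_mapI:
  "(\<And>y. lin s (\<lambda>x. f x y)) \<Longrightarrow> (\<And>x. lin s (\<lambda>y. f x y)) \<Longrightarrow> bilinear_map s f"
  by (simp add: bilinear_map_def)

lemma trilinear_mapI:
  "(\<And>y z. lin s (\<lambda>x. f x y z)) \<Longrightarrow> (\<And>x z. lin s (\<lambda>y. f x y z)) \<Longrightarrow>
   (\<And>x y. lin s (\<lambda>z. f x y z)) \<Longrightarrow> trilinear_map s f"
  by (simp add: trilinear_map_def)

lemma bilinear_map_vector_space: "bilinear_map s f \<Longrightarrow> vector_space s"
  by (auto simp: bilinear_map_def intro: lin_vector_space)

lemma trilinear_map_vector_space: "trilinear_map s f \<Longrightarrow> vector_space s"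
  by (auto simp: trilinear_map_def intro: lin_vector_space)

lemma separation:
  assumes "vector_space s" and "\<And>\<phi>. Vector_Spaces.linear s (*) \<phi> \<Longrightarrow> \<phi> v = (\<phi> w :: 'k)"
  shows "v = w"
  using exists_separating_functional[OF assms(1)] assms(2) by blast

lemma lin_compose: "lin s f \<Longrightarrow> Vector_Spaces.linear s t g \<Longrightarrow> lin t (\<lambda>x. g (f x))"
  using Vector_Spaces.linear_compose[of scale s f t g] by (simp add: o_def)

lemma bilinear_map_compose:
  "bilinear_map s f \<Longrightarrow> Vector_Spaces.linear s t g \<Longrightarrow> bilinear_map t (\<lambda>x y. g (f x y))"
  by (auto simp: bilinear_map_def intro!: lin_compose[where g = g and s = s and t = t])

lemma trilinear_map_compose:
  "trilinear_map s f \<Longrightarrow> Vector_Spaces.linear s t g \<Longrightarrow> trilinear_map t (\<lambda>x y z. g (f x y z))"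
  by (auto simp: trilinear_map_def intro!: lin_compose[where g = g and s = s and t = t])

lemma bilinear_map_pure2: "bilinear_map fun_scale pure2"
proof (intro bilinear_mapI lin_fun_scaleI)
  show "lin (*) (\<lambda>x. pure2 x y \<beta>)" for y \<beta>
    by (cases "bilinear_map (*) \<beta>") (simp_all add: pure2_def lin_zero vector_space_field, simp add: bilinear_map_def)
  show "lin (*) (\<lambda>y. pure2 x y \<beta>)" for x \<beta>
    by (cases "bilinear_map (*) \<beta>") (simp_all add: pure2_def lin_zero vector_space_field, simp add: bilinear_map_def)
qed

lemma trilinear_map_pure3: "trilinear_map fun_scale pure3"
proof (intro trilinear_mapI lin_fun_scaleI)
  show "lin (*) (\<lambda>x. pure3 x y z \<beta>)" for y z \<beta>
    by (cases "trilinear_map (*) \<beta>") (simp_all add: pure3_def lin_zero vector_space_field, simp add: trilinear_map_def)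
  show "lin (*) (\<lambda>y. pure3 x y z \<beta>)" for x z \<beta>
    by (cases "trilinear_map (*) \<beta>") (simp_all add: pure3_def lin_zero vector_space_field, simp add: trilinear_map_def)
  show "lin (*) (\<lambda>z. pure3 x y z \<beta>)" for x y \<beta>
    by (cases "trilinear_map (*) \<beta>") (simp_all add: pure3_def lin_zero vector_space_field, simp add: trilinear_map_def)
qed

end

lemma sum_list_case_prod_nth:
  "(\<Sum>(x, y)\<leftarrow>ps. f x y) = (\<Sum>i<length ps. f (fst (ps ! i)) (snd (ps ! i)))"
  by (simp add: sum_list_sum_nth atLeast0LessThan case_prod_unfold)

lemma sum_list_concat: "(\<Sum>x\<leftarrow>concat xss. f x) = (\<Sum>xs\<leftarrow>xss. \<Sum>x\<leftarrow>xs. f x)"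
  by (induction xss) simp_all

lemma sum_fun_apply: "(\<Sum>i\<in>I. F i) \<beta> = (\<Sum>i\<in>I. F i \<beta>)"
  by (induction I rule: infinite_finite_induct) simp_all

context weak_hopf_algebra
begin

definition legs :: "'h \<Rightarrow> ('h \<times> 'h) list" where
  "legs h = (SOME ps. \<Delta> h = (\<Sum>(x, y)\<leftarrow>ps. pure2 x y))"

text \<open>\<open>sw h f\<close> is \<open>f h\<^sub>1 h\<^sub>2\<close> in Sweedler notation. As a sum over a fixed representative of \<open>\<Delta> h\<close> it
  commutes with every additive operation, whether \<open>f\<close> is bilinear or not; bilinearity of \<open>f\<close> makes it
  independent of the representative.\<close>

definition sw :: "'h \<Rightarrow> ('h \<Rightarrow> 'h \<Rightarrow> 'c::comm_monoid_add) \<Rightarrow> 'c" where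
  "sw h f = (\<Sum>i<length (legs h). f (fst (legs h ! i)) (snd (legs h ! i)))"

lemma comult_legs: "\<Delta> h = (\<Sum>(x, y)\<leftarrow>legs h. pure2 x y)"
  unfolding legs_def
  by (rule someI_ex) (use comult_in_tensor_square[of h] in \<open>auto simp: tensor_square_def\<close>)

lemma sw_sum_list: "sw h f = (\<Sum>(x, y)\<leftarrow>legs h. f x y)"
  unfolding sw_def by (rule sum_list_case_prod_nth[symmetric])

lemma lift2_comult:
  assumes b: "bilinear_map s f"
  shows "lift2 f (\<Delta> h) = sw h f"
  using lift2_sum[OF bilinear_map_vector_space[OF b] b, of "legs h"]
  by (simp flip: comult_legs add: sw_sum_list)

lemma comult_apply: "bilinear_map (*) \<beta> \<Longrightarrow> \<Delta> h \<beta> = sw h \<beta>"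
  by (subst comult_legs) (simp add: sum_pure2_apply sw_sum_list)

lemma sw_swap: "sw h (\<lambda>x y. sw g (\<lambda>u v. f x y u v)) = sw g (\<lambda>u v. sw h (\<lambda>x y. f x y u v))"
  unfolding sw_def by (rule sum.swap)

lemma sw_sum: "sw h (\<lambda>x y. \<Sum>i\<in>I. f i x y) = (\<Sum>i\<in>I. sw h (f i))"
  unfolding sw_def by (rule sum.swap)

lemma sw_mult_left: "(a :: 'c::semiring_0) * sw h f = sw h (\<lambda>x y. a * f x y)"
  unfolding sw_def by (rule sum_distrib_left)

lemma sw_mult_right: "sw h f * (a :: 'c::semiring_0) = sw h (\<lambda>x y. f x y * a)"
  unfolding sw_def by (rule sum_distrib_right)

lemma sw_scale: "c *s sw h f = sw h (\<lambda>x y. c *s f x y)"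
  unfolding sw_def by (rule scale_sum_right)

lemma sw_scale_left: "sw h f *s a = sw h (\<lambda>x y. f x y *s a)"
  unfolding sw_def by (rule scale_sum_left)

lemma sw_fun_apply: "sw h F \<beta> = sw h (\<lambda>x y. F x y \<beta>)"
  unfolding sw_def by (rule sum_fun_apply)

lemma sw_linear: "Vector_Spaces.linear s t \<phi> \<Longrightarrow> \<phi> (sw h f) = sw h (\<lambda>x y. \<phi> (f x y))"
  unfolding sw_def by (rule linear_sum')

lemma bilinear_sw_left: "bilinear_map s f \<Longrightarrow> f (sw h g) y = sw h (\<lambda>u v. f (g u v) y)"
  using sw_linear[of scale s "\<lambda>x. f x y"] by (simp add: bilinear_map_def)

lemma bilinear_sw_right: "bilinear_map s f \<Longrightarrow> f x (sw h g) = sw h (\<lambda>u v. f x (g u v))"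
  using sw_linear[of scale s "f x"] by (simp add: bilinear_map_def)

lemma bilinear_scale_left: "bilinear_map s f \<Longrightarrow> f (c *s x) y = s c (f x y)"
  by (simp add: bilinear_map_def Vector_Spaces.linear_iff)

lemma bilinear_scale_right: "bilinear_map s f \<Longrightarrow> f x (c *s y) = s c (f x y)"
  by (simp add: bilinear_map_def Vector_Spaces.linear_iff)

lemma lin_id: "lin scale (\<lambda>x. x)"
  by (simp add: Vector_Spaces.linear_iff vector_space_axioms)

lemma lin_scale_left: "lin (*) f \<Longrightarrow> lin scale (\<lambda>x. f x *s a)"
  by (simp add: Vector_Spaces.linear_iff scale_left_distrib)

lemma lin_scale_right: "lin scale f \<Longrightarrow> lin scale (\<lambda>x. c *s f x)"
  by (simp add: Vector_Spaces.linear_iff scale_right_distrib scale_left_commute)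

lemma lin_const_times: "lin (*) f \<Longrightarrow> lin (*) (\<lambda>x. c * f x)"
  by (simp add: Vector_Spaces.linear_iff algebra_simps)

lemma lin_times_const: "lin (*) f \<Longrightarrow> lin (*) (\<lambda>x. f x * c)"
  by (simp add: Vector_Spaces.linear_iff algebra_simps)

lemma lin_sum: 
  assumes "\<And>i. lin s (f i)"
  shows "lin s (\<lambda>x. \<Sum>i\<in>I. f i x)"
proof -
  interpret vs: vector_space s by (rule lin_vector_space[OF assms])
  show ?thesis
    using assms by (simp add: Vector_Spaces.linear_iff sum.distrib vs.scale_sum_right)
qed

lemma lin_sw: "(\<And>u v. lin s (\<lambda>x. f x u v)) \<Longrightarrow> lin s (\<lambda>x. sw h (f x))"
  unfolding sw_def by (rule lin_sum)

lemma sw_bilinear_linear: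
  assumes "bilinear_map s f"
  shows "lin s (\<lambda>h. sw h f)"
proof -
  interpret \<Delta>: Vector_Spaces.linear scale fun_scale \<Delta> by (rule linear_comult)
  interpret vs: vector_space s by (rule bilinear_map_vector_space[OF assms])
  have add: "sw (a + b) f = sw a f + sw b f" for a b
  proof (rule separation[OF vs.vector_space_axioms])
    fix \<phi> assume \<phi>: "Vector_Spaces.linear s (*) \<phi>"
    interpret \<phi>: Vector_Spaces.linear s "(*)" \<phi> by (rule \<phi>)
    note b = bilinear_map_compose[OF assms \<phi>]
    show "\<phi> (sw (a + b) f) = \<phi> (sw a f + sw b f)"
      by (simp add: \<phi>.add sw_linear[OF \<phi>] \<Delta>.add flip: comult_apply[OF b])
  qed
  have scale: "sw (c *s a) f = s c (sw a f)" for a c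
  proof (rule separation[OF vs.vector_space_axioms])
    fix \<phi> assume \<phi>: "Vector_Spaces.linear s (*) \<phi>"
    interpret \<phi>: Vector_Spaces.linear s "(*)" \<phi> by (rule \<phi>)
    note b = bilinear_map_compose[OF assms \<phi>]
    show "\<phi> (sw (c *s a) f) = \<phi> (s c (sw a f))"
      by (simp add: \<phi>.scale sw_linear[OF \<phi>] \<Delta>.scale fun_scale_def flip: comult_apply[OF b])
  qed
  show ?thesis
    by (simp add: Vector_Spaces.linear_iff vector_space_axioms vs.vector_space_axioms add scale)
qed

lemma lin_sw_arg: "lin scale f \<Longrightarrow> bilinear_map s g \<Longrightarrow> lin s (\<lambda>x. sw (f x) g)"
  by (rule lin_compose[OF _ sw_bilinear_linear])

lemma lin_mult_left: "lin scale f \<Longrightarrow> lin scale (\<lambda>x. f x * a)"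
  by (rule lin_compose[OF _ linear_mult_left])

lemma lin_mult_right: "lin scale f \<Longrightarrow> lin scale (\<lambda>x. a * f x)"
  by (rule lin_compose[OF _ linear_mult_right])

lemma lin_antipode: "lin scale f \<Longrightarrow> lin scale (\<lambda>x. S (f x))"
  by (rule lin_compose[OF _ linear_antipode])

lemma lin_counit: "lin scale f \<Longrightarrow> lin (*) (\<lambda>x. \<epsilon> (f x))"
  by (rule lin_compose[OF _ linear_counit])

lemmas lin_intros = bilinear_mapI trilinear_mapI lin_id lin_scale_left lin_scale_right lin_const_times lin_times_const
  lin_sum lin_sw lin_sw_arg lin_mult_left lin_mult_right lin_antipode lin_counit

lemma bilinear_lin:
  assumes "bilinear_map s f"
  shows "lin scale g \<Longrightarrow> lin s (\<lambda>x. f (g x) y)" "lin scale g \<Longrightarrow> lin s (\<lambda>x. f y (g x))"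
  using assms lin_compose[of scale g s "\<lambda>x. f x y"] lin_compose[of scale g s "\<lambda>x. f y x"]
  by (simp_all add: bilinear_map_def)

lemma trilinear_lin:
  assumes "trilinear_map s f"
  shows "lin scale g \<Longrightarrow> lin s (\<lambda>x. f (g x) y z)" "lin scale g \<Longrightarrow> lin s (\<lambda>x. f y (g x) z)"
    "lin scale g \<Longrightarrow> lin s (\<lambda>x. f y z (g x))"
  using assms lin_compose[of scale g s "\<lambda>x. f x y z"] lin_compose[of scale g s "\<lambda>x. f y x z"]
    lin_compose[of scale g s "\<lambda>x. f y z x"]
  by (simp_all add: trilinear_map_def)

lemma pure3_lin:
  "lin scale g \<Longrightarrow> lin (*) (\<lambda>x. pure3 (g x) y z \<tau>)" "lin scale g \<Longrightarrow> lin (*) (\<lambda>x. pure3 y (g x) z \<tau>)"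
  "lin scale g \<Longrightarrow> lin (*) (\<lambda>x. pure3 y z (g x) \<tau>)"
  using trilinear_lin[OF trilinear_map_pure3, of g] by (simp_all add: lin_fun_scale)

lemma pure2_lin:
  "lin scale g \<Longrightarrow> lin (*) (\<lambda>x. pure2 (g x) y \<tau>)" "lin scale g \<Longrightarrow> lin (*) (\<lambda>x. pure2 y (g x) \<tau>)"
  using bilinear_lin[OF bilinear_map_pure2, of g] by (simp_all add: lin_fun_scale)

lemma tensor_right_comult: "tensor_right (\<Delta> x) y = sw x (\<lambda>u v. pure3 u v y)"
  unfolding tensor_right_def
  by (rule lift2_comult[where s = fun_scale]) (intro bilinear_mapI lin_fun_scaleI pure3_lin lin_id)

lemma tensor_left_comult: "tensor_left x (\<Delta> y) = sw y (\<lambda>u v. pure3 x u v)"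
  unfolding tensor_left_def
  by (rule lift2_comult[where s = fun_scale]) (intro bilinear_mapI lin_fun_scaleI pure3_lin lin_id)

lemma lift2_tensor_right:
  "lift2 (\<lambda>x y. tensor_right (\<Delta> x) y) (\<Delta> h) = sw h (\<lambda>x y. sw x (\<lambda>u v. pure3 u v y))"
  unfolding tensor_right_comult
  by (rule lift2_comult[where s = fun_scale], intro bilinear_mapI lin_fun_scaleI, unfold sw_fun_apply)
    (intro lin_intros pure3_lin)+

lemma lift2_tensor_left:
  "lift2 (\<lambda>x y. tensor_left x (\<Delta> y)) (\<Delta> h) = sw h (\<lambda>x y. sw y (\<lambda>u v. pure3 x u v))"
  unfolding tensor_left_comult
  by (rule lift2_comult[where s = fun_scale], intro bilinear_mapI lin_fun_scaleI, unfold sw_fun_apply)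
    (intro lin_intros pure3_lin)+

text \<open>An equation between pure tensors passes to every trilinear map, because functionals separate the
  points of its codomain.\<close>

lemma trilinear_ext:
  assumes f: "trilinear_map s f"
    and eq: "sw h (\<lambda>x y. sw (a x y) (\<lambda>u v. pure3 (p x y u v) (q x y u v) (r x y u v))) =
      sw h' (\<lambda>x y. sw (a' x y) (\<lambda>u v. pure3 (p' x y u v) (q' x y u v) (r' x y u v)))"
  shows "sw h (\<lambda>x y. sw (a x y) (\<lambda>u v. f (p x y u v) (q x y u v) (r x y u v))) =
      sw h' (\<lambda>x y. sw (a' x y) (\<lambda>u v. f (p' x y u v) (q' x y u v) (r' x y u v)))"
proof (rule separation[OF trilinear_map_vector_space[OF f]])
  fix \<phi> assume \<phi>: "Vector_Spaces.linear s (*) \<phi>"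
  note t = trilinear_map_compose[OF f \<phi>]
  show "\<phi> (sw h (\<lambda>x y. sw (a x y) (\<lambda>u v. f (p x y u v) (q x y u v) (r x y u v)))) =
      \<phi> (sw h' (\<lambda>x y. sw (a' x y) (\<lambda>u v. f (p' x y u v) (q' x y u v) (r' x y u v))))"
    using arg_cong[OF eq, of "\<lambda>t. t (\<lambda>x y z. \<phi> (f x y z))"]
    by (simp add: sw_fun_apply pure3_apply[OF t] sw_linear[OF \<phi>])
qed

lemma sw_coassoc:
  assumes "trilinear_map s f"
  shows "sw h (\<lambda>x y. sw x (\<lambda>u v. f u v y)) = sw h (\<lambda>x y. sw y (\<lambda>u v. f x u v))"
  using coassoc[of h] unfolding lift2_tensor_right lift2_tensor_left
  by (rule trilinear_ext[OF assms])

lemma sw_mult: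
  assumes f: "bilinear_map s f"
  shows "sw (h * g) f = sw h (\<lambda>x y. sw g (\<lambda>u v. f (x * u) (y * v)))"
proof -
  have inner: "lift2 (\<lambda>c d. pure2 (a * c) (b * d)) (\<Delta> g) = sw g (\<lambda>c d. pure2 (a * c) (b * d))" for a b
    by (rule lift2_comult[where s = fun_scale]) (intro bilinear_mapI lin_fun_scaleI pure2_lin lin_intros)
  have eq: "\<Delta> (h * g) = sw h (\<lambda>x y. sw g (\<lambda>u v. pure2 (x * u) (y * v)))"
    unfolding comult_mult mult2_def inner
    by (rule lift2_comult[where s = fun_scale], intro bilinear_mapI lin_fun_scaleI, unfold sw_fun_apply)
      (intro lin_intros pure2_lin)+
  show ?thesis
  proof (rule separation[OF bilinear_map_vector_space[OF f]])
    fix \<phi> assume \<phi>: "Vector_Spaces.linear s (*) \<phi>"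
    note b = bilinear_map_compose[OF f \<phi>]
    show "\<phi> (sw (h * g) f) = \<phi> (sw h (\<lambda>x y. sw g (\<lambda>u v. f (x * u) (y * v))))"
      using arg_cong[OF eq, of "\<lambda>t. t (\<lambda>x y. \<phi> (f x y))"]
      by (simp add: sw_fun_apply pure2_apply[OF b] sw_linear[OF \<phi>] comult_apply[OF b])
  qed
qed

lemma mult3_one:
  "tensor_right (\<Delta> 1) 1 \<cdot>\<^sub>3 tensor_left 1 (\<Delta> 1) = sw 1 (\<lambda>x y. sw 1 (\<lambda>u v. pure3 x (y * u) v))"
  "tensor_left 1 (\<Delta> 1) \<cdot>\<^sub>3 tensor_right (\<Delta> 1) 1 = sw 1 (\<lambda>x y. sw 1 (\<lambda>u v. pure3 u (x * v) y))"
proof -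
  have R: "tensor_right (\<Delta> 1) 1 = (\<Sum>(x, y, z)\<leftarrow>map (\<lambda>(x, y). (x, y, 1)) (legs 1). pure3 x y z)"
    by (simp add: tensor_right_comult sw_sum_list o_def case_prod_unfold)
  have L: "tensor_left 1 (\<Delta> 1) = (\<Sum>(x, y, z)\<leftarrow>map (\<lambda>(x, y). (1, x, y)) (legs 1). pure3 x y z)"
    by (simp add: tensor_left_comult sw_sum_list o_def case_prod_unfold)
  have tri: "trilinear_map fun_scale (\<lambda>d e f. pure3 (a * d) (b * e) (c * f))" for a b c
    by (intro trilinear_mapI lin_fun_scaleI pure3_lin lin_intros)
  have tri': "trilinear_map fun_scale (\<lambda>a b c. sw 1 (\<lambda>u v. pure3 (a * p u v) (b * q u v) (c * r u v)))" for p q r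
    by (intro trilinear_mapI lin_fun_scaleI, unfold sw_fun_apply) (intro lin_intros pure3_lin)+
  have inL: "lift3 (\<lambda>d e f. pure3 (a * d) (b * e) (c * f)) (tensor_left 1 (\<Delta> 1)) =
      sw 1 (\<lambda>u v. pure3 (a * 1) (b * u) (c * v))" for a b c
    unfolding L by (subst lift3_sum[OF vector_space_fun_scale tri]) (simp add: sw_sum_list o_def case_prod_unfold)
  have inR: "lift3 (\<lambda>d e f. pure3 (a * d) (b * e) (c * f)) (tensor_right (\<Delta> 1) 1) =
      sw 1 (\<lambda>u v. pure3 (a * u) (b * v) (c * 1))" for a b c
    unfolding R by (subst lift3_sum[OF vector_space_fun_scale tri]) (simp add: sw_sum_list o_def case_prod_unfold)
  show "tensor_right (\<Delta> 1) 1 \<cdot>\<^sub>3 tensor_left 1 (\<Delta> 1) = sw 1 (\<lambda>x y. sw 1 (\<lambda>u v. pure3 x (y * u) v))"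
    unfolding mult3_def inL R
    by (subst lift3_sum[OF vector_space_fun_scale tri'])
      (simp add: sw_sum_list[of 1 "\<lambda>x y. sw 1 (\<lambda>u v. pure3 x (y * u) v)"] o_def case_prod_unfold)
  show "tensor_left 1 (\<Delta> 1) \<cdot>\<^sub>3 tensor_right (\<Delta> 1) 1 = sw 1 (\<lambda>x y. sw 1 (\<lambda>u v. pure3 u (x * v) y))"
    unfolding mult3_def inR L
    by (subst lift3_sum[OF vector_space_fun_scale tri'])
      (simp add: sw_sum_list[of 1 "\<lambda>x y. sw 1 (\<lambda>u v. pure3 u (x * v) y)"] o_def case_prod_unfold)
qed

lemma sw_one1:
  assumes "trilinear_map s f"
  shows "sw 1 (\<lambda>x y. sw x (\<lambda>u v. f u v y)) = sw 1 (\<lambda>x y. sw 1 (\<lambda>u v. f x (y * u) v))"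
  using comult_one1 unfolding lift2_tensor_right mult3_one by (rule trilinear_ext[OF assms])

lemma sw_one2:
  assumes "trilinear_map s f"
  shows "sw 1 (\<lambda>x y. sw x (\<lambda>u v. f u v y)) = sw 1 (\<lambda>x y. sw 1 (\<lambda>u v. f x (u * y) v))"
proof -
  have "sw 1 (\<lambda>x y. sw x (\<lambda>u v. f u v y)) = sw 1 (\<lambda>x y. sw 1 (\<lambda>u v. f u (x * v) y))"
    using comult_one2 unfolding lift2_tensor_right mult3_one by (rule trilinear_ext[OF assms])
  also have "\<dots> = sw 1 (\<lambda>u v. sw 1 (\<lambda>x y. f u (x * v) y))" by (rule sw_swap)
  finally show ?thesis .
qed

lemma counit_bilinear_left: "bilinear_map scale (\<lambda>x y. \<epsilon> x *s y)"
  and counit_bilinear_right: "bilinear_map scale (\<lambda>x y. \<epsilon> y *s x)"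
  by (intro lin_intros)+

lemma sw_counit_left: "sw h (\<lambda>x y. \<epsilon> x *s y) = h"
  using counit_left[of h] lift2_comult[OF counit_bilinear_left] by simp

lemma sw_counit_right: "sw h (\<lambda>x y. \<epsilon> y *s x) = h"
  using counit_right[of h] lift2_comult[OF counit_bilinear_right] by simp

lemma counit_mult_sw: "\<epsilon> (f * g * h) = sw g (\<lambda>x y. \<epsilon> (f * x) * \<epsilon> (y * h))"
proof -
  have "bilinear_map (*) (\<lambda>x y. \<epsilon> (f * x) * \<epsilon> (y * h))" by (intro lin_intros)
  then show ?thesis using counit_mult1[of f g h] lift2_comult by metis
qed

lemma target_counital_sw: "\<epsilon>\<^sub>t h = sw 1 (\<lambda>x y. \<epsilon> (x * h) *s y)"
  unfolding target_counital_def by (rule lift2_comult[where s = scale]) (intro lin_intros)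

lemma source_counital_sw: "\<epsilon>\<^sub>s h = sw 1 (\<lambda>x y. \<epsilon> (h * y) *s x)"
  unfolding source_counital_def by (rule lift2_comult[where s = scale]) (intro lin_intros)

lemma lift2_pure2:
  assumes b: "bilinear_map s f"
  shows "lift2 f (pure2 x y) = f x y"
  using lift2_sum[OF bilinear_map_vector_space[OF b] b, of "[(x, y)]"] by simp

lemma sw_antipode_right: "sw h (\<lambda>x y. x * S y) = \<epsilon>\<^sub>t h"
proof -
  have "\<Delta> 1 \<cdot>\<^sub>2 pure2 h 1 = lift2 (\<lambda>a b. pure2 (a * h) (b * 1)) (\<Delta> 1)"
    unfolding mult2_def
    by (subst lift2_pure2[where s = fun_scale], intro bilinear_mapI lin_fun_scaleI pure2_lin lin_intros) (rule refl)
  also have "\<dots> = sw 1 (\<lambda>a b. pure2 (a * h) (b * 1))"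
    by (rule lift2_comult[where s = fun_scale]) (intro bilinear_mapI lin_fun_scaleI pure2_lin lin_intros)
  also have "\<dots> = (\<Sum>(x, y)\<leftarrow>map (\<lambda>(x, y). (x * h, y)) (legs 1). pure2 x y)"
    by (simp add: sw_sum_list o_def case_prod_unfold)
  finally have "lift2 (\<lambda>x y. \<epsilon> x *s y) (\<Delta> 1 \<cdot>\<^sub>2 pure2 h 1) = sw 1 (\<lambda>x y. \<epsilon> (x * h) *s y)"
    by (simp only: lift2_sum[OF vector_space_axioms counit_bilinear_left])
      (simp add: sw_sum_list o_def case_prod_unfold)
  moreover have "lift2 (\<lambda>x y. x * S y) (\<Delta> h) = sw h (\<lambda>x y. x * S y)"
    by (rule lift2_comult[where s = scale]) (intro lin_intros)
  ultimately show ?thesis using antipode_right[of h] by (simp add: target_counital_sw)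
qed

lemma sw_antipode_left: "sw h (\<lambda>x y. S x * y) = \<epsilon>\<^sub>s h"
proof -
  have "pure2 1 h \<cdot>\<^sub>2 \<Delta> 1 = lift2 (\<lambda>c d. pure2 (1 * c) (h * d)) (\<Delta> 1)"
    unfolding mult2_def
  proof (subst lift2_pure2[where s = fun_scale])
    have "lift2 (\<lambda>c d. pure2 (a * c) (b * d)) (\<Delta> 1) = sw 1 (\<lambda>c d. pure2 (a * c) (b * d))" for a b
      by (rule lift2_comult[where s = fun_scale]) (intro bilinear_mapI lin_fun_scaleI pure2_lin lin_intros)
    then show "bilinear_map fun_scale (\<lambda>a b. lift2 (\<lambda>c d. pure2 (a * c) (b * d)) (\<Delta> 1))"
      by (simp only:) (intro bilinear_mapI lin_fun_scaleI, unfold sw_fun_apply, (intro lin_intros pure2_lin)+)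
  qed (rule refl)
  also have "\<dots> = sw 1 (\<lambda>a b. pure2 (1 * a) (h * b))"
    by (rule lift2_comult[where s = fun_scale]) (intro bilinear_mapI lin_fun_scaleI pure2_lin lin_intros)
  also have "\<dots> = (\<Sum>(x, y)\<leftarrow>map (\<lambda>(x, y). (x, h * y)) (legs 1). pure2 x y)"
    by (simp add: sw_sum_list o_def case_prod_unfold)
  finally have "lift2 (\<lambda>x y. \<epsilon> y *s x) (pure2 1 h \<cdot>\<^sub>2 \<Delta> 1) = sw 1 (\<lambda>x y. \<epsilon> (h * y) *s x)"
    by (simp only: lift2_sum[OF vector_space_axioms counit_bilinear_right])
      (simp add: sw_sum_list o_def case_prod_unfold)
  moreover have "lift2 (\<lambda>x y. S x * y) (\<Delta> h) = sw h (\<lambda>x y. S x * y)"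
    by (rule lift2_comult[where s = scale]) (intro lin_intros)
  ultimately show ?thesis using antipode_left[of h] by (simp add: source_counital_sw)
qed

lemma sw_antipode_sandwich: "S h = sw h (\<lambda>x y. sw x (\<lambda>u v. S u * v * S y))"
proof -
  have tri: "trilinear_map scale (\<lambda>x y z. S x * y * S z)" by (intro lin_intros)
  have "sw h (\<lambda>x y. sw x (\<lambda>u v. pure3 u v y)) =
      (\<Sum>(u, v, y)\<leftarrow>concat (map (\<lambda>(x, y). map (\<lambda>(u, v). (u, v, y)) (legs x)) (legs h)). pure3 u v y)"
    by (simp add: sum_list_concat sw_sum_list o_def case_prod_unfold)
  then have "S h = (\<Sum>(u, v, y)\<leftarrow>concat (map (\<lambda>(x, y). map (\<lambda>(u, v). (u, v, y)) (legs x)) (legs h)). S u * v * S y)"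
    using antipode_sandwich[of h] lift3_sum[OF vector_space_axioms tri]
    by (simp only: lift2_tensor_right)
  then show ?thesis
    by (simp add: sum_list_concat sw_sum_list o_def case_prod_unfold)
qed

end


section \<open>The base algebra\<close>

context weak_hopf_algebra
begin

lemma sw_scale_arg:
  assumes f: "bilinear_map s f"
  shows "sw (c *s y) f = sw y (\<lambda>u v. f (c *s u) v)"
proof -
  interpret vs: vector_space s by (rule bilinear_map_vector_space[OF f])
  have "sw (c *s y) f = s c (sw y f)"
    using sw_bilinear_linear[OF f] by (simp add: Vector_Spaces.linear_iff)
  also have "\<dots> = sw y (\<lambda>u v. s c (f u v))"
    unfolding sw_def by (rule vs.scale_sum_right)
  finally show ?thesis by (simp add: bilinear_scale_left[OF f])
qed

text \<open>Applying the counit to the middle leg of \<open>(\<Delta> \<otimes> id) (\<Delta> 1) = 1\<^sub>1 \<otimes> 1'\<^sub>1 1\<^sub>2 \<otimes> 1'\<^sub>2\<close> gives back \<open>\<Delta> 1\<close> on one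
  side; on the other side the factor \<open>\<epsilon> (1'\<^sub>1 1\<^sub>2)\<close> produces a counital map, in whichever leg
  it is absorbed.\<close>

lemma sw_one_base_legs:
  assumes f: "bilinear_map s f"
  shows "sw 1 f = sw 1 (\<lambda>x y. f x (\<epsilon>\<^sub>t y))" and "sw 1 f = sw 1 (\<lambda>x y. f (\<epsilon>\<^sub>s x) y)"
proof -
  have "sw 1 f = sw 1 (\<lambda>x y. sw x (\<lambda>u v. f (\<epsilon> v *s u) y))"
    by (simp flip: bilinear_sw_left[OF f] add: sw_counit_right)
  also have "\<dots> = sw 1 (\<lambda>x y. sw 1 (\<lambda>u v. f (\<epsilon> (u * y) *s x) v))"
    by (rule sw_one2[where s = s]) (intro lin_intros bilinear_lin[OF f])
  finally have eq: "sw 1 f = \<dots>" .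
  also have "\<dots> = sw 1 (\<lambda>x y. f x (\<epsilon>\<^sub>t y))"
    by (simp add: target_counital_sw bilinear_sw_right[OF f] bilinear_scale_left[OF f] bilinear_scale_right[OF f])
  finally show "sw 1 f = sw 1 (\<lambda>x y. f x (\<epsilon>\<^sub>t y))" .
  have "sw 1 f = sw 1 (\<lambda>u v. sw 1 (\<lambda>x y. f (\<epsilon> (u * y) *s x) v))"
    unfolding eq by (rule sw_swap)
  then show "sw 1 f = sw 1 (\<lambda>x y. f (\<epsilon>\<^sub>s x) y)"
    by (simp add: source_counital_sw bilinear_sw_left[OF f])
qed

text \<open>The coproduct of \<open>\<epsilon> (1\<^sub>1 h) 1\<^sub>2\<close> is computed from \<open>(\<Delta> \<otimes> id) (\<Delta> 1)\<close>; the two orders of the factors in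
  the latter give the two forms.\<close>

lemma sw_target_counital:
  assumes f: "bilinear_map s f"
  shows "sw (\<epsilon>\<^sub>t h) f = sw 1 (\<lambda>u v. f (\<epsilon>\<^sub>t h * u) v)" and "sw (\<epsilon>\<^sub>t h) f = sw 1 (\<lambda>u v. f (u * \<epsilon>\<^sub>t h) v)"
proof -
  have tri: "trilinear_map s (\<lambda>x u v. f (\<epsilon> (x * h) *s u) v)"
    by (intro lin_intros bilinear_lin[OF f])
  have "sw (\<epsilon>\<^sub>t h) f = sw 1 (\<lambda>x y. sw (\<epsilon> (x * h) *s y) f)"
    unfolding target_counital_sw by (rule sw_linear[OF sw_bilinear_linear[OF f]])
  also have "\<dots> = sw 1 (\<lambda>x y. sw y (\<lambda>u v. f (\<epsilon> (x * h) *s u) v))"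
    by (simp only: sw_scale_arg[OF f])
  also have "\<dots> = sw 1 (\<lambda>x y. sw x (\<lambda>u v. f (\<epsilon> (u * h) *s v) y))"
    by (rule sw_coassoc[OF tri, symmetric])
  finally have eq: "sw (\<epsilon>\<^sub>t h) f = \<dots>" .
  have "\<dots> = sw 1 (\<lambda>x y. sw 1 (\<lambda>u v. f (\<epsilon> (x * h) *s (y * u)) v))"
    by (rule sw_one1[OF tri])
  also have "\<dots> = sw 1 (\<lambda>u v. sw 1 (\<lambda>x y. f (\<epsilon> (x * h) *s (y * u)) v))"
    by (rule sw_swap)
  finally show "sw (\<epsilon>\<^sub>t h) f = sw 1 (\<lambda>u v. f (\<epsilon>\<^sub>t h * u) v)"
    unfolding eq by (simp add: target_counital_sw sw_mult_right bilinear_sw_left[OF f] scale_mult_left)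
  have "sw 1 (\<lambda>x y. sw x (\<lambda>u v. f (\<epsilon> (u * h) *s v) y)) =
      sw 1 (\<lambda>x y. sw 1 (\<lambda>u v. f (\<epsilon> (x * h) *s (u * y)) v))"
    by (rule sw_one2[OF tri])
  also have "\<dots> = sw 1 (\<lambda>u v. sw 1 (\<lambda>x y. f (\<epsilon> (x * h) *s (u * y)) v))"
    by (rule sw_swap)
  finally show "sw (\<epsilon>\<^sub>t h) f = sw 1 (\<lambda>u v. f (u * \<epsilon>\<^sub>t h) v)"
    unfolding eq by (simp add: target_counital_sw sw_mult_left bilinear_sw_left[OF f] scale_mult_right)
qed

lemma sw_source_counital:
  assumes f: "bilinear_map s f"
  shows "sw (\<epsilon>\<^sub>s h) f = sw 1 (\<lambda>u v. f u (\<epsilon>\<^sub>s h * v))" and "sw (\<epsilon>\<^sub>s h) f = sw 1 (\<lambda>u v. f u (v * \<epsilon>\<^sub>s h))"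
proof -
  have tri: "trilinear_map s (\<lambda>u v y. f u (\<epsilon> (h * y) *s v))"
    by (intro lin_intros bilinear_lin[OF f])
  have "sw (\<epsilon>\<^sub>s h) f = sw 1 (\<lambda>x y. sw (\<epsilon> (h * y) *s x) f)"
    unfolding source_counital_sw by (rule sw_linear[OF sw_bilinear_linear[OF f]])
  also have "\<dots> = sw 1 (\<lambda>x y. sw x (\<lambda>u v. f u (\<epsilon> (h * y) *s v)))"
    by (simp only: sw_scale_arg[OF f] bilinear_scale_left[OF f] bilinear_scale_right[OF f])
  finally have eq: "sw (\<epsilon>\<^sub>s h) f = \<dots>" .
  have "\<dots> = sw 1 (\<lambda>x y. sw 1 (\<lambda>u v. f x (\<epsilon> (h * v) *s (y * u))))"
    by (rule sw_one1[OF tri])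
  then show "sw (\<epsilon>\<^sub>s h) f = sw 1 (\<lambda>u v. f u (v * \<epsilon>\<^sub>s h))"
    unfolding eq by (simp add: source_counital_sw sw_mult_left bilinear_sw_right[OF f] scale_mult_right)
  have "sw 1 (\<lambda>x y. sw x (\<lambda>u v. f u (\<epsilon> (h * y) *s v))) =
      sw 1 (\<lambda>x y. sw 1 (\<lambda>u v. f x (\<epsilon> (h * v) *s (u * y))))"
    by (rule sw_one2[OF tri])
  then show "sw (\<epsilon>\<^sub>s h) f = sw 1 (\<lambda>u v. f u (\<epsilon>\<^sub>s h * v))"
    unfolding eq by (simp add: source_counital_sw sw_mult_right bilinear_sw_right[OF f] scale_mult_left)
qed

lemma target_counital_one: "\<epsilon>\<^sub>t 1 = 1"
  by (simp add: target_counital_sw sw_counit_left)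

lemma source_counital_one: "\<epsilon>\<^sub>s 1 = 1"
  by (simp add: source_counital_sw sw_counit_right)

lemma linear_target_counital: "lin scale \<epsilon>\<^sub>t"
  unfolding target_counital_sw[abs_def] by (intro lin_intros)

end

locale common_base_weak_hopf_algebra = weak_hopf_algebra scale \<Delta> \<epsilon> S
  for scale :: "'k::{alg_closed_field, field_char_0} \<Rightarrow> 'h::{ring, monoid_mult} \<Rightarrow> 'h" (infixr \<open>*s\<close> 75)
    and \<Delta> :: "'h \<Rightarrow> ('k, 'h) tensor2"
    and \<epsilon> :: "'h \<Rightarrow> 'k"
    and S :: "'h \<Rightarrow> 'h" +
  assumes common_base: "target_base = source_base"
begin

sublocale alg_closed_algebra scale ..

lemma target_counital_base: "\<epsilon>\<^sub>t h \<in> target_base"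
  by (simp add: target_base_def)

lemma source_counital_base: "\<epsilon>\<^sub>s h \<in> target_base"
  by (simp add: common_base source_base_def)

lemma sw_base:
  assumes z: "z \<in> target_base" and f: "bilinear_map s f"
  shows "sw z f = sw 1 (\<lambda>u v. f (z * u) v)" "sw z f = sw 1 (\<lambda>u v. f (u * z) v)"
    "sw z f = sw 1 (\<lambda>u v. f u (z * v))" "sw z f = sw 1 (\<lambda>u v. f u (v * z))"
proof -
  obtain h where "z = \<epsilon>\<^sub>t h" using z by (auto simp: target_base_def)
  then show "sw z f = sw 1 (\<lambda>u v. f (z * u) v)" "sw z f = sw 1 (\<lambda>u v. f (u * z) v)"
    using sw_target_counital[OF f] by auto
  obtain h where "z = \<epsilon>\<^sub>s h" using z by (auto simp: common_base source_base_def)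
  then show "sw z f = sw 1 (\<lambda>u v. f u (z * v))" "sw z f = sw 1 (\<lambda>u v. f u (v * z))"
    using sw_source_counital[OF f] by auto
qed

lemma sw_base_mult:
  assumes z: "z \<in> target_base" and w: "w \<in> target_base" and f: "bilinear_map s f"
  shows "sw (z * w) f = sw 1 (\<lambda>u v. f (z * u) (w * v))" "sw (z * w) f = sw 1 (\<lambda>u v. f (u * (z * w)) v)"
proof -
  have "sw (z * w) f = sw z (\<lambda>x y. sw w (\<lambda>u v. f (x * u) (y * v)))"
    by (rule sw_mult[OF f])
  also have "\<dots> = sw 1 (\<lambda>x y. sw w (\<lambda>u v. f (z * x * u) (y * v)))"
    by (rule sw_base(1)[where s = s, OF z]) (intro lin_intros bilinear_lin[OF f])
  also have "\<dots> = sw (1 * w) (\<lambda>p q. f (z * p) q)"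
    by (subst sw_mult[where s = s]) (auto intro!: lin_intros bilinear_lin[OF f] simp: mult.assoc)
  finally have eq: "sw (z * w) f = sw w (\<lambda>p q. f (z * p) q)" by simp
  have b: "bilinear_map s (\<lambda>p q. f (z * p) q)" by (intro lin_intros bilinear_lin[OF f])
  show "sw (z * w) f = sw 1 (\<lambda>u v. f (z * u) (w * v))"
    unfolding eq by (rule sw_base(3)[OF w b])
  have b': "bilinear_map s (\<lambda>p q. f (p * w) q)" by (intro lin_intros bilinear_lin[OF f])
  have "sw w (\<lambda>p q. f (z * p) q) = sw 1 (\<lambda>u v. f (z * u * w) v)"
    using sw_base(2)[OF w b] by (simp add: mult.assoc)
  also have "\<dots> = sw 1 (\<lambda>u v. f (u * (z * w)) v)"
    using sw_base(1,2)[OF z b'] by (simp add: mult.assoc)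
  finally show "sw (z * w) f = sw 1 (\<lambda>u v. f (u * (z * w)) v)" unfolding eq .
qed

lemma base_mult_closed:
  assumes "z \<in> target_base" and "w \<in> target_base"
  shows "z * w \<in> target_base"
proof -
  have "\<epsilon>\<^sub>t (z * w) = z * w"
    using sw_base_mult(2)[OF assms counit_bilinear_left]
    by (simp add: target_counital_sw sw_counit_left)
  then show ?thesis using target_counital_base by metis
qed

text \<open>Both products have the coproduct \<open>z 1\<^sub>1 \<otimes> w 1\<^sub>2\<close>, because an element of the common base may be moved
  to either leg of \<open>\<Delta> 1\<close>.\<close>

lemma base_commute:
  assumes z: "z \<in> target_base" and w: "w \<in> target_base"
  shows "z * w = w * z"
proof -
  let ?f = "\<lambda>x y. \<epsilon> x *s y"
  have b: "bilinear_map scale (\<lambda>p q. ?f p (w * q))" by (intro lin_intros)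
  have "w * z = sw (w * z) ?f" by (simp add: sw_counit_left)
  also have "\<dots> = sw w (\<lambda>x y. sw z (\<lambda>u v. ?f (x * u) (y * v)))"
    by (rule sw_mult[OF counit_bilinear_left])
  also have "\<dots> = sw 1 (\<lambda>x y. sw z (\<lambda>u v. ?f (x * u) (w * y * v)))"
    by (rule sw_base(3)[where s = scale, OF w]) (intro lin_intros)
  also have "\<dots> = sw (1 * z) (\<lambda>p q. ?f p (w * q))"
    by (subst sw_mult[OF b]) (simp add: mult.assoc)
  also have "\<dots> = sw 1 (\<lambda>u v. ?f (z * u) (w * v))"
    using sw_base(1)[OF z b] by simp
  also have "\<dots> = sw (z * w) ?f"
    by (rule sw_base_mult(1)[OF z w counit_bilinear_left, symmetric])
  finally show ?thesis by (simp add: sw_counit_left)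
qed

text \<open>In \<open>S z = S z\<^sub>1 * z\<^sub>2 * S z\<^sub>3\<close> the coproduct formulas collect \<open>z\<close> between \<open>S 1\<^sub>1 * 1\<^sub>2 = 1\<close> and
  \<open>1\<^sub>1 * S 1\<^sub>2 = 1\<close>.\<close>

lemma antipode_base:
  assumes z: "z \<in> target_base"
  shows "S z = z"
proof -
  let ?G = "\<lambda>x y. sw x (\<lambda>u v. S u * v * S y)"
  have G: "bilinear_map scale ?G" by (intro lin_intros)
  have G': "bilinear_map scale (\<lambda>x y. ?G (x * z) y)" by (intro lin_intros)
  have base: "?G w y = w * S y" if w: "w \<in> target_base" for w y
  proof -
    have "?G w y = sw 1 (\<lambda>u v. S u * (v * w) * S y)"
      by (rule sw_base(4)[where s = scale, OF w]) (intro lin_intros)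
    also have "\<dots> = sw 1 (\<lambda>u v. S u * v) * (w * S y)"
      by (simp add: sw_mult_right mult.assoc)
    finally show ?thesis by (simp add: sw_antipode_left source_counital_one)
  qed
  have "S z = sw 1 (\<lambda>x y. ?G (x * z) y)"
    unfolding sw_antipode_sandwich[of z] by (rule sw_base(2)[OF z G])
  also have "\<dots> = sw 1 (\<lambda>x y. ?G (\<epsilon>\<^sub>s x * z) y)"
    by (rule sw_one_base_legs(2)[OF G'])
  also have "\<dots> = sw 1 (\<lambda>x y. z * (\<epsilon>\<^sub>s x * S y))"
    by (simp only: base[OF base_mult_closed[OF source_counital_base z]])
      (simp only: base_commute[OF source_counital_base z] mult.assoc)
  also have "\<dots> = sw 1 (\<lambda>x y. z * (x * S y))"
    by (rule sw_one_base_legs(2)[where s = scale, symmetric]) (intro lin_intros)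
  also have "\<dots> = z * \<epsilon>\<^sub>t 1"
    by (simp flip: sw_mult_left add: sw_antipode_right)
  finally show ?thesis by (simp add: target_counital_one)
qed

lemma sw_one_mult: "sw 1 (\<lambda>x y. x * y) = 1"
proof -
  have "sw 1 (\<lambda>x y. x * y) = sw 1 (\<lambda>x y. \<epsilon>\<^sub>s x * y)"
    by (rule sw_one_base_legs(2)[where s = scale]) (intro lin_intros)
  also have "\<dots> = sw 1 (\<lambda>x y. S (\<epsilon>\<^sub>s x) * y)"
    by (simp add: antipode_base[OF source_counital_base])
  also have "\<dots> = sw 1 (\<lambda>x y. S x * y)"
    by (rule sw_one_base_legs(2)[where s = scale, symmetric]) (intro lin_intros)
  finally show ?thesis by (simp add: sw_antipode_left source_counital_one)
qed

lemma subspace_target_base: "subspace target_base"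
proof -
  interpret t: Vector_Spaces.linear scale scale \<epsilon>\<^sub>t by (rule linear_target_counital)
  show ?thesis unfolding target_base_def by (rule t.subspace_image[OF subspace_UNIV])
qed

text \<open>\<open>\<Delta> 1\<close> is a separability idempotent of the base. Averaging a linear projection onto the ideal
  generated by \<open>n\<close> shows that this ideal has a unit, so that \<open>n\<close> is a multiple of \<open>n * n\<close>.\<close>

lemma base_reduced:
  assumes n: "n \<in> target_base" "n * n = 0"
  shows "n = 0"
proof -
  interpret p: vector_space_pair scale scale ..
  define I where "I = (\<lambda>z. n * z) ` target_base"
  interpret m: Vector_Spaces.linear scale scale "\<lambda>z. n * z" by (rule linear_mult_right)
  have I: "subspace I" unfolding I_def by (rule m.subspace_image[OF subspace_target_base])
  obtain p where p: "lin scale p" "p ` UNIV \<subseteq> I" "\<And>v. v \<in> I \<Longrightarrow> p v = v"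
    using p.linear_exists_left_inverse_on[OF lin_id I] by (auto simp: inj_on_def)
  note lin_p = lin_compose[OF _ p(1)]
  have ideal: "w * a \<in> I" if wa: "w \<in> target_base" "a \<in> I" for w a
  proof -
    obtain z where z: "z \<in> target_base" "a = n * z" using wa(2) by (auto simp: I_def)
    have "w * a = n * (w * z)"
      using base_commute[OF n(1) wa(1)] z(2) by (simp flip: mult.assoc)
    then show ?thesis using base_mult_closed[OF wa(1) z(1)] by (auto simp: I_def)
  qed
  define f where "f = sw 1 (\<lambda>x y. x * p y)"
  have b: "bilinear_map scale (\<lambda>x y. x * p y)"
    by (intro bilinear_mapI lin_mult_left lin_mult_right lin_id lin_p)
  have "f = sw 1 (\<lambda>x y. \<epsilon>\<^sub>s x * p y)"
    unfolding f_def by (rule sw_one_base_legs(2)[OF b])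
  also have "\<dots> \<in> I"
    unfolding sw_def using p(2) by (intro subspace_sum I ideal source_counital_base) blast
  finally obtain z where z: "f = n * z" by (auto simp: I_def)
  have nI: "n \<in> I"
    using target_counital_base[of 1] unfolding I_def target_counital_one
    by (metis imageI mult_1_right)
  have "n = sw 1 (\<lambda>x y. x * y) * n" by (simp add: sw_one_mult)
  also have "\<dots> = sw 1 (\<lambda>x y. x * (y * n))" by (simp add: sw_mult_right mult.assoc)
  also have "\<dots> = sw 1 (\<lambda>x y. x * (\<epsilon>\<^sub>t y * n))"
    by (rule sw_one_base_legs(1)[where s = scale]) (intro lin_intros)
  also have "\<dots> = sw 1 (\<lambda>x y. x * p (\<epsilon>\<^sub>t y * n))"
    by (simp add: p(3)[OF ideal[OF target_counital_base nI]])
  also have "\<dots> = sw 1 (\<lambda>x y. x * p (y * n))"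
    by (rule sw_one_base_legs(1)[where s = scale, symmetric])
      (intro bilinear_mapI lin_mult_left lin_mult_right lin_id lin_p)
  also have "\<dots> = sw 1 (\<lambda>x y. n * x * p y)"
    using sw_base(4)[OF n(1) b] sw_base(1)[OF n(1) b] by simp
  also have "\<dots> = n * f" by (simp add: f_def sw_mult_left mult.assoc)
  also have "\<dots> = 0" using n(2) by (simp add: z flip: mult.assoc)
  finally show ?thesis .
qed

text \<open>The base is a product of copies of the field, and its only separability idempotent is the
  diagonal one.\<close>

lemma comult_one_diagonal:
  "\<exists>E. orthogonal_idempotents E \<and> \<Sum>E = 1 \<and> (\<forall>e\<in>E. S e = e) \<and> \<Delta> 1 = (\<Sum>e\<in>E. pure2 e e)"
proof -
  have "target_base \<subseteq> span (snd ` set (legs 1))"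
  proof
    fix z assume "z \<in> target_base"
    then obtain h where z: "z = sw 1 (\<lambda>x y. \<epsilon> (x * h) *s y)"
      by (auto simp: target_base_def target_counital_sw)
    show "z \<in> span (snd ` set (legs 1))"
      unfolding z sw_def by (intro span_sum span_scale span_base) auto
  qed
  then obtain E where E: "orthogonal_idempotents E" "span E = target_base"
    using idempotent_basis_exists[OF subspace_target_base, of "snd ` set (legs 1)"]
      base_mult_closed base_commute base_reduced by blast
  have EB: "e \<in> target_base" if "e \<in> E" for e
    using span_base[OF that] E(2) by simp
  have finE: "finite E" using E(1) by (simp add: orthogonal_idempotents_def)
  have sumE: "\<Sum>E = 1"
    using orthogonal_idempotents_unit[OF E(1), of 1] target_counital_base[of 1] E(2)
    by (simp add: target_counital_one)
  define co where "co e z = (SOME c. e * z = c *s e)" for e z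
  have co: "e * z = co e z *s e" if "e \<in> E" "z \<in> target_base" for e z
    unfolding co_def
    by (rule someI_ex[OF orthogonal_idempotents_coordinate[OF E(1)]]) (use that E(2) in auto)
  define \<kappa> where "\<kappa> e = sw 1 (\<lambda>x y. co e (\<epsilon>\<^sub>s x) * co e (\<epsilon>\<^sub>t y))" for e
  have diag: "sw 1 (\<lambda>x y. f (e * x) y) = fun_scale (\<kappa> e) (f e e)"
    if e: "e \<in> E" and f: "bilinear_map fun_scale f" for e and f :: "'h \<Rightarrow> 'h \<Rightarrow> ('k, 'h) tensor2"
  proof -
    interpret vs: vector_space "fun_scale :: 'k \<Rightarrow> ('k, 'h) tensor2 \<Rightarrow> _"
      by (rule vector_space_fun_scale)
    have ee: "e * e = e" using orthogonal_idempotents_mult[OF E(1) e e] by simp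
    have b: "bilinear_map fun_scale (\<lambda>x y. f (e * x) y)" by (intro lin_intros bilinear_lin[OF f])
    have b2: "bilinear_map fun_scale (\<lambda>x y. f (e * x) (e * y))" by (intro lin_intros bilinear_lin[OF f])
    have b3: "bilinear_map fun_scale (\<lambda>x y. f (e * x) (e * \<epsilon>\<^sub>t y))"
      by (intro lin_intros bilinear_lin[OF f] lin_compose[OF _ linear_target_counital])
    have "sw 1 (\<lambda>x y. f (e * x) y) = sw 1 (\<lambda>x y. f (e * (e * x)) y)"
      by (simp flip: mult.assoc add: ee)
    also have "\<dots> = sw 1 (\<lambda>x y. f (e * x) (e * y))"
      using sw_base(1)[OF EB[OF e] b] sw_base(3)[OF EB[OF e] b] by simp
    also have "\<dots> = sw 1 (\<lambda>x y. f (e * x) (e * \<epsilon>\<^sub>t y))" by (rule sw_one_base_legs(1)[OF b2])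
    also have "\<dots> = sw 1 (\<lambda>x y. f (e * \<epsilon>\<^sub>s x) (e * \<epsilon>\<^sub>t y))" by (rule sw_one_base_legs(2)[OF b3])
    also have "\<dots> = sw 1 (\<lambda>x y. fun_scale (co e (\<epsilon>\<^sub>s x) * co e (\<epsilon>\<^sub>t y)) (f e e))"
      by (simp add: co[OF e] source_counital_base target_counital_base bilinear_scale_left[OF f]
          bilinear_scale_right[OF f] mult.commute)
    also have "\<dots> = fun_scale (\<kappa> e) (f e e)"
      unfolding \<kappa>_def sw_def by (rule vs.scale_sum_left[symmetric])
    finally show ?thesis .
  qed
  have \<kappa>1: "\<kappa> e = 1" if e: "e \<in> E" for e
  proof -
    have e0: "e \<noteq> 0" using E(1) e by (auto simp: orthogonal_idempotents_def)
    have b: "bilinear_map scale (\<lambda>x y. \<epsilon>\<^sub>s x * y)"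
      unfolding source_counital_sw by (intro lin_intros)
    have "e = e * sw 1 (\<lambda>x y. x * y)" by (simp add: sw_one_mult)
    also have "sw 1 (\<lambda>x y. x * y) = sw 1 (\<lambda>x y. \<epsilon>\<^sub>s x * y)"
      by (rule sw_one_base_legs(2)[where s = scale]) (intro lin_intros)
    also have "\<dots> = sw 1 (\<lambda>x y. \<epsilon>\<^sub>s x * \<epsilon>\<^sub>t y)" by (rule sw_one_base_legs(1)[OF b])
    also have "e * \<dots> = sw 1 (\<lambda>x y. (e * \<epsilon>\<^sub>s x) * \<epsilon>\<^sub>t y)" by (simp add: sw_mult_left mult.assoc)
    also have "\<dots> = sw 1 (\<lambda>x y. (co e (\<epsilon>\<^sub>s x) * co e (\<epsilon>\<^sub>t y)) *s e)"
      by (simp add: co[OF e] source_counital_base target_counital_base scale_mult_left mult.commute)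
    also have "\<dots> = \<kappa> e *s e" by (simp add: \<kappa>_def sw_scale_left)
    finally have "\<kappa> e *s e = 1 *s e" by simp
    then show ?thesis using e0 by (simp only: scale_cancel_right) simp
  qed
  have "\<Delta> 1 = sw 1 pure2" by (simp add: comult_legs[of 1] sw_sum_list)
  also have "\<dots> = sw 1 (\<lambda>x y. \<Sum>e\<in>E. pure2 (e * x) y)"
  proof -
    have "pure2 x y = (\<Sum>e\<in>E. pure2 (e * x) y)" for x y
    proof -
      have "pure2 x y = pure2 (\<Sum>e\<in>E. e * x) y"
        by (simp flip: sum_distrib_right add: sumE)
      also have "\<dots> = (\<Sum>e\<in>E. pure2 (e * x) y)"
        by (rule linear_sum'[of scale fun_scale "\<lambda>x. pure2 x y"])
          (use bilinear_map_pure2 in \<open>simp add: bilinear_map_def\<close>)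
      finally show ?thesis .
    qed
    then have "pure2 = (\<lambda>x y. \<Sum>e\<in>E. pure2 (e * x) y)" by blast
    then show ?thesis by (rule arg_cong)
  qed
  also have "\<dots> = (\<Sum>e\<in>E. fun_scale (\<kappa> e) (pure2 e e))"
    by (simp add: sw_sum diag[OF _ bilinear_map_pure2] cong: sum.cong)
  also have "\<dots> = (\<Sum>e\<in>E. pure2 e e)"
    by (rule sum.cong) (simp_all add: \<kappa>1 fun_scale_def)
  finally show ?thesis
    using E(1) sumE antipode_base EB by (intro exI[of _ E]) simp
qed

end


section \<open>Weak Hopf algebras with a diagonal coproduct of the unit\<close>

text \<open>Such an algebra is a category enriched in coalgebras: \<open>E\<close> is the set of objects, the corner
  \<open>e * H * f\<close> is the coalgebra of morphisms between two objects, and the elements of \<open>E\<close> are the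
  identities. The counital maps send a morphism to a multiple of the identity of its target or
  source.\<close>

locale diagonal_weak_hopf_algebra = weak_hopf_algebra scale \<Delta> \<epsilon> S
  for scale :: "'k::field \<Rightarrow> 'h::{ring, monoid_mult} \<Rightarrow> 'h" (infixr \<open>*s\<close> 75)
    and \<Delta> :: "'h \<Rightarrow> ('k, 'h) tensor2"
    and \<epsilon> :: "'h \<Rightarrow> 'k"
    and S :: "'h \<Rightarrow> 'h" +
  fixes E :: "'h set"
  assumes orthogonal_E: "orthogonal_idempotents E"
    and sum_E: "\<Sum>E = 1"
    and antipode_E: "e \<in> E \<Longrightarrow> S e = e"
    and comult_one: "\<Delta> 1 = (\<Sum>e\<in>E. pure2 e e)"
begin

sublocale \<epsilon>: Vector_Spaces.linear scale "(*)" \<epsilon> by (rule linear_counit)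
sublocale S: Vector_Spaces.linear scale scale S by (rule linear_antipode)

lemma finite_E: "finite E"
  using orthogonal_E by (simp add: orthogonal_idempotents_def)

lemma E_mult: "e \<in> E \<Longrightarrow> f \<in> E \<Longrightarrow> e * f = (if e = f then e else 0)"
  by (rule orthogonal_idempotents_mult[OF orthogonal_E])

lemma E_mult_assoc: "e \<in> E \<Longrightarrow> f \<in> E \<Longrightarrow> e * (f * x) = (if e = f then e * x else 0)"
  by (simp flip: mult.assoc add: E_mult)

lemma E_mult_assoc': "e \<in> E \<Longrightarrow> f \<in> E \<Longrightarrow> x * e * f = (if e = f then x * e else 0)"
  by (simp add: mult.assoc E_mult)

lemma sum_E_single:
  assumes "e \<in> E" and "\<And>i. i \<in> E \<Longrightarrow> g i = (if i = e then c else 0)"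
  shows "sum g E = c"
  using assms finite_E by (simp cong: sum.cong)

lemma sum_E_left: "(\<Sum>e\<in>E. e * x) = x"
  by (simp flip: sum_distrib_right add: sum_E)

lemma sum_E_right: "(\<Sum>e\<in>E. x * e) = x"
  by (simp flip: sum_distrib_left add: sum_E)

lemma sw_one:
  assumes f: "bilinear_map s f"
  shows "sw 1 f = (\<Sum>e\<in>E. f e e)"
proof (rule separation[OF bilinear_map_vector_space[OF f]])
  fix \<phi> assume \<phi>: "Vector_Spaces.linear s (*) \<phi>"
  note b = bilinear_map_compose[OF f \<phi>]
  have "\<phi> (sw 1 f) = \<Delta> 1 (\<lambda>x y. \<phi> (f x y))"
    by (simp add: sw_linear[OF \<phi>] comult_apply[OF b])
  then show "\<phi> (sw 1 f) = \<phi> (\<Sum>e\<in>E. f e e)"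
    by (simp add: comult_one sum_fun_apply pure2_apply[OF b] linear_sum'[OF \<phi>])
qed

lemma counit_E: 
  assumes e: "e \<in> E"
  shows "\<epsilon> e = 1"
proof -
  have "e = e * sw 1 (\<lambda>x y. \<epsilon> x *s y)" by (simp add: sw_counit_left)
  also have "\<dots> = (\<Sum>f\<in>E. \<epsilon> f *s (e * f))"
    by (simp add: sw_one[OF counit_bilinear_left] sum_distrib_left scale_mult_right)
  also have "\<dots> = \<epsilon> e *s e"
    by (rule sum_E_single[OF e]) (use e in \<open>auto simp: E_mult\<close>)
  finally have "\<epsilon> e *s e = 1 *s e" by simp
  moreover have "e \<noteq> 0" using e orthogonal_E by (auto simp: orthogonal_idempotents_def)
  ultimately show ?thesis by (simp only: scale_cancel_right) simp
qed

lemma target_counital_sum: "\<epsilon>\<^sub>t h = (\<Sum>e\<in>E. \<epsilon> (e * h) *s e)"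
  unfolding target_counital_sw by (rule sw_one[where s = scale]) (intro lin_intros)

lemma source_counital_sum: "\<epsilon>\<^sub>s h = (\<Sum>e\<in>E. \<epsilon> (h * e) *s e)"
  unfolding source_counital_sw by (rule sw_one[where s = scale]) (intro lin_intros)

lemma target_counital_E: 
  assumes e: "e \<in> E"
  shows "\<epsilon>\<^sub>t e = e"
proof -
  have "\<epsilon>\<^sub>t e = e"
    unfolding target_counital_sum by (rule sum_E_single[OF e]) (use e in \<open>auto simp: E_mult counit_E\<close>)
  then show ?thesis using e finite_E by simp
qed

lemma bilinear_zero:
  assumes f: "bilinear_map s f"
  shows "f 0 y = 0" "f x 0 = 0"
  using f linear_sum'[of scale s "\<lambda>x. f x y" "\<lambda>_. 0" "{}"] linear_sum'[of scale s "f x" "\<lambda>_. 0" "{}"]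
  by (simp_all add: bilinear_map_def)

lemma sw_E:
  assumes e: "e \<in> E" and f: "bilinear_map s f"
  shows "sw e f = f e e"
proof -
  have b: "bilinear_map s (\<lambda>u v. f (e * u) v)" by (intro lin_intros bilinear_lin[OF f])
  have "sw e f = (\<Sum>g\<in>E. f (e * g) g)"
    using sw_target_counital(1)[OF f, of e] sw_one[OF b] by (simp add: target_counital_E[OF e])
  also have "\<dots> = f e e"
    by (rule sum_E_single[OF e]) (use e in \<open>auto simp: E_mult bilinear_zero[OF f]\<close>)
  finally show ?thesis using e finite_E by simp
qed

lemma counit_mult: "\<epsilon> (g * h) = (\<Sum>e\<in>E. \<epsilon> (g * e) * \<epsilon> (e * h))"
proof -
  have "\<epsilon> (g * 1 * h) = sw 1 (\<lambda>x y. \<epsilon> (g * x) * \<epsilon> (y * h))" by (rule counit_mult_sw)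
  also have "\<dots> = (\<Sum>e\<in>E. \<epsilon> (g * e) * \<epsilon> (e * h))"
    by (rule sw_one[where s = "(*)"]) (intro lin_intros)
  finally show ?thesis by simp
qed

lemma sum_sw_E_left:
  assumes f: "bilinear_map s f"
  shows "(\<Sum>e\<in>E. sw (e * h) f) = sw h f"
  by (simp flip: linear_sum'[OF sw_bilinear_linear[OF f]] add: sum_E_left)

lemma sum_sw_E_right:
  assumes f: "bilinear_map s f"
  shows "(\<Sum>e\<in>E. sw (h * e) f) = sw h f"
  by (simp flip: linear_sum'[OF sw_bilinear_linear[OF f]] add: sum_E_right)

lemma sw_E_mult_both:
  assumes e: "e \<in> E" and f: "bilinear_map s f"
  shows "sw (e * h) f = sw h (\<lambda>u v. f (e * u) (e * v))"
proof -
  have "sw (e * h) f = sw e (\<lambda>x y. sw h (\<lambda>u v. f (x * u) (y * v)))" by (rule sw_mult[OF f])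
  also have "\<dots> = sw h (\<lambda>u v. f (e * u) (e * v))"
    by (rule sw_E[OF e, where s = s]) (intro lin_intros bilinear_lin[OF f])
  finally show ?thesis .
qed

lemma sw_mult_E_both:
  assumes e: "e \<in> E" and f: "bilinear_map s f"
  shows "sw (h * e) f = sw h (\<lambda>u v. f (u * e) (v * e))"
proof -
  have "sw e (\<lambda>u v. f (x * u) (y * v)) = f (x * e) (y * e)" for x y
    by (rule sw_E[OF e, where s = s]) (intro lin_intros bilinear_lin[OF f])
  then show ?thesis by (simp only: sw_mult[OF f])
qed

text \<open>Since \<open>\<Delta> h = \<Delta> 1 * \<Delta> h\<close>, both legs of a coproduct have the same source and the same target, so
  multiplying one leg by an element of \<open>E\<close> is the same as multiplying both.\<close>

lemma sw_E_mult:
  assumes e: "e \<in> E" and f: "bilinear_map s f"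
  shows "sw h (\<lambda>x y. f (e * x) y) = sw (e * h) f" "sw h (\<lambda>x y. f x (e * y)) = sw (e * h) f"
    "sw h (\<lambda>x y. f (x * e) y) = sw (h * e) f" "sw h (\<lambda>x y. f x (y * e)) = sw (h * e) f"
proof -
  have both: "sw h g = (\<Sum>i\<in>E. sw h (\<lambda>u v. g (i * u) (i * v)))" if "bilinear_map s g" for g
    by (subst sum_sw_E_left[OF that, symmetric]) (rule sum.cong, simp_all add: sw_E_mult_both[OF _ that])
  have both': "sw h g = (\<Sum>i\<in>E. sw h (\<lambda>u v. g (u * i) (v * i)))" if "bilinear_map s g" for g
    by (subst sum_sw_E_right[OF that, symmetric]) (rule sum.cong, simp_all add: sw_mult_E_both[OF _ that])
  have sw0: "sw h (\<lambda>x y. 0) = 0" by (simp add: sw_def)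
  have "sw h (\<lambda>x y. f (e * x) y) = (\<Sum>i\<in>E. sw h (\<lambda>u v. f (e * (i * u)) (i * v)))"
    by (rule both) (intro lin_intros bilinear_lin[OF f])
  also have "\<dots> = sw h (\<lambda>u v. f (e * u) (e * v))"
    by (rule sum_E_single[OF e]) (use e in \<open>auto simp: E_mult_assoc bilinear_zero[OF f] sw0\<close>)
  finally show "sw h (\<lambda>x y. f (e * x) y) = sw (e * h) f"
    using e finite_E by (simp add: sw_E_mult_both[OF e f])
  have "sw h (\<lambda>x y. f x (e * y)) = (\<Sum>i\<in>E. sw h (\<lambda>u v. f (i * u) (e * (i * v))))"
    by (rule both) (intro lin_intros bilinear_lin[OF f])
  also have "\<dots> = sw h (\<lambda>u v. f (e * u) (e * v))"
    by (rule sum_E_single[OF e]) (use e in \<open>auto simp: E_mult_assoc bilinear_zero[OF f] sw0\<close>)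
  finally show "sw h (\<lambda>x y. f x (e * y)) = sw (e * h) f"
    using e finite_E by (simp add: sw_E_mult_both[OF e f])
  have "sw h (\<lambda>x y. f (x * e) y) = (\<Sum>i\<in>E. sw h (\<lambda>u v. f (u * i * e) (v * i)))"
    by (rule both') (intro lin_intros bilinear_lin[OF f])
  also have "\<dots> = sw h (\<lambda>u v. f (u * e) (v * e))"
    by (rule sum_E_single[OF e]) (use e in \<open>auto simp: E_mult_assoc' bilinear_zero[OF f] sw0\<close>)
  finally show "sw h (\<lambda>x y. f (x * e) y) = sw (h * e) f"
    using e finite_E by (simp add: sw_mult_E_both[OF e f])
  have "sw h (\<lambda>x y. f x (y * e)) = (\<Sum>i\<in>E. sw h (\<lambda>u v. f (u * i) (v * i * e)))"
    by (rule both') (intro lin_intros bilinear_lin[OF f])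
  also have "\<dots> = sw h (\<lambda>u v. f (u * e) (v * e))"
    by (rule sum_E_single[OF e]) (use e in \<open>auto simp: E_mult_assoc' bilinear_zero[OF f] sw0\<close>)
  finally show "sw h (\<lambda>x y. f x (y * e)) = sw (h * e) f"
    using e finite_E by (simp add: sw_mult_E_both[OF e f])
qed

lemma sw_counital:
  assumes f: "bilinear_map s f"
  shows "sw h (\<lambda>x y. f (\<epsilon>\<^sub>s x) y) = (\<Sum>e\<in>E. f e (h * e))"
    "sw h (\<lambda>x y. f x (\<epsilon>\<^sub>s y)) = (\<Sum>e\<in>E. f (h * e) e)"
    "sw h (\<lambda>x y. f (\<epsilon>\<^sub>t x) y) = (\<Sum>e\<in>E. f e (e * h))"
    "sw h (\<lambda>x y. f x (\<epsilon>\<^sub>t y)) = (\<Sum>e\<in>E. f (e * h) e)"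
proof -
  have sums: "f (sum g E) y = (\<Sum>e\<in>E. f (g e) y)" "f x (sum g E) = (\<Sum>e\<in>E. f x (g e))" for g x y
    using f linear_sum'[of scale s "\<lambda>x. f x y"] linear_sum'[of scale s "f x"]
    by (simp_all add: bilinear_map_def)
  note sc = bilinear_scale_left[OF f] bilinear_scale_right[OF f]
  have "sw h (\<lambda>x y. f (\<epsilon>\<^sub>s x) y) = (\<Sum>e\<in>E. f e (sw h (\<lambda>x y. \<epsilon> (x * e) *s y)))"
    by (simp add: source_counital_sum sums sw_sum bilinear_sw_right[OF f] sc)
  then show "sw h (\<lambda>x y. f (\<epsilon>\<^sub>s x) y) = (\<Sum>e\<in>E. f e (h * e))"
    by (simp add: sw_E_mult(3)[OF _ counit_bilinear_left] sw_counit_left cong: sum.cong)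
  have "sw h (\<lambda>x y. f x (\<epsilon>\<^sub>s y)) = (\<Sum>e\<in>E. f (sw h (\<lambda>x y. \<epsilon> (y * e) *s x)) e)"
    by (simp add: source_counital_sum sums sw_sum bilinear_sw_left[OF f] sc)
  then show "sw h (\<lambda>x y. f x (\<epsilon>\<^sub>s y)) = (\<Sum>e\<in>E. f (h * e) e)"
    by (simp add: sw_E_mult(4)[OF _ counit_bilinear_right] sw_counit_right cong: sum.cong)
  have "sw h (\<lambda>x y. f (\<epsilon>\<^sub>t x) y) = (\<Sum>e\<in>E. f e (sw h (\<lambda>x y. \<epsilon> (e * x) *s y)))"
    by (simp add: target_counital_sum sums sw_sum bilinear_sw_right[OF f] sc)
  then show "sw h (\<lambda>x y. f (\<epsilon>\<^sub>t x) y) = (\<Sum>e\<in>E. f e (e * h))"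
    by (simp add: sw_E_mult(1)[OF _ counit_bilinear_left] sw_counit_left cong: sum.cong)
  have "sw h (\<lambda>x y. f x (\<epsilon>\<^sub>t y)) = (\<Sum>e\<in>E. f (sw h (\<lambda>x y. \<epsilon> (e * y) *s x)) e)"
    by (simp add: target_counital_sum sums sw_sum bilinear_sw_left[OF f] sc)
  then show "sw h (\<lambda>x y. f x (\<epsilon>\<^sub>t y)) = (\<Sum>e\<in>E. f (e * h) e)"
    by (simp add: sw_E_mult(2)[OF _ counit_bilinear_right] sw_counit_right cong: sum.cong)
qed

lemma sw_antipode_cancel:
  assumes f: "bilinear_map s f"
  shows "sw h (\<lambda>x y. sw x (\<lambda>u v. f (S u * v) y)) = (\<Sum>e\<in>E. f e (h * e))"
    "sw h (\<lambda>x y. sw y (\<lambda>u v. f x (S u * v))) = (\<Sum>e\<in>E. f (h * e) e)"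
    "sw h (\<lambda>x y. sw x (\<lambda>u v. f (u * S v) y)) = (\<Sum>e\<in>E. f e (e * h))"
    "sw h (\<lambda>x y. sw y (\<lambda>u v. f x (u * S v))) = (\<Sum>e\<in>E. f (e * h) e)"
  by (simp_all flip: bilinear_sw_left[OF f] bilinear_sw_right[OF f] sw_counital[OF f]
      add: sw_antipode_left sw_antipode_right)

lemma antipode_sw_target: "S h = sw h (\<lambda>x y. S x * \<epsilon>\<^sub>t y)"
proof -
  have "S h = sw h (\<lambda>x y. sw x (\<lambda>u v. S u * (v * S y)))"
    using sw_antipode_sandwich[of h] by (simp add: mult.assoc)
  also have "\<dots> = sw h (\<lambda>x y. sw y (\<lambda>u v. S x * (u * S v)))"
    by (rule sw_coassoc[where s = scale]) (intro lin_intros)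
  finally show ?thesis by (simp flip: sw_mult_left add: sw_antipode_right)
qed

lemma antipode_sw_source: "S h = sw h (\<lambda>x y. \<epsilon>\<^sub>s x * S y)"
  using sw_antipode_sandwich[of h] by (simp flip: sw_mult_right add: sw_antipode_left)

lemma antipode_mult_E:
  assumes e: "e \<in> E"
  shows "S (h * e) = e * S h" "S (e * h) = S h * e"
proof -
  have src: "S h = (\<Sum>i\<in>E. i * S (h * i))" for h
    by (subst antipode_sw_source, rule sw_counital(1)[where s = scale]) (intro lin_intros)
  have tgt: "S h = (\<Sum>i\<in>E. S (i * h) * i)" for h
    by (subst antipode_sw_target, rule sw_counital(4)[where s = scale]) (intro lin_intros)
  have "S (h * e) = (\<Sum>i\<in>E. i * S (h * e * i))" by (rule src)
  also have "\<dots> = e * S (h * e)"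
    by (rule sum_E_single[OF e]) (use e in \<open>auto simp: E_mult_assoc'\<close>)
  finally have 1: "S (h * e) = e * S (h * e)" using e finite_E by simp
  have "e * S h = (\<Sum>i\<in>E. e * (i * S (h * i)))"
    by (subst src) (simp add: sum_distrib_left)
  also have "\<dots> = e * S (h * e)"
    by (rule sum_E_single[OF e]) (use e in \<open>auto simp: E_mult_assoc\<close>)
  finally show "S (h * e) = e * S h" using e finite_E 1 by simp
  have "S (e * h) = (\<Sum>i\<in>E. S (i * (e * h)) * i)" by (rule tgt)
  also have "\<dots> = S (e * h) * e"
    by (rule sum_E_single[OF e]) (use e in \<open>auto simp: E_mult_assoc\<close>)
  finally have 2: "S (e * h) = S (e * h) * e" using e finite_E by simp
  have "S h * e = (\<Sum>i\<in>E. S (i * h) * i * e)"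
    by (subst tgt) (simp add: sum_distrib_right)
  also have "\<dots> = S (e * h) * e"
    by (rule sum_E_single[OF e]) (use e in \<open>auto simp: E_mult_assoc'\<close>)
  finally show "S (e * h) = S h * e" using e finite_E 2 by simp
qed

lemma counit_target_counital: "\<epsilon> (\<epsilon>\<^sub>t h) = \<epsilon> h"
proof -
  have "\<epsilon> (\<epsilon>\<^sub>t h) = (\<Sum>e\<in>E. \<epsilon> (e * h))"
    by (simp add: target_counital_sum \<epsilon>.sum \<epsilon>.scale counit_E cong: sum.cong)
  then show ?thesis by (simp flip: \<epsilon>.sum add: sum_E_left)
qed

lemma counit_antipode: "\<epsilon> (S h) = \<epsilon> h"
proof -
  have "\<epsilon> h = sw h (\<lambda>x y. \<epsilon> (x * S y))"
    by (simp flip: sw_linear[OF linear_counit] add: sw_antipode_right counit_target_counital)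
  also have "\<dots> = (\<Sum>e\<in>E. sw h (\<lambda>x y. \<epsilon> (x * e) * \<epsilon> (e * S y)))"
    unfolding sw_sum[symmetric] by (subst counit_mult) (rule refl)
  also have "\<dots> = (\<Sum>e\<in>E. \<epsilon> (S (h * e)))"
  proof (rule sum.cong[OF refl])
    fix e assume e: "e \<in> E"
    have b: "bilinear_map (*) (\<lambda>x y. \<epsilon> x * \<epsilon> (e * S y))" by (intro lin_intros)
    have "sw h (\<lambda>x y. \<epsilon> (x * e) * \<epsilon> (e * S y)) = sw (h * e) (\<lambda>x y. \<epsilon> x * \<epsilon> (e * S y))"
      by (rule sw_E_mult(3)[OF e b])
    also have "\<dots> = \<epsilon> (e * S (sw (h * e) (\<lambda>x y. \<epsilon> x *s y)))"
      by (simp add: sw_linear[OF linear_antipode] sw_mult_left sw_linear[OF linear_counit] S.scale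
          scale_mult_right \<epsilon>.scale)
    also have "\<dots> = \<epsilon> (S (h * e))"
      using E_mult[OF e e] by (simp add: sw_counit_left mult.assoc flip: antipode_mult_E[OF e])
    finally show "sw h (\<lambda>x y. \<epsilon> (x * e) * \<epsilon> (e * S y)) = \<epsilon> (S (h * e))" .
  qed
  also have "\<dots> = \<epsilon> (S h)" by (simp flip: \<epsilon>.sum S.sum add: sum_E_right)
  finally show ?thesis by simp
qed

lemma source_counital_antipode: "\<epsilon>\<^sub>s (S h) = \<epsilon>\<^sub>t h"
  unfolding source_counital_sum target_counital_sum
  by (rule sum.cong) (simp_all flip: antipode_mult_E add: counit_antipode)

lemma target_counital_mult: "\<epsilon>\<^sub>t (g * h) = \<epsilon>\<^sub>t (g * \<epsilon>\<^sub>t h)"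
proof -
  have "\<epsilon> (e * (g * h)) = \<epsilon> (e * (g * \<epsilon>\<^sub>t h))" for e
    using counit_mult[of "e * g" h]
    by (simp add: target_counital_sum sum_distrib_left scale_mult_right \<epsilon>.sum \<epsilon>.scale mult.assoc mult.commute)
  then show ?thesis by (simp add: target_counital_sum[of "g * _"])
qed

lemma target_counital_idem: "\<epsilon>\<^sub>t (\<epsilon>\<^sub>t h) = \<epsilon>\<^sub>t h"
  using target_counital_mult[of 1 h] by simp

lemma sw_target_counital_mult:
  assumes f: "bilinear_map s f"
  shows "sw (\<epsilon>\<^sub>t q * x) f = sw x (\<lambda>u v. f (\<epsilon>\<^sub>t q * u) v)"
proof -
  have b: "bilinear_map s (\<lambda>u v. f (\<epsilon>\<^sub>t q * u) v)" by (intro lin_intros bilinear_lin[OF f])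
  have "sw (\<epsilon>\<^sub>t q * x) f = sw (\<epsilon>\<^sub>t q) (\<lambda>a b. sw x (\<lambda>u v. f (a * u) (b * v)))" by (rule sw_mult[OF f])
  also have "\<dots> = sw 1 (\<lambda>a b. sw x (\<lambda>u v. f (\<epsilon>\<^sub>t q * a * u) (b * v)))"
    by (rule sw_target_counital(1)[where s = s]) (intro lin_intros bilinear_lin[OF f])
  also have "\<dots> = sw (1 * x) (\<lambda>u v. f (\<epsilon>\<^sub>t q * u) v)"
    by (subst sw_mult[OF b]) (simp add: mult.assoc)
  finally show ?thesis by simp
qed

lemma sw_mult_source_counital:
  assumes f: "bilinear_map s f"
  shows "sw (x * \<epsilon>\<^sub>s q) f = sw x (\<lambda>u v. f u (v * \<epsilon>\<^sub>s q))"
proof -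
  have b: "bilinear_map s (\<lambda>u v. f u (v * \<epsilon>\<^sub>s q))" by (intro lin_intros bilinear_lin[OF f])
  have inner: "sw (\<epsilon>\<^sub>s q) (\<lambda>a b. f (u * a) (v * b)) = sw 1 (\<lambda>a b. f (u * a) (v * (b * \<epsilon>\<^sub>s q)))" for u v
    by (rule sw_source_counital(2)[where s = s]) (intro lin_intros bilinear_lin[OF f])
  have "sw (x * \<epsilon>\<^sub>s q) f = sw x (\<lambda>u v. sw 1 (\<lambda>a b. f (u * a) (v * (b * \<epsilon>\<^sub>s q))))"
    by (simp only: sw_mult[OF f] inner)
  also have "\<dots> = sw (x * 1) (\<lambda>u v. f u (v * \<epsilon>\<^sub>s q))"
    by (subst sw_mult[OF b]) (simp add: mult.assoc)
  finally show ?thesis by simp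
qed

section \<open>Integrals\<close>

definition left_integral :: "'h \<Rightarrow> bool" where
  "left_integral x \<longleftrightarrow> (\<forall>h. h * x = \<epsilon>\<^sub>t h * x)"

definition right_integral :: "'h \<Rightarrow> bool" where
  "right_integral x \<longleftrightarrow> (\<forall>h. x * h = x * \<epsilon>\<^sub>s h)"

text \<open>Write \<open>S h\<close> as \<open>S h\<^sub>1 * \<epsilon>\<^sub>t h\<^sub>2\<close>. For a left integral \<open>\<epsilon>\<^sub>t h\<^sub>2\<close> may be replaced by \<open>h\<^sub>2\<close>, acting on both
  legs of \<open>x\<close>, and \<open>S h\<^sub>1 * h\<^sub>2\<close> cancels.\<close>

lemma left_integral_sw:
  assumes x: "left_integral x" and f: "bilinear_map s f"
  shows "sw x (\<lambda>u v. f (S h * u) v) = sw x (\<lambda>u v. f u (h * v))"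
proof -
  have "f (S h * u) v = sw h (\<lambda>p q. f (S p * (\<epsilon>\<^sub>t q * u)) v)" for u v
    by (subst antipode_sw_target) (simp add: sw_mult_right bilinear_sw_left[OF f] mult.assoc)
  then have "sw x (\<lambda>u v. f (S h * u) v) = sw x (\<lambda>u v. sw h (\<lambda>p q. f (S p * (\<epsilon>\<^sub>t q * u)) v))"
    by (simp only:)
  also have "\<dots> = sw h (\<lambda>p q. sw x (\<lambda>u v. f (S p * (\<epsilon>\<^sub>t q * u)) v))" by (rule sw_swap)
  also have "\<dots> = sw h (\<lambda>p q. sw (\<epsilon>\<^sub>t q * x) (\<lambda>u v. f (S p * u) v))"
  proof -
    have "sw (\<epsilon>\<^sub>t q * x) (\<lambda>u v. f (S p * u) v) = sw x (\<lambda>u v. f (S p * (\<epsilon>\<^sub>t q * u)) v)" for p q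
      by (rule sw_target_counital_mult[where s = s]) (intro lin_intros bilinear_lin[OF f])
    then show ?thesis by simp
  qed
  also have "\<dots> = sw h (\<lambda>p q. sw (q * x) (\<lambda>u v. f (S p * u) v))"
    using x by (simp add: left_integral_def)
  also have "\<dots> = sw h (\<lambda>p q. sw q (\<lambda>r t. sw x (\<lambda>u v. f (S p * (r * u)) (t * v))))"
  proof -
    have "sw (q * x) (\<lambda>u v. f (S p * u) v) = sw q (\<lambda>r t. sw x (\<lambda>u v. f (S p * (r * u)) (t * v)))" for p q
      by (rule sw_mult[where s = s]) (intro lin_intros bilinear_lin[OF f])
    then show ?thesis by simp
  qed
  also have "\<dots> = sw h (\<lambda>p q. sw p (\<lambda>r t. sw x (\<lambda>u v. f (S r * (t * u)) (q * v))))"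
    by (rule sw_coassoc[where s = s, symmetric]) (intro lin_intros bilinear_lin[OF f])
  also have "\<dots> = sw h (\<lambda>p q. sw p (\<lambda>r t. sw x (\<lambda>u v. f ((S r * t) * u) (q * v))))"
    by (simp add: mult.assoc)
  also have "\<dots> = (\<Sum>e\<in>E. sw x (\<lambda>u v. f (e * u) (h * e * v)))"
    by (rule sw_antipode_cancel(1)[where s = s]) (intro lin_intros bilinear_lin[OF f])
  also have "\<dots> = (\<Sum>e\<in>E. sw (e * x) (\<lambda>u v. f u (h * v)))"
  proof (rule sum.cong[OF refl])
    fix e assume e: "e \<in> E"
    have b: "bilinear_map s (\<lambda>u v. f u (h * v))" by (intro lin_intros bilinear_lin[OF f])
    show "sw x (\<lambda>u v. f (e * u) (h * e * v)) = sw (e * x) (\<lambda>u v. f u (h * v))"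
      using sw_E_mult_both[OF e b] by (simp add: mult.assoc)
  qed
  also have "\<dots> = sw x (\<lambda>u v. f u (h * v))"
    by (rule sum_sw_E_left[where s = s]) (intro lin_intros bilinear_lin[OF f])
  finally show ?thesis .
qed

lemma right_integral_sw:
  assumes x: "right_integral x" and f: "bilinear_map s f"
  shows "sw x (\<lambda>u v. f u (v * S h)) = sw x (\<lambda>u v. f (u * h) v)"
proof -
  have "f u (v * S h) = sw h (\<lambda>p q. f u (v * \<epsilon>\<^sub>s p * S q))" for u v
    by (subst antipode_sw_source) (simp add: sw_mult_left bilinear_sw_right[OF f] mult.assoc)
  then have "sw x (\<lambda>u v. f u (v * S h)) = sw x (\<lambda>u v. sw h (\<lambda>p q. f u (v * \<epsilon>\<^sub>s p * S q)))"
    by (simp only:)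
  also have "\<dots> = sw h (\<lambda>p q. sw x (\<lambda>u v. f u (v * \<epsilon>\<^sub>s p * S q)))" by (rule sw_swap)
  also have "\<dots> = sw h (\<lambda>p q. sw (x * \<epsilon>\<^sub>s p) (\<lambda>u v. f u (v * S q)))"
  proof -
    have "sw (x * \<epsilon>\<^sub>s p) (\<lambda>u v. f u (v * S q)) = sw x (\<lambda>u v. f u (v * \<epsilon>\<^sub>s p * S q))" for p q
      by (rule sw_mult_source_counital[where s = s]) (intro lin_intros bilinear_lin[OF f])
    then show ?thesis by simp
  qed
  also have "\<dots> = sw h (\<lambda>p q. sw (x * p) (\<lambda>u v. f u (v * S q)))"
    using x by (simp add: right_integral_def)
  also have "\<dots> = sw h (\<lambda>p q. sw p (\<lambda>r t. sw x (\<lambda>u v. f (u * r) (v * (t * S q)))))"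
  proof -
    have "sw (x * p) (\<lambda>u v. f u (v * S q)) = sw x (\<lambda>u v. sw p (\<lambda>r t. f (u * r) (v * t * S q)))" for p q
      by (rule sw_mult[where s = s]) (intro lin_intros bilinear_lin[OF f])
    moreover have "sw x (\<lambda>u v. sw p (\<lambda>r t. f (u * r) (v * t * S q))) =
        sw p (\<lambda>r t. sw x (\<lambda>u v. f (u * r) (v * (t * S q))))" for p q
      by (subst sw_swap) (simp add: mult.assoc)
    ultimately show ?thesis by simp
  qed
  also have "\<dots> = sw h (\<lambda>p q. sw q (\<lambda>r t. sw x (\<lambda>u v. f (u * p) (v * (r * S t)))))"
    by (rule sw_coassoc[where s = s]) (intro lin_intros bilinear_lin[OF f])
  also have "\<dots> = (\<Sum>e\<in>E. sw x (\<lambda>u v. f (u * (e * h)) (v * e)))"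
    by (rule sw_antipode_cancel(4)[where s = s]) (intro lin_intros bilinear_lin[OF f])
  also have "\<dots> = (\<Sum>e\<in>E. sw (x * e) (\<lambda>u v. f (u * h) v))"
  proof (rule sum.cong[OF refl])
    fix e assume e: "e \<in> E"
    have b: "bilinear_map s (\<lambda>u v. f (u * h) v)" by (intro lin_intros bilinear_lin[OF f])
    show "sw x (\<lambda>u v. f (u * (e * h)) (v * e)) = sw (x * e) (\<lambda>u v. f (u * h) v)"
      using sw_mult_E_both[OF e b] by (simp add: mult.assoc)
  qed
  also have "\<dots> = sw x (\<lambda>u v. f (u * h) v)"
    by (rule sum_sw_E_right[where s = s]) (intro lin_intros bilinear_lin[OF f])
  finally show ?thesis .
qed

end


context vector_space
begin

lemma coordinate_functional_exists:
  assumes "independent A" and "a \<in> A"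
  shows "\<exists>\<xi>. Vector_Spaces.linear scale (*) \<xi> \<and> (\<forall>b\<in>A. \<xi> b = (if b = a then 1 else 0))"
proof -
  have "vector_space ((*) :: 'a \<Rightarrow> 'a \<Rightarrow> 'a)" by unfold_locales (auto simp: algebra_simps)
  then interpret p: vector_space_pair scale "(*) :: 'a \<Rightarrow> 'a \<Rightarrow> 'a"
    by (simp add: vector_space_pair_def vector_space_axioms)
  show ?thesis
    using p.linear_construct[OF assms(1), of "\<lambda>b. if b = a then 1 else 0"]
      p.construct_basis[OF assms(1), of _ "\<lambda>b. if b = a then 1 else 0"] by blast
qed

lemma vanishing_functional_exists:
  assumes "y \<notin> span B"
  shows "\<exists>\<phi>. Vector_Spaces.linear scale (*) \<phi> \<and> (\<forall>v\<in>span B. \<phi> v = 0) \<and> \<phi> y = 1"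
proof -
  obtain C where C: "C \<subseteq> B" "independent C" "B \<subseteq> span C"
    using maximal_independent_subset[of B] by metis
  have CB: "span B = span C"
    using C span_mono span_minimal by (metis subspace_span subset_antisym)
  then have y: "y \<notin> span C" using assms by simp
  then have "independent (insert y C)" using C(2) by (simp add: independent_insertI)
  then obtain \<phi> where \<phi>: "Vector_Spaces.linear scale (*) \<phi>"
      "\<And>b. b \<in> insert y C \<Longrightarrow> \<phi> b = (if b = y then 1 else 0)"
    using coordinate_functional_exists[of "insert y C" y] by blast
  interpret \<phi>: Vector_Spaces.linear scale "(*)" \<phi> by (rule \<phi>(1))
  have "y \<notin> C" using y span_base by blast
  then have 0: "\<phi> b = 0" if "b \<in> C" for b using \<phi>(2)[of b] that by auto
  have "\<phi> v = 0" if "v \<in> span C" for v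
    using that by (induction rule: span_induct_alt) (simp_all add: \<phi>.add \<phi>.scale 0)
  then show ?thesis using \<phi>(1) \<phi>(2)[of y] CB by auto
qed

end

context weak_hopf_algebra
begin

text \<open>A representative of \<open>\<Delta> x\<close> whose left legs are linearly independent, so that it can be
  compared coefficientwise with other tensors.\<close>

definition leg_basis :: "'h \<Rightarrow> 'h set" where
  "leg_basis x = (SOME A. A \<subseteq> fst ` set (legs x) \<and> independent A \<and> fst ` set (legs x) \<subseteq> span A)"

definition leg_coeff :: "'h \<Rightarrow> 'h \<Rightarrow> 'h" where
  "leg_coeff x a = sw x (\<lambda>u v. representation (leg_basis x) u a *s v)"

lemma leg_basis:
  "leg_basis x \<subseteq> fst ` set (legs x)" "independent (leg_basis x)" "fst ` set (legs x) \<subseteq> span (leg_basis x)"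
proof -
  have "\<exists>A. A \<subseteq> fst ` set (legs x) \<and> independent A \<and> fst ` set (legs x) \<subseteq> span A"
    using maximal_independent_subset[of "fst ` set (legs x)"] by metis
  then have "leg_basis x \<subseteq> fst ` set (legs x) \<and> independent (leg_basis x) \<and> fst ` set (legs x) \<subseteq> span (leg_basis x)"
    unfolding leg_basis_def by (rule someI_ex)
  then show "leg_basis x \<subseteq> fst ` set (legs x)" "independent (leg_basis x)" "fst ` set (legs x) \<subseteq> span (leg_basis x)"
    by auto
qed

lemma finite_leg_basis: "finite (leg_basis x)"
  using leg_basis(1) by (rule finite_subset) simp

lemma sw_leg_basis:
  assumes f: "bilinear_map s f"
  shows "sw x f = (\<Sum>a\<in>leg_basis x. f a (leg_coeff x a))"
proof -
  let ?r = "representation (leg_basis x)"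
  have f_sum: "f (sum g I) y = (\<Sum>i\<in>I. f (g i) y)" for g :: "'h \<Rightarrow> 'h" and I y
    using f linear_sum'[of scale s "\<lambda>x. f x y"] by (simp add: bilinear_map_def)
  have "f (fst (legs x ! i)) (snd (legs x ! i)) = (\<Sum>a\<in>leg_basis x. f a (?r (fst (legs x ! i)) a *s snd (legs x ! i)))"
    if "i < length (legs x)" for i
  proof -
    have "fst (legs x ! i) \<in> span (leg_basis x)"
      using leg_basis(3) that by force
    then have "fst (legs x ! i) = (\<Sum>a\<in>leg_basis x. ?r (fst (legs x ! i)) a *s a)"
      using sum_representation_eq[OF leg_basis(2) _ finite_leg_basis order_refl] by simp
    then have "f (fst (legs x ! i)) (snd (legs x ! i)) =
        f (\<Sum>a\<in>leg_basis x. ?r (fst (legs x ! i)) a *s a) (snd (legs x ! i))" by simp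
    then show ?thesis
      by (simp add: f_sum bilinear_scale_left[OF f] bilinear_scale_right[OF f])
  qed
  then have "sw x f = sw x (\<lambda>u v. \<Sum>a\<in>leg_basis x. f a (?r u a *s v))"
    unfolding sw_def by (intro sum.cong refl) simp
  then show ?thesis
    by (simp add: sw_sum leg_coeff_def bilinear_sw_right[OF f])
qed

end

context diagonal_weak_hopf_algebra
begin

text \<open>By \<open>left_integral_sw\<close>, the span \<open>V\<close> of the right legs of a left
  integral \<open>x\<close> is a left ideal. If a functional \<open>\<phi>\<close> vanishes on \<open>V\<close>, then also
  \<open>\<phi> (h * (S x\<^sub>2 * x\<^sub>3)) x\<^sub>1 = 0\<close>, and cancelling the antipode leaves the sum of \<open>\<phi> (h * e) (x * e)\<close>.\<close>

lemma integral_legs_separate: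
  assumes x: "left_integral x" and xe: "\<And>e. e \<in> E \<Longrightarrow> x * e \<noteq> 0"
    and \<phi>: "lin (*) \<phi>" and van: "\<And>a. a \<in> leg_basis x \<Longrightarrow> \<phi> (leg_coeff x a) = 0"
  shows "\<phi> h = 0"
proof -
  interpret \<phi>: Vector_Spaces.linear scale "(*)" \<phi> by (rule \<phi>)
  let ?V = "span (leg_coeff x ` leg_basis x)"
  have V0: "\<phi> v = 0" if "v \<in> ?V" for v
    using that by (induction rule: span_induct_alt) (auto simp: \<phi>.add \<phi>.scale van)
  have ideal: "h * leg_coeff x a \<in> ?V" if a: "a \<in> leg_basis x" for h a
  proof -
    obtain \<xi> where \<xi>: "lin (*) \<xi>" "\<And>b. b \<in> leg_basis x \<Longrightarrow> \<xi> b = (if b = a then 1 else 0)"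
      using coordinate_functional_exists[OF leg_basis(2) a] by blast
    have b: "bilinear_map scale (\<lambda>u v. \<xi> u *s v)"
      by (intro lin_intros lin_compose[OF _ \<xi>(1)])
    have b1: "bilinear_map scale (\<lambda>u v. \<xi> (S h * u) *s v)"
      and b2: "bilinear_map scale (\<lambda>u v. \<xi> u *s (h * v))"
      by (intro lin_intros lin_compose[OF _ \<xi>(1)])+
    have "h * leg_coeff x a = (\<Sum>b\<in>leg_basis x. if b = a then h * leg_coeff x a else 0)"
      using a finite_leg_basis by simp
    also have "\<dots> = sw x (\<lambda>u v. \<xi> u *s (h * v))"
      unfolding sw_leg_basis[OF b2] by (rule sum.cong) (auto simp: \<xi>(2))
    also have "\<dots> = sw x (\<lambda>u v. \<xi> (S h * u) *s v)"
      by (rule left_integral_sw[OF x b, symmetric])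
    also have "\<dots> \<in> ?V"
      unfolding sw_leg_basis[OF b1] by (intro span_sum span_scale span_base) auto
    finally show ?thesis .
  qed
  have idealV: "h * v \<in> ?V" if "v \<in> ?V" for h v
    using that by (induction rule: span_induct_alt)
      (auto simp: distrib_left scale_mult_right intro!: span_add span_scale ideal span_zero)
  note lin_\<phi> = lin_compose[OF _ \<phi>]
  have sum0: "(\<Sum>e\<in>E. \<phi> (h * e) *s (x * e)) = 0" for h
  proof -
    have "(\<Sum>e\<in>E. \<phi> (h * e) *s (x * e)) = sw x (\<lambda>u v. sw v (\<lambda>p q. \<phi> (h * (S p * q)) *s u))"
      by (rule sw_antipode_cancel(2)[where s = scale, symmetric])
        (intro bilinear_mapI lin_scale_left lin_scale_right lin_\<phi> lin_mult_right lin_id)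
    also have "\<dots> = sw x (\<lambda>u v. sw u (\<lambda>p q. \<phi> (h * (S q * v)) *s p))"
      by (rule sw_coassoc[where s = scale, symmetric])
        (intro trilinear_mapI lin_scale_left lin_scale_right lin_\<phi> lin_mult_right lin_mult_left lin_antipode lin_id)
    also have "\<dots> = (\<Sum>a\<in>leg_basis x. sw a (\<lambda>p q. \<phi> (h * (S q * leg_coeff x a)) *s p))"
      by (rule sw_leg_basis[where s = scale])
        (intro bilinear_mapI lin_sw lin_sw_arg lin_scale_left lin_scale_right lin_\<phi> lin_mult_right lin_mult_left lin_antipode lin_id)
    also have "\<dots> = 0"
      by (rule sum.neutral) (simp add: V0[OF idealV[OF ideal]] sw_def)
    finally show ?thesis .
  qed
  have "\<phi> (h * e) = 0" if e: "e \<in> E" for e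
  proof -
    have "0 = (\<Sum>i\<in>E. \<phi> (h * i) *s (x * i)) * e" by (simp add: sum0)
    also have "\<dots> = \<phi> (h * e) *s (x * e)"
      unfolding sum_distrib_right
      by (rule sum_E_single[OF e]) (use e in \<open>auto simp: scale_mult_left E_mult_assoc'\<close>)
    finally show ?thesis using xe[OF e] by simp
  qed
  then have "(\<Sum>e\<in>E. \<phi> (h * e)) = 0" by simp
  then show ?thesis by (simp flip: \<phi>.sum add: sum_E_right)
qed

lemma integral_legs_span:
  assumes "left_integral x" and "\<And>e. e \<in> E \<Longrightarrow> x * e \<noteq> 0"
  shows "span (leg_coeff x ` leg_basis x) = UNIV"
proof (rule ccontr)
  assume "span (leg_coeff x ` leg_basis x) \<noteq> UNIV"
  then obtain y where "y \<notin> span (leg_coeff x ` leg_basis x)" by blast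
  then obtain \<phi> where \<phi>: "lin (*) \<phi>" "\<forall>v\<in>span (leg_coeff x ` leg_basis x). \<phi> v = 0" "\<phi> y = 1"
    using vanishing_functional_exists by blast
  then have "\<phi> y = 0"
    using integral_legs_separate[OF assms \<phi>(1)] span_base by blast
  then show False using \<phi>(3) by simp
qed

lemma integral_transform_injective:
  assumes "left_integral x" and "\<And>e. e \<in> E \<Longrightarrow> x * e \<noteq> 0"
    and \<phi>: "lin (*) \<phi>" and zero: "sw x (\<lambda>u v. \<phi> v *s u) = 0"
  shows "\<phi> h = 0"
proof (rule integral_legs_separate[OF assms(1,2) \<phi>])
  fix a assume a: "a \<in> leg_basis x"
  have b: "bilinear_map scale (\<lambda>u v. \<phi> v *s u)"
    by (intro lin_intros lin_compose[OF _ \<phi>])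
  have "(\<Sum>a\<in>leg_basis x. \<phi> (leg_coeff x a) *s a) = 0"
    using zero by (simp add: sw_leg_basis[OF b])
  from independentD[OF leg_basis(2) finite_leg_basis order_refl this a]
  show "\<phi> (leg_coeff x a) = 0" .
qed

text \<open>The kernel of the target counital map is a left ideal, generated by an idempotent \<open>f\<close> if the
  algebra is semisimple; then \<open>1 - f\<close> is a left integral with target counit 1. Right multiples of it
  are left integrals as well, and suitable ones have counit 1 in each diagonal corner.\<close>

lemma left_integral_exists:
  assumes "semisimple_ring (ring_of_type :: 'h ring)"
  shows "\<exists>x. left_integral x \<and> (\<forall>e\<in>E. \<epsilon> (e * x * e) = 1)"
proof -
  interpret t: Vector_Spaces.linear scale scale "\<epsilon>\<^sub>t" by (rule linear_target_counital)
  have "\<exists>f\<in>{x. \<epsilon>\<^sub>t x = 0}. \<forall>x\<in>{x. \<epsilon>\<^sub>t x = 0}. x * f = x"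
  proof (rule left_ideal_idempotent[OF assms])
    show "a * x \<in> {x. \<epsilon>\<^sub>t x = 0}" if "x \<in> {x. \<epsilon>\<^sub>t x = 0}" for a x
      using that target_counital_mult[of a x] by (simp add: t.zero)
  qed (simp_all add: t.zero t.add)
  then obtain f where f: "\<epsilon>\<^sub>t f = 0" "\<And>x. \<epsilon>\<^sub>t x = 0 \<Longrightarrow> x * f = x" by auto
  define x0 where "x0 = 1 - f"
  have x0: "h * x0 = \<epsilon>\<^sub>t h * x0" for h
  proof -
    have "\<epsilon>\<^sub>t (h - \<epsilon>\<^sub>t h) = 0" by (simp add: t.diff target_counital_idem)
    then have "(h - \<epsilon>\<^sub>t h) * x0 = 0"
      using f(2) by (simp add: x0_def right_diff_distrib)
    then show ?thesis by (simp add: left_diff_distrib)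
  qed
  have "\<epsilon>\<^sub>t x0 = 1" by (simp add: x0_def t.diff f target_counital_one)
  have ex0: "\<epsilon> (e * x0) = 1" if e: "e \<in> E" for e
  proof -
    have "e = e * \<epsilon>\<^sub>t x0" using \<open>\<epsilon>\<^sub>t x0 = 1\<close> by simp
    also have "\<dots> = \<epsilon> (e * x0) *s e"
      unfolding target_counital_sum sum_distrib_left
      by (rule sum_E_single[OF e]) (use e in \<open>auto simp: scale_mult_right E_mult\<close>)
    finally have "\<epsilon> (e * x0) *s e = 1 *s e" by simp
    moreover have "e \<noteq> 0" using e orthogonal_E by (auto simp: orthogonal_idempotents_def)
    ultimately show ?thesis by (simp only: scale_cancel_right) simp
  qed
  have "\<exists>y. left_integral y \<and> \<epsilon> (e * y * e) = 1" if e: "e \<in> E" for e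
  proof -
    have "(\<Sum>i\<in>E. \<epsilon> (e * x0 * i)) = 1"
      using ex0[OF e] by (simp flip: \<epsilon>.sum add: sum_E_right)
    then obtain i where i: "i \<in> E" "\<epsilon> (e * x0 * i) \<noteq> 0"
      by (metis (no_types, lifting) sum.neutral zero_neq_one)
    define g where "g = e * x0 * i"
    have Sg: "i * S g = S g" "S g * e = S g"
      using i e by (simp_all add: g_def E_mult_assoc' E_mult_assoc mult.assoc E_mult flip: antipode_mult_E)
    have "\<epsilon> (g * S g) = (\<Sum>j\<in>E. \<epsilon> (g * j) * \<epsilon> (j * S g))" by (rule counit_mult)
    also have "\<dots> = \<epsilon> g * \<epsilon> (i * S g)"
      by (rule sum_E_single[OF i(1)]) (use i in \<open>auto simp: g_def E_mult_assoc'\<close>)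
    also have "\<dots> = \<epsilon> g * \<epsilon> g" using i finite_E by (simp add: Sg counit_antipode)
    finally have gg: "\<epsilon> (g * S g) = \<epsilon> g * \<epsilon> g" .
    define y where "y = inverse (\<epsilon> g * \<epsilon> g) *s (x0 * i * S g)"
    have "left_integral y"
      using x0 by (simp add: left_integral_def y_def scale_mult_right flip: mult.assoc)
    moreover have "e * y * e = inverse (\<epsilon> g * \<epsilon> g) *s (g * S g)"
      by (simp add: y_def g_def scale_mult_right scale_mult_left mult.assoc Sg[unfolded g_def mult.assoc])
    then have "\<epsilon> (e * y * e) = inverse (\<epsilon> g * \<epsilon> g) * (\<epsilon> g * \<epsilon> g)"
      by (simp only: \<epsilon>.scale gg)
    moreover have "\<epsilon> g * \<epsilon> g \<noteq> 0" using i by (simp add: g_def)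
    ultimately show ?thesis
      by (intro exI[of _ y]) (simp only: left_inverse simp_thms)
  qed
  then obtain y where y: "\<And>e. e \<in> E \<Longrightarrow> left_integral (y e) \<and> \<epsilon> (e * y e * e) = 1" by metis
  define x where "x = (\<Sum>e\<in>E. y e * e)"
  have "h * x = \<epsilon>\<^sub>t h * x" for h
    unfolding x_def sum_distrib_left
  proof (rule sum.cong[OF refl])
    fix e assume "e \<in> E"
    then have "h * y e = \<epsilon>\<^sub>t h * y e" using y unfolding left_integral_def by blast
    then show "h * (y e * e) = \<epsilon>\<^sub>t h * (y e * e)" by (simp flip: mult.assoc)
  qed
  then have "left_integral x" unfolding left_integral_def by blast
  moreover have "x * e = y e * e" if e: "e \<in> E" for e
  proof -
    have "x * e = y e * e"
      unfolding x_def sum_distrib_right by (rule sum_E_single[OF e]) (use e in \<open>auto simp: E_mult_assoc'\<close>)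
    then show ?thesis using e finite_E by simp
  qed
  ultimately show ?thesis
    using y by (intro exI[of _ x]) (simp add: mult.assoc)
qed

end


section \<open>The dual integral and Radford's formula\<close>

locale integral_weak_hopf_algebra =
  diagonal_weak_hopf_algebra scale \<Delta> \<epsilon> S E + finite_dim_algebra scale Basis
  for scale :: "'k::field \<Rightarrow> 'h::{ring, monoid_mult} \<Rightarrow> 'h" (infixr \<open>*s\<close> 75)
    and \<Delta> :: "'h \<Rightarrow> ('k, 'h) tensor2"
    and \<epsilon> :: "'h \<Rightarrow> 'k"
    and S :: "'h \<Rightarrow> 'h"
    and E Basis :: "'h set" +
  fixes \<Lambda> :: 'h
  assumes left_integral: "left_integral \<Lambda>"
    and counit_integral: "e \<in> E \<Longrightarrow> \<epsilon> (e * \<Lambda> * e) = 1"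
begin

lemma integral_mult_E_nonzero: "e \<in> E \<Longrightarrow> \<Lambda> * e \<noteq> 0"
  using counit_integral[of e] by (auto simp: mult.assoc \<epsilon>.zero)

definition transform :: "('h \<Rightarrow> 'k) \<Rightarrow> 'h" where
  "transform \<phi> = sw \<Lambda> (\<lambda>u v. \<phi> v *s u)"

lemma transform_bilinear: "lin (*) \<phi> \<Longrightarrow> bilinear_map scale (\<lambda>u v. \<phi> v *s u)"
  by (intro bilinear_mapI lin_scale_left lin_scale_right lin_id)

lemma transform_inject:
  assumes "lin (*) \<phi>" and "lin (*) \<psi>" and "transform \<phi> = transform \<psi>"
  shows "\<phi> h = \<psi> h"
proof -
  have l: "lin (*) (\<lambda>x. \<phi> x - \<psi> x)"
    using assms by (simp add: Vector_Spaces.linear_iff algebra_simps)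
  have z: "sw \<Lambda> (\<lambda>u v. (\<phi> v - \<psi> v) *s u) = 0"
    using assms(3) by (simp add: transform_def sw_def scale_left_diff_distrib sum_subtractf)
  have "\<phi> h - \<psi> h = 0"
    by (rule integral_transform_injective[OF left_integral _ l z]) (rule integral_mult_E_nonzero)
  then show ?thesis by simp
qed

lemma transform_surjective: "\<exists>\<phi>. lin (*) \<phi> \<and> transform \<phi> = h"
proof -
  let ?r = "representation Basis"
  define \<phi> where "\<phi> h y = (\<Sum>b\<in>Basis. ?r h b * ?r y b)" for h y
  have \<phi>: "lin (*) (\<phi> h)" for h
    unfolding \<phi>_def by (intro lin_sum lin_const_times representation_Basis_linear)
  have "lin (*) (\<lambda>h. \<phi> h y)" for y
    unfolding \<phi>_def by (intro lin_sum lin_times_const representation_Basis_linear)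
  then have "lin scale (\<lambda>h. transform (\<phi> h))"
    unfolding transform_def by (intro lin_sw lin_scale_left)
  moreover have "inj (\<lambda>h. transform (\<phi> h))"
  proof (rule injI)
    fix g h assume "transform (\<phi> g) = transform (\<phi> h)"
    then have eq: "\<phi> g b = \<phi> h b" for b by (rule transform_inject[OF \<phi> \<phi>])
    have "\<phi> h b = ?r h b" if "b \<in> Basis" for h b
    proof -
      have "\<phi> h b = (\<Sum>c\<in>Basis. if c = b then ?r h b else 0)"
        unfolding \<phi>_def by (rule sum.cong) (use that in \<open>auto simp: representation_basis[OF independent_Basis]\<close>)
      then show ?thesis using that finite_Basis by simp
    qed
    then have "?r g b = ?r h b" if "b \<in> Basis" for b using eq[of b] that by simp
    then have "(\<Sum>b\<in>Basis. ?r g b *s b) = (\<Sum>b\<in>Basis. ?r h b *s b)" by simp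
    then show "g = h" by (simp only: representation_Basis_sum)
  qed
  ultimately have "surj (\<lambda>h. transform (\<phi> h))" by (rule linear_inj_imp_surj)
  then show ?thesis using \<phi> by (metis surjD)
qed

lemma antipode_mult_transform:
  assumes \<phi>: "lin (*) \<phi>"
  shows "transform (\<lambda>v. \<phi> (h * v)) = S h * transform \<phi>"
  using left_integral_sw[OF left_integral transform_bilinear[OF \<phi>], of h]
  by (simp add: transform_def sw_mult_left scale_mult_right)

text \<open>The preimage of 1 under the transform is an integral of the dual.\<close>

definition dual_integral :: "'h \<Rightarrow> 'k" (\<open>\<lambda>\<^sub>0\<close>) where
  "dual_integral = (SOME \<phi>. lin (*) \<phi> \<and> transform \<phi> = 1)"

lemma dual_integral: "lin (*) \<lambda>\<^sub>0" "transform \<lambda>\<^sub>0 = 1"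
  using someI_ex[OF transform_surjective[of 1]] by (simp_all add: dual_integral_def)

sublocale dual: Vector_Spaces.linear scale "(*)" dual_integral by (rule dual_integral(1))

lemma lin_dual_integral: "lin scale f \<Longrightarrow> lin (*) (\<lambda>x. \<lambda>\<^sub>0 (f x))"
  by (rule lin_compose[OF _ dual_integral(1)])

lemma transform_dual_integral: "transform (\<lambda>v. \<lambda>\<^sub>0 (h * v)) = S h"
  by (simp add: antipode_mult_transform[OF dual_integral(1)] dual_integral(2))

lemma antipode_mult: "S (g * h) = S h * S g"
proof -
  have "lin (*) (\<lambda>v. \<lambda>\<^sub>0 (g * v))" by (intro lin_dual_integral lin_intros)
  from antipode_mult_transform[OF this, of h]
  show ?thesis by (simp add: transform_dual_integral flip: mult.assoc)
qed

lemma antipode_zero_imp_zero: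
  assumes "S h = 0"
  shows "h = 0"
proof (rule separation[OF vector_space_axioms])
  fix \<phi> assume \<phi>: "lin (*) \<phi>"
  have "lin (*) (\<lambda>v. \<phi> (h * v))" by (rule lin_compose[OF linear_mult_right \<phi>])
  moreover have "transform (\<lambda>v. \<phi> (h * v)) = transform (\<lambda>v. 0)"
    using assms by (simp add: antipode_mult_transform[OF \<phi>]) (simp add: transform_def sw_def)
  ultimately have "\<phi> (h * 1) = 0"
    by (rule transform_inject[OF _ lin_zero[OF vector_space_field]])
  moreover have "\<phi> 0 = 0" using linear_sum'[OF \<phi>, of "\<lambda>_. 0" "{}"] by simp
  ultimately show "\<phi> h = \<phi> 0" by simp
qed

lemma antipode_inject: "S g = S h \<Longrightarrow> g = h"
  using antipode_zero_imp_zero[of "g - h"] by (simp add: S.diff)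

lemma antipode_surj: "\<exists>g. S g = h"
proof -
  have "surj S"
    by (rule linear_inj_imp_surj[OF linear_antipode]) (auto intro: injI antipode_inject)
  then show ?thesis by (metis surjD)
qed

lemma antipode_target_counital: "S (\<epsilon>\<^sub>t h) = \<epsilon>\<^sub>t h"
  unfolding target_counital_sum by (simp add: S.sum S.scale antipode_E cong: sum.cong)

lemma right_integral_antipode: "right_integral (S \<Lambda>)"
  unfolding right_integral_def
proof
  fix k
  obtain h where h: "S h = k" using antipode_surj by blast
  have "S \<Lambda> * k = S (h * \<Lambda>)" by (simp add: antipode_mult h)
  also have "\<dots> = S (\<epsilon>\<^sub>t h * \<Lambda>)" using left_integral unfolding left_integral_def by metis
  also have "\<dots> = S \<Lambda> * \<epsilon>\<^sub>s k"
    using source_counital_antipode[of h] by (simp add: antipode_mult antipode_target_counital h)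
  finally show "S \<Lambda> * k = S \<Lambda> * \<epsilon>\<^sub>s k" .
qed

lemma target_counital_corner:
  assumes "e \<in> E"
  shows "\<epsilon>\<^sub>t (e * x) = \<epsilon> (e * x) *s e"
proof -
  have "\<epsilon>\<^sub>t (e * x) = \<epsilon> (e * x) *s e"
    unfolding target_counital_sum by (rule sum_E_single[OF assms]) (use assms in \<open>auto simp: E_mult_assoc\<close>)
  then show ?thesis using assms finite_E by simp
qed

lemma source_counital_corner:
  assumes "e \<in> E"
  shows "\<epsilon>\<^sub>s (x * e) = \<epsilon> (x * e) *s e"
proof -
  have "\<epsilon>\<^sub>s (x * e) = \<epsilon> (x * e) *s e"
    unfolding source_counital_sum by (rule sum_E_single[OF assms]) (use assms in \<open>auto simp: E_mult_assoc'\<close>)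
  then show ?thesis using assms finite_E by simp
qed

lemma counit_mult_corner:
  assumes "f \<in> E"
  shows "\<epsilon> (g * f * h) = \<epsilon> (g * f) * \<epsilon> (f * h)"
proof -
  have "\<epsilon> (g * f * h) = \<epsilon> (g * f) * \<epsilon> (f * h)"
    unfolding counit_mult[of "g * f" h] by (rule sum_E_single[OF assms]) (use assms in \<open>auto simp: E_mult_assoc'\<close>)
  then show ?thesis using assms finite_E by simp
qed

lemma corner_zero:
  assumes e: "e \<in> E" and f: "f \<in> E" and van: "\<And>h. \<epsilon> (e * h * f) = 0"
  shows "e * h * f = 0"
proof -
  have "e * h * f = sw (e * h * f) (\<lambda>x y. \<epsilon> x *s y)" by (simp add: sw_counit_left)
  also have "\<dots> = sw (e * h) (\<lambda>x y. \<epsilon> (x * f) *s y)"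
    by (rule sw_E_mult(3)[OF f counit_bilinear_left, symmetric])
  also have "\<dots> = sw h (\<lambda>x y. \<epsilon> (e * x * f) *s y)"
    by (rule sw_E_mult(1)[OF e, where s = scale, symmetric]) (intro lin_intros)
  finally show ?thesis by (simp add: van sw_def)
qed

text \<open>In the category, the corners \<open>e * \<Lambda> * f\<close> are left invariant and the corners \<open>e * S \<Lambda> * f\<close> right
  invariant. Evaluating
  the product of \<open>e * S \<Lambda> * e\<close> and \<open>e * \<Lambda> * f\<close> in both ways shows that the two corners are
  proportional, and the counit fixes the factor.\<close>

lemma antipode_integral: "S \<Lambda> = \<Lambda>"
proof -
  let ?P = "S \<Lambda>"
  have left: "h * \<Lambda> = \<epsilon>\<^sub>t h * \<Lambda>" for h using left_integral unfolding left_integral_def by blast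
  have right: "?P * h = ?P * \<epsilon>\<^sub>s h" for h using right_integral_antipode unfolding right_integral_def by blast
  have corner: "e * \<Lambda> * f = e * ?P * f" if e: "e \<in> E" and f: "f \<in> E" for e f
  proof -
    have "\<epsilon> (e * ?P * e) = \<epsilon> (S (e * \<Lambda> * e))"
      using e by (simp add: antipode_mult_E mult.assoc)
    then have Pe: "\<epsilon> (e * ?P * e) = 1" by (simp add: counit_antipode counit_integral[OF e])
    have "(e * ?P * e) * \<Lambda> = \<epsilon>\<^sub>t (e * (?P * e)) * \<Lambda>" using left[of "e * ?P * e"] by (simp add: mult.assoc)
    also have "\<dots> = e * \<Lambda>" using Pe by (simp add: target_counital_corner[OF e] mult.assoc)
    finally have "(e * ?P * e) * \<Lambda> * f = e * \<Lambda> * f" by simp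
    then have "e * \<Lambda> * f = e * (?P * (e * \<Lambda> * f))" by (simp add: mult.assoc)
    also have "\<dots> = e * (?P * \<epsilon>\<^sub>s (e * \<Lambda> * f))" using right by metis
    also have "\<dots> = \<epsilon> (e * \<Lambda> * f) *s (e * ?P * f)"
      unfolding source_counital_corner[OF f] by (simp add: scale_mult_right mult.assoc)
    finally have scaled: "e * \<Lambda> * f = \<epsilon> (e * \<Lambda> * f) *s (e * ?P * f)" .
    show ?thesis
    proof (cases "\<forall>h. \<epsilon> (e * h * f) = 0")
      case True
      then show ?thesis using corner_zero[OF e f] by simp
    next
      case False
      then obtain h where h: "\<epsilon> (e * h * f) \<noteq> 0" by blast
      have "(e * h * f) * \<Lambda> = \<epsilon>\<^sub>t (e * (h * f)) * \<Lambda>" using left[of "e * h * f"] by (simp add: mult.assoc)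
      also have "\<dots> = \<epsilon> (e * h * f) *s (e * \<Lambda>)"
        by (simp add: target_counital_corner[OF e] scale_mult_left mult.assoc)
      finally have "\<epsilon> ((e * h * f) * (\<Lambda> * f)) = \<epsilon> (e * h * f) * \<epsilon> (e * \<Lambda> * f)"
        by (simp add: scale_mult_left \<epsilon>.scale flip: mult.assoc)
      moreover have "\<epsilon> ((e * h * f) * (\<Lambda> * f)) = \<epsilon> (e * h * f) * \<epsilon> (f * \<Lambda> * f)"
        using counit_mult_corner[OF f, of "e * h" "\<Lambda> * f"] by (simp add: mult.assoc)
      ultimately have "\<epsilon> (e * \<Lambda> * f) = 1" using h counit_integral[OF f] by simp
      then show ?thesis using scaled by simp
    qed
  qed
  have split: "x = (\<Sum>e\<in>E. \<Sum>f\<in>E. e * x * f)" for x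
    by (simp add: sum_E_right sum_E_left)
  show ?thesis
    by (subst (2) split, subst split) (simp add: corner cong: sum.cong)
qed

lemma right_integral: "right_integral \<Lambda>"
  using right_integral_antipode by (simp add: antipode_integral)

lemma transform_mult_antipode:
  assumes \<phi>: "lin (*) \<phi>"
  shows "transform (\<lambda>v. \<phi> (v * S h)) = transform \<phi> * h"
  using right_integral_sw[OF right_integral transform_bilinear[OF \<phi>], of h]
  by (simp add: transform_def sw_mult_right scale_mult_left)

text \<open>Both sides, as functionals of \<open>y\<close>, have the transform \<open>S h\<close>.\<close>

lemma dual_integral_nakayama: "\<lambda>\<^sub>0 (y * S (S h)) = \<lambda>\<^sub>0 (h * y)"
proof (rule transform_inject[where h = y and \<phi> = "\<lambda>y. \<lambda>\<^sub>0 (y * S (S h))" and \<psi> = "\<lambda>y. \<lambda>\<^sub>0 (h * y)"])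
  show "lin (*) (\<lambda>y. \<lambda>\<^sub>0 (y * S (S h)))" "lin (*) (\<lambda>y. \<lambda>\<^sub>0 (h * y))"
    by (intro lin_dual_integral lin_intros)+
  show "transform (\<lambda>y. \<lambda>\<^sub>0 (y * S (S h))) = transform (\<lambda>y. \<lambda>\<^sub>0 (h * y))"
    by (simp add: transform_mult_antipode[OF dual_integral(1)] transform_dual_integral dual_integral(2))
qed

lemma dual_integral_nondegenerate:
  assumes "\<And>y. \<lambda>\<^sub>0 (h * y) = 0"
  shows "h = 0"
proof (rule antipode_zero_imp_zero)
  have "S h = transform (\<lambda>v. 0)" using assms by (simp flip: transform_dual_integral)
  then show "S h = 0" by (simp add: transform_def sw_def)
qed

lemma dual_integral_nondegenerate_right:
  assumes "\<And>y. \<lambda>\<^sub>0 (y * h) = 0"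
  shows "h = 0"
proof -
  obtain g where g: "S (S g) = h" using antipode_surj by metis
  have "\<lambda>\<^sub>0 (g * y) = 0" for y
    using dual_integral_nakayama[of y g] assms[of y] by (simp add: g)
  then have "g = 0" by (rule dual_integral_nondegenerate)
  then show ?thesis using g by (simp add: S.zero)
qed

lemma dual_integral_E_commute: "e \<in> E \<Longrightarrow> \<lambda>\<^sub>0 (y * e) = \<lambda>\<^sub>0 (e * y)"
  using dual_integral_nakayama[of y e] by (simp add: antipode_E)

lemma dual_integral_antipode_square: "\<lambda>\<^sub>0 (S (S h)) = \<lambda>\<^sub>0 h"
  using dual_integral_nakayama[of 1 h] by simp

text \<open>By coassociativity, the transform of the convolution of \<open>\<psi>\<close> and \<open>\<lambda>\<^sub>0\<close> is obtained from the transform of \<open>\<lambda>\<^sub>0\<close>, that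
  is from 1, by applying \<open>\<psi>\<close> to the second leg of the coproduct.\<close>

lemma dual_integral_invariant: "sw x (\<lambda>u v. \<lambda>\<^sub>0 v *s u) = (\<Sum>e\<in>E. \<lambda>\<^sub>0 (e * x) *s e)"
proof (rule separation[OF vector_space_axioms])
  fix \<psi> assume \<psi>: "lin (*) \<psi>"
  interpret \<psi>: Vector_Spaces.linear scale "(*)" \<psi> by (rule \<psi>)
  note lin_\<psi> = lin_compose[OF _ \<psi>]
  note intros = bilinear_mapI trilinear_mapI lin_scale_left lin_scale_right lin_const_times lin_times_const
    lin_\<psi> lin_dual_integral lin_id lin_mult_right lin_mult_left
  have b: "bilinear_map (*) (\<lambda>u v. \<psi> u * \<lambda>\<^sub>0 v)" by (intro intros)
  have b': "bilinear_map scale (\<lambda>u v. \<psi> v *s u)" by (intro intros)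
  have "sw x (\<lambda>u v. \<psi> u * \<lambda>\<^sub>0 v) = (\<Sum>e\<in>E. \<psi> e * \<lambda>\<^sub>0 (e * x))"
  proof (rule transform_inject[where h = x and \<phi> = "\<lambda>x. sw x (\<lambda>u v. \<psi> u * \<lambda>\<^sub>0 v)"
        and \<psi> = "\<lambda>x. \<Sum>e\<in>E. \<psi> e * \<lambda>\<^sub>0 (e * x)"])
    show "lin (*) (\<lambda>x. sw x (\<lambda>u v. \<psi> u * \<lambda>\<^sub>0 v))" by (rule sw_bilinear_linear[OF b])
    show "lin (*) (\<lambda>x. \<Sum>e\<in>E. \<psi> e * \<lambda>\<^sub>0 (e * x))" by (intro lin_sum intros)
    have "transform (\<lambda>x. sw x (\<lambda>u v. \<psi> u * \<lambda>\<^sub>0 v)) = sw \<Lambda> (\<lambda>u v. sw v (\<lambda>p q. (\<psi> p * \<lambda>\<^sub>0 q) *s u))"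
      by (simp add: transform_def sw_scale_left)
    also have "\<dots> = sw \<Lambda> (\<lambda>x y. sw x (\<lambda>u v. (\<psi> v * \<lambda>\<^sub>0 y) *s u))"
      by (rule sw_coassoc[where s = scale, symmetric]) (intro intros)
    also have "\<dots> = sw (transform \<lambda>\<^sub>0) (\<lambda>u v. \<psi> v *s u)"
      unfolding transform_def
      by (subst sw_linear[OF sw_bilinear_linear[OF b']])
        (simp add: sw_scale_arg[OF b'] mult.commute)
    also have "\<dots> = (\<Sum>e\<in>E. \<psi> e *s e)"
      by (simp add: dual_integral(2) sw_one[OF b'])
    also have "\<dots> = (\<Sum>e\<in>E. \<psi> e *s transform (\<lambda>v. \<lambda>\<^sub>0 (e * v)))"
      by (simp add: transform_dual_integral antipode_E cong: sum.cong)
    also have "\<dots> = transform (\<lambda>x. \<Sum>e\<in>E. \<psi> e * \<lambda>\<^sub>0 (e * x))"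
      by (simp add: transform_def scale_sum_left sw_sum sw_scale)
    finally show "transform (\<lambda>x. sw x (\<lambda>u v. \<psi> u * \<lambda>\<^sub>0 v)) = transform (\<lambda>x. \<Sum>e\<in>E. \<psi> e * \<lambda>\<^sub>0 (e * x))" .
  qed
  then show "\<psi> (sw x (\<lambda>u v. \<lambda>\<^sub>0 v *s u)) = \<psi> (\<Sum>e\<in>E. \<lambda>\<^sub>0 (e * x) *s e)"
    by (simp add: sw_linear[OF \<psi>] \<psi>.sum \<psi>.scale mult.commute)
qed

text \<open>The counterpart of \<open>left_integral_sw\<close> for the dual: insert \<open>S h\<^sub>1 * h\<^sub>2\<close> in front of \<open>v\<^sub>1\<close> and use the invariance
  of \<open>\<lambda>\<^sub>0\<close> on the product \<open>h v\<close>.\<close>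

lemma dual_integral_adjoint:
  "sw v (\<lambda>p q. \<lambda>\<^sub>0 (h * q) *s p) = sw h (\<lambda>r t. \<lambda>\<^sub>0 (t * v) *s S r)"
proof -
  note intros = lin_intros lin_dual_integral
  have bh: "bilinear_map scale (\<lambda>p q. \<lambda>\<^sub>0 (h * q) *s p)" by (intro intros)
  have b1: "bilinear_map scale (\<lambda>p q. \<lambda>\<^sub>0 q *s p)" by (intro intros)
  have bv: "bilinear_map scale (\<lambda>r t. \<lambda>\<^sub>0 (t * v) *s S r)" by (intro intros)
  have "sw h (\<lambda>r t. \<lambda>\<^sub>0 (t * v) *s S r) = (\<Sum>e\<in>E. sw h (\<lambda>r t. \<lambda>\<^sub>0 (e * t * v) *s S (e * r)))"
    by (subst sum_sw_E_left[OF bv, symmetric]) (rule sum.cong, simp_all add: sw_E_mult_both[OF _ bv])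
  also have "\<dots> = sw h (\<lambda>r t. S r * (\<Sum>e\<in>E. \<lambda>\<^sub>0 (e * (t * v)) *s e))"
    by (simp add: sum_distrib_left sw_sum scale_mult_right antipode_mult_E mult.assoc cong: sum.cong)
  also have "\<dots> = sw h (\<lambda>r t. S r * sw (t * v) (\<lambda>p q. \<lambda>\<^sub>0 q *s p))"
    by (simp only: dual_integral_invariant)
  also have "\<dots> = sw h (\<lambda>r t. sw t (\<lambda>a b. sw v (\<lambda>p q. \<lambda>\<^sub>0 (b * q) *s (S r * (a * p)))))"
    by (simp add: sw_mult[OF b1] sw_mult_left scale_mult_right)
  also have "\<dots> = sw h (\<lambda>x y. sw x (\<lambda>r a. sw v (\<lambda>p q. \<lambda>\<^sub>0 (y * q) *s (S r * (a * p)))))"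
    by (rule sw_coassoc[where s = scale, symmetric]) (intro intros)
  also have "\<dots> = sw h (\<lambda>x y. sw x (\<lambda>r a. sw v (\<lambda>p q. \<lambda>\<^sub>0 (y * q) *s ((S r * a) * p))))"
    by (simp add: mult.assoc)
  also have "\<dots> = (\<Sum>e\<in>E. sw v (\<lambda>p q. \<lambda>\<^sub>0 (h * e * q) *s (e * p)))"
    by (rule sw_antipode_cancel(1)[where s = scale]) (intro intros)
  also have "\<dots> = (\<Sum>e\<in>E. sw (e * v) (\<lambda>p q. \<lambda>\<^sub>0 (h * q) *s p))"
    by (rule sum.cong) (simp_all add: sw_E_mult_both[OF _ bh] mult.assoc)
  also have "\<dots> = sw v (\<lambda>p q. \<lambda>\<^sub>0 (h * q) *s p)" by (rule sum_sw_E_left[OF bh])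
  finally show ?thesis by simp
qed

text \<open>Take the coproduct of \<open>S h = \<lambda>\<^sub>0 (h * \<Lambda>\<^sub>2) \<Lambda>\<^sub>1\<close>; coassociativity and the adjunction for \<open>\<lambda>\<^sub>0\<close>
  turn the remaining leg into an antipode.\<close>

lemma sw_antipode:
  assumes f: "bilinear_map s f"
  shows "sw (S h) f = sw h (\<lambda>r t. f (S t) (S r))"
proof -
  note intros = lin_intros lin_dual_integral bilinear_lin[OF f]
  have "sw (S h) f = sw \<Lambda> (\<lambda>u v. sw (\<lambda>\<^sub>0 (h * v) *s u) f)"
    unfolding transform_dual_integral[symmetric] transform_def
    by (rule sw_linear[OF sw_bilinear_linear[OF f]])
  also have "\<dots> = sw \<Lambda> (\<lambda>x y. sw x (\<lambda>p q. f (\<lambda>\<^sub>0 (h * y) *s p) q))"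
    by (simp only: sw_scale_arg[OF f])
  also have "\<dots> = sw \<Lambda> (\<lambda>x y. sw y (\<lambda>q v. f (\<lambda>\<^sub>0 (h * v) *s x) q))"
    by (rule sw_coassoc[where s = s]) (intro intros)
  also have "\<dots> = sw \<Lambda> (\<lambda>x y. f x (sw y (\<lambda>q v. \<lambda>\<^sub>0 (h * v) *s q)))"
    by (simp only: bilinear_scale_left[OF f] bilinear_scale_right[OF f] bilinear_sw_right[OF f])
  also have "\<dots> = sw \<Lambda> (\<lambda>x y. f x (sw h (\<lambda>r t. \<lambda>\<^sub>0 (t * y) *s S r)))"
    by (simp only: dual_integral_adjoint)
  also have "\<dots> = sw \<Lambda> (\<lambda>x y. sw h (\<lambda>r t. f (\<lambda>\<^sub>0 (t * y) *s x) (S r)))"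
    by (simp only: bilinear_scale_left[OF f] bilinear_scale_right[OF f] bilinear_sw_right[OF f])
  also have "\<dots> = sw h (\<lambda>r t. sw \<Lambda> (\<lambda>x y. f (\<lambda>\<^sub>0 (t * y) *s x) (S r)))" by (rule sw_swap)
  also have "\<dots> = sw h (\<lambda>r t. f (transform (\<lambda>y. \<lambda>\<^sub>0 (t * y))) (S r))"
    by (simp only: transform_def bilinear_sw_left[OF f])
  finally show ?thesis by (simp only: transform_dual_integral)
qed

text \<open>The modular element: it expresses the right-invariant functional \<open>\<lambda>\<^sub>0 \<circ> S\<close> through the left-invariant
  functional \<open>\<lambda>\<^sub>0\<close>.\<close>

definition modular :: 'h (\<open>\<gamma>\<close>) where
  "modular = (SOME g. \<forall>y. \<lambda>\<^sub>0 (S y) = \<lambda>\<^sub>0 (g * y))"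

lemma modular: "\<lambda>\<^sub>0 (S y) = \<lambda>\<^sub>0 (\<gamma> * y)"
proof -
  have "\<exists>g. \<forall>y. \<lambda>\<^sub>0 (S y) = \<lambda>\<^sub>0 (g * y)"
  proof (rule functional_representable[OF dual_integral(1)])
    show "w = 0" if "\<And>y. \<lambda>\<^sub>0 (w * y) = 0" for w
      using that by (rule dual_integral_nondegenerate)
    show "lin (*) (\<lambda>y. \<lambda>\<^sub>0 (S y))" by (intro lin_dual_integral lin_intros)
  qed
  then show ?thesis unfolding modular_def by (rule someI2_ex) blast
qed

text \<open>Radford's formula for the fourth power of the antipode. Both sides of the Nakayama identity are
  evaluated on a product under the antipode.\<close>

lemma antipode_fourth_power: "\<gamma> * S (S (S (S h))) = h * \<gamma>"
proof -
  have "\<lambda>\<^sub>0 (\<gamma> * S (S (S (S h))) * y) = \<lambda>\<^sub>0 (h * \<gamma> * y)" for y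
  proof -
    have "\<lambda>\<^sub>0 (\<gamma> * S (S (S (S h))) * y) = \<lambda>\<^sub>0 (S y * S (S (S (S (S h)))))"
      by (simp flip: modular antipode_mult add: mult.assoc)
    also have "\<dots> = \<lambda>\<^sub>0 (S (S (S h)) * S y)" by (rule dual_integral_nakayama)
    also have "\<dots> = \<lambda>\<^sub>0 (\<gamma> * (y * S (S h)))" by (simp flip: modular add: antipode_mult)
    also have "\<dots> = \<lambda>\<^sub>0 (\<gamma> * y * S (S h))" by (simp add: mult.assoc)
    also have "\<dots> = \<lambda>\<^sub>0 (h * (\<gamma> * y))" by (rule dual_integral_nakayama)
    finally show ?thesis by (simp add: mult.assoc)
  qed
  then have "\<gamma> * S (S (S (S h))) - h * \<gamma> = 0"
    by (intro dual_integral_nondegenerate) (simp add: left_diff_distrib dual.diff)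
  then show ?thesis by simp
qed

lemma modular_E_commute: "e \<in> E \<Longrightarrow> \<gamma> * e = e * \<gamma>"
  using antipode_fourth_power[of e] by (simp add: antipode_E)

lemma modular_invertible: "\<exists>\<gamma>'. \<gamma>' * \<gamma> = 1 \<and> \<gamma> * \<gamma>' = 1"
proof (rule right_cancellable_imp_invertible)
  fix h assume h: "h * \<gamma> = 0"
  have "\<lambda>\<^sub>0 (S (S (S h)) * y) = 0" for y
  proof -
    obtain x where x: "S x = y" using antipode_surj by blast
    have "\<lambda>\<^sub>0 (S (S (S h)) * y) = \<lambda>\<^sub>0 (\<gamma> * (x * S (S h)))" by (simp flip: x modular add: antipode_mult)
    also have "\<dots> = \<lambda>\<^sub>0 (h * (\<gamma> * x))" using dual_integral_nakayama[of "\<gamma> * x" h] by (simp add: mult.assoc)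
    also have "\<dots> = 0" by (simp add: h dual.zero flip: mult.assoc)
    finally show ?thesis .
  qed
  then show "h = 0"
    by (intro antipode_zero_imp_zero[of h] antipode_zero_imp_zero[of "S h"]
        antipode_zero_imp_zero[of "S (S h)"] dual_integral_nondegenerate)
qed

text \<open>\<open>\<Delta> x = x \<otimes> x\<close>, tested on the first leg by functionals.\<close>

definition group_like :: "'h \<Rightarrow> bool" where
  "group_like x \<longleftrightarrow> (\<forall>\<xi>. lin (*) \<xi> \<longrightarrow> sw x (\<lambda>r t. \<xi> r *s t) = \<xi> x *s x)"

text \<open>The element \<open>\<gamma>\<close> compares the left and the right invariance of \<open>\<lambda>\<^sub>0\<close>. Expressing
  \<open>\<lambda>\<^sub>0 (\<gamma> v\<^sub>2) v\<^sub>1\<close> once through this comparison and once through the coproduct of \<open>\<gamma>\<close>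
  determines the latter.\<close>

lemma group_like_modular:
  assumes e: "e \<in> E"
  shows "group_like (e * \<gamma>)"
proof -
  note intros = lin_intros lin_dual_integral
  have right: "sw y (\<lambda>p q. \<lambda>\<^sub>0 (\<gamma> * p) *s q) = (\<Sum>i\<in>E. \<lambda>\<^sub>0 (\<gamma> * (y * i)) *s i)" for y
  proof (rule antipode_inject)
    have "S (sw y (\<lambda>p q. \<lambda>\<^sub>0 (\<gamma> * p) *s q)) = sw y (\<lambda>r t. \<lambda>\<^sub>0 (S r) *s S t)"
      by (simp add: sw_linear[OF linear_antipode] S.scale modular)
    also have "\<dots> = sw (S y) (\<lambda>u v. \<lambda>\<^sub>0 v *s u)"
      by (rule sw_antipode[where s = scale, symmetric]) (intro intros)
    also have "\<dots> = (\<Sum>i\<in>E. \<lambda>\<^sub>0 (i * S y) *s i)" by (rule dual_integral_invariant)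
    also have "\<dots> = S (\<Sum>i\<in>E. \<lambda>\<^sub>0 (\<gamma> * (y * i)) *s i)"
      by (simp add: S.sum S.scale antipode_E antipode_mult_E flip: modular cong: sum.cong)
    finally show "S (sw y (\<lambda>p q. \<lambda>\<^sub>0 (\<gamma> * p) *s q)) = S (\<Sum>i\<in>E. \<lambda>\<^sub>0 (\<gamma> * (y * i)) *s i)" .
  qed
  define T where "T v = sw v (\<lambda>p q. \<lambda>\<^sub>0 (\<gamma> * q) *s p)" for v
  have bT: "bilinear_map scale (\<lambda>p q. \<lambda>\<^sub>0 (\<gamma> * q) *s p)" by (intro intros)
  have T_transform: "T (transform \<psi>) = (\<Sum>i\<in>E. \<psi> i *s (S \<gamma> * i))" if \<psi>: "lin (*) \<psi>" for \<psi>
  proof -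
    interpret \<psi>: Vector_Spaces.linear scale "(*)" \<psi> by (rule \<psi>)
    note intros' = bilinear_mapI trilinear_mapI lin_scale_left lin_scale_right lin_const_times lin_times_const
      lin_compose[OF _ \<psi>] lin_dual_integral lin_id lin_mult_right lin_mult_left
    have "T (transform \<psi>) = sw \<Lambda> (\<lambda>u v. sw (\<psi> v *s u) (\<lambda>p q. \<lambda>\<^sub>0 (\<gamma> * q) *s p))"
      unfolding T_def transform_def by (rule sw_linear[OF sw_bilinear_linear[OF bT]])
    also have "\<dots> = sw \<Lambda> (\<lambda>x y. sw x (\<lambda>u p. (\<lambda>\<^sub>0 (\<gamma> * p) * \<psi> y) *s u))"
      by (simp add: sw_scale_arg[OF bT])
    also have "\<dots> = sw \<Lambda> (\<lambda>x y. sw y (\<lambda>p q. (\<lambda>\<^sub>0 (\<gamma> * p) * \<psi> q) *s x))"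
      by (rule sw_coassoc[where s = scale]) (intro intros')
    also have "\<dots> = sw \<Lambda> (\<lambda>x y. \<psi> (sw y (\<lambda>p q. \<lambda>\<^sub>0 (\<gamma> * p) *s q)) *s x)"
      by (simp add: sw_linear[OF \<psi>] \<psi>.scale sw_scale_left)
    also have "\<dots> = sw \<Lambda> (\<lambda>x y. (\<Sum>i\<in>E. \<lambda>\<^sub>0 (\<gamma> * (y * i)) * \<psi> i) *s x)"
      by (simp add: right \<psi>.sum \<psi>.scale)
    also have "\<dots> = (\<Sum>i\<in>E. \<psi> i *s transform (\<lambda>y. \<lambda>\<^sub>0 (\<gamma> * (y * S i))))"
      by (simp add: transform_def scale_sum_left sw_sum sw_scale antipode_E mult.commute[of _ "\<psi> _"] cong: sum.cong)
    finally have eq: "T (transform \<psi>) = \<dots>" .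
    have "transform (\<lambda>y. \<lambda>\<^sub>0 (\<gamma> * (y * S i))) = S \<gamma> * i" for i
    proof -
      have "lin (*) (\<lambda>y. \<lambda>\<^sub>0 (\<gamma> * y))" by (intro intros)
      from transform_mult_antipode[OF this, of i] show ?thesis by (simp add: transform_dual_integral mult.assoc)
    qed
    then show ?thesis by (simp add: eq)
  qed
  have T: "T v = (\<Sum>i\<in>E. \<lambda>\<^sub>0 (\<gamma> * i * v) *s (S \<gamma> * i))" for v
  proof -
    obtain h where h: "S h = v" using antipode_surj by blast
    have "lin (*) (\<lambda>v. \<lambda>\<^sub>0 (h * v))" by (intro intros)
    from T_transform[OF this] have "T v = (\<Sum>i\<in>E. \<lambda>\<^sub>0 (h * i) *s (S \<gamma> * i))"
      by (simp add: transform_dual_integral h)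
    moreover have "\<lambda>\<^sub>0 (h * i) = \<lambda>\<^sub>0 (\<gamma> * i * v)" if "i \<in> E" for i
    proof -
      have "\<lambda>\<^sub>0 (h * i) = \<lambda>\<^sub>0 (S (S (h * i)))" by (simp add: dual_integral_antipode_square)
      then show ?thesis using that by (simp add: modular antipode_mult_E(1) h mult.assoc)
    qed
    ultimately show ?thesis by (simp cong: sum.cong)
  qed
  have comult: "sw \<gamma> (\<lambda>r t. \<xi> r *s t) = (\<Sum>i\<in>E. \<xi> (i * \<gamma>) *s (\<gamma> * i))" if \<xi>: "lin (*) \<xi>" for \<xi>
  proof -
    interpret \<xi>: Vector_Spaces.linear scale "(*)" \<xi> by (rule \<xi>)
    have "\<lambda>\<^sub>0 ((sw \<gamma> (\<lambda>r t. \<xi> r *s t) - (\<Sum>i\<in>E. \<xi> (i * \<gamma>) *s (\<gamma> * i))) * v) = 0" for v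
    proof -
      have "sw \<gamma> (\<lambda>r t. \<lambda>\<^sub>0 (t * v) *s r) = (\<Sum>i\<in>E. \<lambda>\<^sub>0 (\<gamma> * i * v) *s (i * \<gamma>))"
      proof (rule antipode_inject)
        have "S (sw \<gamma> (\<lambda>r t. \<lambda>\<^sub>0 (t * v) *s r)) = T v"
          by (simp add: sw_linear[OF linear_antipode] S.scale T_def dual_integral_adjoint)
        then show "S (sw \<gamma> (\<lambda>r t. \<lambda>\<^sub>0 (t * v) *s r)) = S (\<Sum>i\<in>E. \<lambda>\<^sub>0 (\<gamma> * i * v) *s (i * \<gamma>))"
          by (simp add: T S.sum S.scale antipode_mult_E cong: sum.cong)
      qed
      from arg_cong[OF this, of \<xi>]
      have "sw \<gamma> (\<lambda>r t. \<lambda>\<^sub>0 (t * v) * \<xi> r) = (\<Sum>i\<in>E. \<lambda>\<^sub>0 (\<gamma> * i * v) * \<xi> (i * \<gamma>))"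
        by (simp add: sw_linear[OF \<xi>] \<xi>.scale \<xi>.sum)
      then show ?thesis
        by (simp add: left_diff_distrib dual.diff sw_mult_right sw_linear[OF dual_integral(1)] sum_distrib_right
            dual.sum scale_mult_left dual.scale mult.commute[of "\<xi> _"])
    qed
    then have "sw \<gamma> (\<lambda>r t. \<xi> r *s t) - (\<Sum>i\<in>E. \<xi> (i * \<gamma>) *s (\<gamma> * i)) = 0"
      by (rule dual_integral_nondegenerate)
    then show ?thesis by simp
  qed
  show ?thesis
    unfolding group_like_def
  proof (intro allI impI)
    fix \<xi> assume \<xi>: "lin (*) \<xi>"
    interpret \<xi>: Vector_Spaces.linear scale "(*)" \<xi> by (rule \<xi>)
    have \<xi>e: "lin (*) (\<lambda>r. \<xi> (e * r))" by (rule lin_compose[OF linear_mult_right \<xi>])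
    have b: "bilinear_map scale (\<lambda>r t. \<xi> r *s t)"
      by (intro bilinear_mapI lin_scale_left lin_scale_right \<xi> lin_id)
    have "sw (e * \<gamma>) (\<lambda>r t. \<xi> r *s t) = sw \<gamma> (\<lambda>r t. \<xi> (e * r) *s t)"
      by (rule sw_E_mult(1)[OF e b, symmetric])
    also have "\<dots> = (\<Sum>i\<in>E. \<xi> (e * (i * \<gamma>)) *s (\<gamma> * i))" by (rule comult[OF \<xi>e])
    also have "\<dots> = \<xi> (e * \<gamma>) *s (e * \<gamma>)"
      by (rule sum_E_single[OF e]) (use e in \<open>auto simp: E_mult_assoc \<xi>.zero modular_E_commute\<close>)
    finally show "sw (e * \<gamma>) (\<lambda>r t. \<xi> r *s t) = \<xi> (e * \<gamma>) *s (e * \<gamma>)" using e finite_E by simp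
  qed
qed

lemma group_like_mult:
  assumes "group_like x" and "group_like y"
  shows "group_like (x * y)"
  unfolding group_like_def
proof (intro allI impI)
  fix \<xi> assume \<xi>: "lin (*) \<xi>"
  have \<xi>1: "lin (*) (\<lambda>r'. \<xi> (r * r'))" and \<xi>2: "lin (*) (\<lambda>r. \<xi> (r * y))" for r
    by (rule lin_compose[OF linear_mult_right \<xi>]) (rule lin_compose[OF linear_mult_left \<xi>])
  have b: "bilinear_map scale (\<lambda>r t. \<xi> r *s t)"
    by (intro bilinear_mapI lin_scale_left lin_scale_right \<xi> lin_id)
  have "sw (x * y) (\<lambda>r t. \<xi> r *s t) = sw x (\<lambda>r t. t * sw y (\<lambda>r' t'. \<xi> (r * r') *s t'))"
    by (simp add: sw_mult[OF b] sw_mult_left scale_mult_right)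
  also have "\<dots> = sw x (\<lambda>r t. \<xi> (r * y) *s t) * y"
    using assms(2) \<xi>1 by (simp add: group_like_def sw_mult_right scale_mult_right scale_mult_left)
  also have "\<dots> = \<xi> (x * y) *s (x * y)"
    using assms(1) \<xi>2 by (simp add: group_like_def scale_mult_left)
  finally show "sw (x * y) (\<lambda>r t. \<xi> r *s t) = \<xi> (x * y) *s (x * y)" .
qed

text \<open>In a relation \<open>y = (\<Sum>a\<in>A. c\<^sub>a a)\<close> compare the coproducts: applying the coordinate functional of \<open>a\<close> to the first
  leg gives \<open>c\<^sub>a y = c\<^sub>a a\<close>.\<close>

lemma group_likes_independent:
  assumes "finite A" and "\<And>x. x \<in> A \<Longrightarrow> group_like x \<and> x \<noteq> 0"
  shows "independent A"
  using assms
proof (induction A rule: finite_induct)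
  case empty
  show ?case by (rule independent_empty)
next
  case (insert y A)
  then have A: "independent A" by simp
  have "y \<notin> span A"
  proof
    assume y: "y \<in> span A"
    let ?c = "representation A y"
    have exp: "y = (\<Sum>a\<in>A. ?c a *s a)"
      using sum_representation_eq[OF A y insert.hyps(1) order_refl] by simp
    have "?c a = 0" if a: "a \<in> A" for a
    proof -
      obtain \<xi> where \<xi>: "lin (*) \<xi>" "\<And>b. b \<in> A \<Longrightarrow> \<xi> b = (if b = a then 1 else 0)"
        using coordinate_functional_exists[OF A a] by blast
      interpret \<xi>: Vector_Spaces.linear scale "(*)" \<xi> by (rule \<xi>(1))
      have b: "bilinear_map scale (\<lambda>r t. \<xi> r *s t)"
        by (intro bilinear_mapI lin_scale_left lin_scale_right \<xi> lin_id)
      interpret D: Vector_Spaces.linear scale scale "\<lambda>x. sw x (\<lambda>r t. \<xi> r *s t)"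
        by (rule sw_bilinear_linear[OF b])
      have "\<xi> y = (\<Sum>b\<in>A. if b = a then ?c a else 0)"
        by (subst exp, unfold \<xi>.sum \<xi>.scale) (rule sum.cong, simp_all add: \<xi>(2))
      then have \<xi>y: "\<xi> y = ?c a" using a insert.hyps(1) by simp
      have "?c a *s y = sw y (\<lambda>r t. \<xi> r *s t)"
        using insert.prems[of y] \<xi>(1) \<xi>y by (simp add: group_like_def)
      also have "\<dots> = (\<Sum>b\<in>A. ?c b *s sw b (\<lambda>r t. \<xi> r *s t))"
        by (subst exp) (simp only: D.sum D.scale)
      also have "\<dots> = (\<Sum>b\<in>A. if b = a then ?c a *s a else 0)"
      proof (rule sum.cong[OF refl])
        fix b assume b: "b \<in> A"
        then have "sw b (\<lambda>r t. \<xi> r *s t) = \<xi> b *s b"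
          using insert.prems[of b] \<xi>(1) by (simp add: group_like_def)
        then show "?c b *s sw b (\<lambda>r t. \<xi> r *s t) = (if b = a then ?c a *s a else 0)"
          using b by (simp add: \<xi>(2))
      qed
      also have "\<dots> = ?c a *s a" using a insert.hyps(1) by simp
      finally have "?c a = 0 \<or> y = a" by (simp add: scale_cancel_left disj_commute)
      then show ?thesis using a insert.hyps(2) by auto
    qed
    then have "y = 0" using exp by simp
    then show False using insert.prems[of y] by simp
  qed
  then show ?case using A by (simp add: independent_insertI)
qed

lemma modular_finite_order:
  assumes e: "e \<in> E"
  shows "\<exists>N>0. e * \<gamma> ^ N = e"
proof -
  obtain \<gamma>' where \<gamma>': "\<gamma>' * \<gamma> = 1" "\<gamma> * \<gamma>' = 1" using modular_invertible by blast
  have cancel: "\<gamma> ^ n * \<gamma>' ^ n = 1" for n by (rule left_right_inverse_power[OF \<gamma>'(2)])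
  have commute: "\<gamma> ^ n * e = e * \<gamma> ^ n" for n
    by (induction n) (simp_all add: mult.assoc, metis modular_E_commute e mult.assoc)
  have gl: "group_like (e * \<gamma> ^ Suc n)" for n
  proof (induction n)
    case 0
    show ?case using group_like_modular[OF e] by simp
  next
    case (Suc n)
    have "(e * \<gamma>) * (e * \<gamma> ^ Suc n) = e * (\<gamma> * e) * \<gamma> ^ Suc n" by (simp add: mult.assoc)
    also have "\<dots> = e * \<gamma> ^ Suc (Suc n)" using e by (simp add: modular_E_commute E_mult_assoc mult.assoc)
    finally show ?case using group_like_mult[OF group_like_modular[OF e] Suc] by simp
  qed
  have nonzero: "e * \<gamma> ^ n \<noteq> 0" for n
  proof
    assume "e * \<gamma> ^ n = 0"
    then have "e * (\<gamma> ^ n * \<gamma>' ^ n) = 0" by (simp flip: mult.assoc)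
    then have "e = 0" using cancel by simp
    then show False using e orthogonal_E by (auto simp: orthogonal_idempotents_def)
  qed
  have "\<not> inj (\<lambda>n. e * \<gamma> ^ Suc n)"
  proof
    assume inj: "inj (\<lambda>n. e * \<gamma> ^ Suc n)"
    let ?A = "(\<lambda>n. e * \<gamma> ^ Suc n) ` {..card Basis}"
    have "independent ?A"
      by (rule group_likes_independent) (use gl nonzero[of "Suc _"] in auto)
    then have "card ?A \<le> card Basis"
      using independent_span_bound[OF finite_Basis] span_Basis by (metis subset_UNIV)
    moreover have "card ?A = Suc (card Basis)"
      using inj by (subst card_image) (auto intro: inj_on_subset)
    ultimately show False by simp
  qed
  then obtain m n where "m \<noteq> n" "e * \<gamma> ^ Suc m = e * \<gamma> ^ Suc n" by (auto simp: inj_def)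
  then obtain m n where mn: "m < n" "e * \<gamma> ^ m = e * \<gamma> ^ n"
    by (metis Suc_less_eq linorder_neqE_nat)
  have "e = e * \<gamma> ^ m * \<gamma>' ^ m" by (simp add: mult.assoc cancel)
  also have "\<dots> = e * \<gamma> ^ (n - m + m) * \<gamma>' ^ m" using mn by simp
  also have "\<dots> = e * \<gamma> ^ (n - m)" by (simp only: power_add mult.assoc cancel mult_1_right)
  finally show ?thesis using mn by (intro exI[of _ "n - m"]) simp
qed

text \<open>The pairs of legs of \<open>\<Lambda>\<close>, paired through \<open>\<lambda>\<^sub>0\<close>, are dual bases for computing traces.\<close>

lemma trace_antipode_square:
  assumes e: "e \<in> E"
  shows "trace (\<lambda>x. e * S (S x) * e) = \<lambda>\<^sub>0 e"
proof -
  note intros = lin_intros lin_dual_integral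
  let ?u = "\<lambda>i. fst (legs \<Lambda> ! i)" and ?v = "\<lambda>i. snd (legs \<Lambda> ! i)"
  have "trace (\<lambda>x. e * S (S x) * e) = (\<Sum>i<length (legs \<Lambda>). \<lambda>\<^sub>0 (?v i * S (e * S (S (?u i)) * e)))"
  proof (rule trace_dual_family)
    show "lin (*) (\<lambda>x. \<lambda>\<^sub>0 (?v i * S x))" for i by (intro intros)
    show "x = (\<Sum>i<length (legs \<Lambda>). \<lambda>\<^sub>0 (?v i * S x) *s ?u i)" for x
    proof -
      have "transform (\<lambda>v. \<lambda>\<^sub>0 (v * S x)) = x"
        by (simp add: transform_mult_antipode[OF dual_integral(1)] dual_integral(2))
      then show ?thesis unfolding transform_def sw_def by (rule sym)
    qed
    show "lin scale (\<lambda>x. e * S (S x) * e)" by (intro intros)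
  qed
  also have "\<dots> = sw \<Lambda> (\<lambda>u v. \<lambda>\<^sub>0 (v * S (e * S (S u) * e)))" by (simp add: sw_def)
  also have "\<dots> = sw \<Lambda> (\<lambda>u v. \<lambda>\<^sub>0 (e * (S (e * u) * v)))"
  proof -
    have "S (e * S (S u) * e) = S (S (e * S u * e))" for u
      using e by (simp add: antipode_mult_E mult.assoc)
    then have "\<lambda>\<^sub>0 (v * S (e * S (S u) * e)) = \<lambda>\<^sub>0 (e * S u * e * v)" for u v
      by (simp add: dual_integral_nakayama)
    then show ?thesis using e by (simp add: antipode_mult_E mult.assoc)
  qed
  also have "\<dots> = \<lambda>\<^sub>0 (e * sw \<Lambda> (\<lambda>u v. S (e * u) * v))"
    by (simp add: sw_mult_left sw_linear[OF dual_integral(1)])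
  also have "sw \<Lambda> (\<lambda>u v. S (e * u) * v) = sw (e * \<Lambda>) (\<lambda>u v. S u * v)"
    by (rule sw_E_mult(1)[OF e, where s = scale]) (intro intros)
  also have "\<dots> = \<epsilon>\<^sub>s (e * \<Lambda>)" by (rule sw_antipode_left)
  also have "e * \<epsilon>\<^sub>s (e * \<Lambda>) = \<epsilon> (e * \<Lambda> * e) *s e"
    unfolding source_counital_sum sum_distrib_left
    by (rule sum_E_single[OF e]) (use e in \<open>auto simp: scale_mult_right E_mult\<close>)
  also have "\<dots> = e" using e finite_E by (simp add: counit_integral)
  finally show ?thesis .
qed

end


section \<open>Semisimplicity of the dual\<close>

locale semisimple_weak_hopf_algebra =
  integral_weak_hopf_algebra scale \<Delta> \<epsilon> S E Basis \<Lambda> + semisimple_algebra scale Basis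
  for scale :: "'k::{alg_closed_field, field_char_0} \<Rightarrow> 'h::{ring, monoid_mult} \<Rightarrow> 'h" (infixr \<open>*s\<close> 75)
    and \<Delta> :: "'h \<Rightarrow> ('k, 'h) tensor2"
    and \<epsilon> :: "'h \<Rightarrow> 'k"
    and S :: "'h \<Rightarrow> 'h"
    and E Basis :: "'h set"
    and \<Lambda> :: 'h
begin

lemma central_square_root_exists:
  assumes "z \<in> center"
  shows "\<exists>c\<in>center. c * c = z"
proof -
  obtain C where C: "orthogonal_idempotents C" "span C = center"
    using central_idempotents_exist by blast
  have fC: "finite C" using C(1) by (simp add: orthogonal_idempotents_def)
  obtain d where d: "z = (\<Sum>i\<in>C. d i *s i)"
    using assms span_finite[OF fC] C(2) by auto
  have "\<exists>r. r * r = a" for a :: 'k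
  proof -
    have "degree [:- a, 0, 1:] > 0" by simp
    then obtain r where "poly [:- a, 0, 1:] r = 0" using alg_closed_imp_poly_has_root by blast
    then show ?thesis by (intro exI[of _ r]) simp
  qed
  then obtain r where r: "\<And>a :: 'k. r a * r a = a" by metis
  define c where "c = (\<Sum>i\<in>C. r (d i) *s i)"
  have "c * c = (\<Sum>i\<in>C. \<Sum>j\<in>C. if j = i then d i *s i else 0)"
    unfolding c_def sum_product
  proof (intro sum.cong refl)
    fix i j assume "i \<in> C" "j \<in> C"
    then show "(r (d i) *s i) * (r (d j) *s j) = (if j = i then d i *s i else 0)"
      by (auto simp: scale_mult_left scale_mult_right orthogonal_idempotents_mult[OF C(1)] r)
  qed
  then have "c * c = z" using fC by (simp add: d)
  moreover have "c \<in> span C" unfolding c_def by (intro span_sum span_scale span_base)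
  ultimately show ?thesis using C(2) by blast
qed

text \<open>Writing \<open>\<lambda>\<^sub>0\<close> through the trace form makes the square of the antipode the conjugation by an element
  \<open>w\<close>. By Radford's formula \<open>\<gamma> * w * w\<close> is central, so \<open>w\<close> can be normalised by a central square root
  to an element \<open>u\<close> with \<open>\<gamma> * u * u = 1\<close>, which has finite order in each corner.\<close>

lemma antipode_square_inner:
  "\<exists>u u'. u * u' = 1 \<and> u' * u = 1 \<and> \<gamma> * (u * u) = 1 \<and> (\<forall>x. S (S x) = u * x * u')"
proof -
  obtain w where w: "\<And>y. \<lambda>\<^sub>0 y = regular_character (w * y)"
    using functional_representable[OF \<tau>_linear \<tau>_nondegenerate dual_integral(1)] by blast
  have conj: "w * h = S (S h) * w" for h
  proof -
    have "regular_character ((w * h - S (S h) * w) * y) = 0" for y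
    proof -
      have "regular_character (w * h * y) = regular_character (w * (y * S (S h)))"
        using dual_integral_nakayama[of y h] by (simp add: w mult.assoc)
      also have "\<dots> = regular_character (S (S h) * w * y)"
        using \<tau>_commute[of "w * y" "S (S h)"] by (simp add: mult.assoc)
      finally show ?thesis by (simp add: left_diff_distrib \<tau>.diff)
    qed
    then have "w * h - S (S h) * w = 0" by (rule \<tau>_nondegenerate)
    then show ?thesis by simp
  qed
  have "\<exists>w'. w' * w = 1 \<and> w * w' = 1"
  proof (rule right_cancellable_imp_invertible)
    fix x assume x: "x * w = 0"
    have "\<lambda>\<^sub>0 (y * x) = 0" for y
    proof -
      have "\<lambda>\<^sub>0 (y * x) = regular_character (y * x * w)"
        using \<tau>_commute[of w "y * x"] by (simp add: w)
      then show ?thesis by (simp add: mult.assoc x \<tau>.zero)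
    qed
    then show "x = 0" by (rule dual_integral_nondegenerate_right)
  qed
  then obtain w' where w': "w' * w = 1" "w * w' = 1" by blast
  have w'_cancel: "w' * (w * x) = x" "w * (w' * x) = x" for x
    using w' by (simp_all flip: mult.assoc)
  obtain \<gamma>' where \<gamma>': "\<gamma>' * \<gamma> = 1" "\<gamma> * \<gamma>' = 1" using modular_invertible by blast
  have SS: "S (S x) = w * x * w'" for x
    using conj[of x] w'(2) by (metis mult.assoc mult_1_right)
  define z where "z = \<gamma> * (w * w)"
  define z' where "z' = w' * w' * \<gamma>'"
  have zz': "z * z' = 1" "z' * z = 1"
    using \<gamma>' w' by (simp_all add: z_def z'_def mult.assoc w'_cancel)
      (simp flip: mult.assoc add: \<gamma>')
  have z_comm: "z * h = h * z" for h
  proof -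
    have "\<gamma> * (w * (w * h * w') * w') = h * \<gamma>"
      using antipode_fourth_power[of h] by (simp only: SS)
    then have "\<gamma> * (w * (w * h * w') * w') * (w * w) = h * \<gamma> * (w * w)" by simp
    then show ?thesis using w' by (simp add: z_def mult.assoc w'_cancel)
  qed
  have z'_comm: "z' * h = h * z'" for h
  proof -
    have "z' * h = z' * (h * z) * z'" using zz' by (simp add: mult.assoc)
    also have "\<dots> = z' * (z * h) * z'" by (simp only: z_comm)
    also have "\<dots> = h * z'" using zz' by (simp flip: mult.assoc)
    finally show ?thesis .
  qed
  then have "z' \<in> center" unfolding center_def by blast
  then obtain c where c: "c \<in> center" "c * c = z'" using central_square_root_exists by blast
  have cc: "c * x = x * c" for x using c(1) by (rule centerD)
  define u where "u = w * c"
  define u' where "u' = w' * (c * z)"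
  have ccz: "c * (c * z) = 1" using c(2) zz' by (simp flip: mult.assoc)
  have czc: "c * z * x = x * (c * z)" for x by (metis cc z_comm mult.assoc)
  have "u * u' = w * (w' * (c * (c * z)))"
    unfolding u_def u'_def by (metis cc mult.assoc)
  then have 1: "u * u' = 1" using w' ccz by simp
  have "u' * u = w' * w * (c * (c * z))"
    unfolding u_def u'_def by (metis czc cc mult.assoc)
  then have 2: "u' * u = 1" using w' ccz by simp
  have "\<gamma> * (u * u) = \<gamma> * (w * w) * (c * c)"
    unfolding u_def by (metis cc mult.assoc)
  then have 3: "\<gamma> * (u * u) = 1" using zz' c(2) by (simp add: z_def)
  have "u * x * u' = w * x * w' * (c * (c * z))" for x
    unfolding u_def u'_def by (metis czc cc mult.assoc)
  then have "S (S x) = u * x * u'" for x using ccz by (simp add: SS)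
  then show ?thesis using 1 2 3 by blast
qed

text \<open>The primitive idempotent required in the corner of \<open>e\<close> is the integral \<open>e * \<Lambda> * e\<close> of the Hopf algebra \<open>e H e\<close>.\<close>

lemma dual_integral_E_nonzero:
  assumes e: "e \<in> E"
  shows "\<lambda>\<^sub>0 e \<noteq> 0"
proof -
  obtain u u' where u: "u * u' = 1" "u' * u = 1" "\<gamma> * (u * u) = 1" "\<And>x. S (S x) = u * x * u'"
    using antipode_square_inner by blast
  obtain \<gamma>' where \<gamma>': "\<gamma>' * \<gamma> = 1" "\<gamma> * \<gamma>' = 1" using modular_invertible by blast
  obtain N where N: "N > 0" "e * \<gamma> ^ N = e" using modular_finite_order[OF e] by blast
  have ee: "e * e = e" using E_mult[OF e e] by simp
  have "u * e * u' = e" using u(4)[of e] by (simp add: antipode_E[OF e])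
  then have eu: "e * u = u * e" using u(2) by (metis mult.assoc mult_1_right)
  have "e * u ^ (2 * N) = e * (\<gamma> ^ N * (u * u) ^ N)"
    using N(2) by (simp flip: mult.assoc add: power_mult power2_eq_square)
  also have "\<dots> = e"
    using left_right_inverse_power[OF u(3), of N] by simp
  finally have order: "e * u ^ (2 * N) = e" .
  define l where "l = e * \<Lambda> * e"
  have "\<epsilon> l = 1" by (simp add: l_def counit_integral[OF e])
  then have l0: "l \<noteq> 0" by (auto simp: \<epsilon>.zero)
  have act: "e * x * l = \<epsilon> (e * x * e) *s l" for x
  proof -
    have "e * x * l = (e * (x * e)) * \<Lambda> * e" by (simp add: l_def mult.assoc)
    also have "(e * (x * e)) * \<Lambda> = \<epsilon>\<^sub>t (e * (x * e)) * \<Lambda>"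
      using left_integral unfolding left_integral_def by blast
    finally show ?thesis
      by (simp add: target_counital_corner[OF e] l_def scale_mult_left mult.assoc)
  qed
  have el: "e * l = l" by (simp add: l_def ee flip: mult.assoc)
  have "l * l = e * \<Lambda> * l" using el by (simp add: l_def mult.assoc)
  also have "\<dots> = l" using act[of \<Lambda>] \<open>\<epsilon> l = 1\<close> by (simp add: l_def)
  finally have ll: "l * l = l" .
  have "trace (\<lambda>x. e * (u * x * u') * e) \<noteq> 0"
    by (rule trace_conjugation_nonzero[OF _ ee eu u(1,2) order l0 el ll]) (use N act in auto)
  then show ?thesis
    using trace_antipode_square[OF e] by (simp add: u(4))
qed

definition normal_integral :: "'h \<Rightarrow> 'k" (\<open>\<mu>\<close>) where
  "\<mu> x = (\<Sum>e\<in>E. inverse (\<lambda>\<^sub>0 e) * \<lambda>\<^sub>0 (e * x))"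

lemma normal_integral_linear: "lin (*) \<mu>"
  unfolding normal_integral_def[abs_def] by (intro lin_sum lin_const_times lin_dual_integral lin_intros)

lemma lin_normal_integral: "lin scale f \<Longrightarrow> lin (*) (\<lambda>x. \<mu> (f x))"
  by (rule lin_compose[OF _ normal_integral_linear])

lemma normal_integral_E:
  assumes e: "e \<in> E"
  shows "\<mu> (e * x) = inverse (\<lambda>\<^sub>0 e) * \<lambda>\<^sub>0 (e * x)" and "\<mu> (x * e) = \<mu> (e * x)" and "\<mu> e = 1"
proof -
  have "\<mu> (e * x) = inverse (\<lambda>\<^sub>0 e) * \<lambda>\<^sub>0 (e * x)" for x
    unfolding normal_integral_def by (rule sum_E_single[OF e]) (use e in \<open>auto simp: E_mult_assoc dual.zero\<close>)
  then show 1: "\<mu> (e * x) = inverse (\<lambda>\<^sub>0 e) * \<lambda>\<^sub>0 (e * x)" for x using e finite_E by simp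
  have "\<mu> (x * e) = (\<Sum>i\<in>E. if i = e then inverse (\<lambda>\<^sub>0 e) * \<lambda>\<^sub>0 (e * x) else 0)"
    unfolding normal_integral_def
  proof (rule sum.cong[OF refl])
    fix i assume i: "i \<in> E"
    have "\<lambda>\<^sub>0 (i * (x * e)) = \<lambda>\<^sub>0 (e * (i * x))"
      using dual_integral_E_commute[OF e, of "i * x"] by (simp add: mult.assoc)
    then show "inverse (\<lambda>\<^sub>0 i) * \<lambda>\<^sub>0 (i * (x * e)) = (if i = e then inverse (\<lambda>\<^sub>0 e) * \<lambda>\<^sub>0 (e * x) else 0)"
      using e i by (auto simp: E_mult_assoc dual.zero)
  qed
  then show "\<mu> (x * e) = \<mu> (e * x)" using e finite_E by (simp add: 1)
  show "\<mu> e = 1"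
    using 1[of e] E_mult[OF e e] dual_integral_E_nonzero[OF e] by simp
qed

lemma normal_integral_invariant: "sw x (\<lambda>u v. \<mu> v *s u) = (\<Sum>e\<in>E. \<mu> (e * x) *s e)"
proof -
  have b: "bilinear_map scale (\<lambda>u v. \<lambda>\<^sub>0 v *s u)" by (intro lin_intros lin_dual_integral)
  have "sw x (\<lambda>u v. \<mu> v *s u) = (\<Sum>i\<in>E. inverse (\<lambda>\<^sub>0 i) *s sw x (\<lambda>u v. \<lambda>\<^sub>0 (i * v) *s u))"
    by (simp add: normal_integral_def scale_sum_left sw_sum sw_scale)
  also have "\<dots> = (\<Sum>i\<in>E. inverse (\<lambda>\<^sub>0 i) *s (\<lambda>\<^sub>0 (i * x) *s i))"
  proof (rule sum.cong[OF refl])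
    fix i assume i: "i \<in> E"
    have "sw x (\<lambda>u v. \<lambda>\<^sub>0 (i * v) *s u) = sw (i * x) (\<lambda>u v. \<lambda>\<^sub>0 v *s u)"
      by (rule sw_E_mult(2)[OF i b])
    also have "\<dots> = (\<Sum>e\<in>E. \<lambda>\<^sub>0 (e * (i * x)) *s e)" by (rule dual_integral_invariant)
    also have "\<dots> = \<lambda>\<^sub>0 (i * x) *s i"
      by (rule sum_E_single[OF i]) (use i in \<open>auto simp: E_mult_assoc dual.zero\<close>)
    finally show "inverse (\<lambda>\<^sub>0 i) *s sw x (\<lambda>u v. \<lambda>\<^sub>0 (i * v) *s u) = inverse (\<lambda>\<^sub>0 i) *s (\<lambda>\<^sub>0 (i * x) *s i)"
      by simp
  qed
  finally show ?thesis by (simp add: normal_integral_E(1) cong: sum.cong)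
qed

text \<open>The form \<open>\<mu> (x * S y)\<close> on \<open>H \<otimes> H\<close> is a separability idempotent of the dual algebra:
  its product is the counit, and both module structures agree on it.\<close>

lemma casimir_form_product: "sw x (\<lambda>u v. \<mu> (u * S v)) = \<epsilon> x"
proof -
  interpret \<mu>: Vector_Spaces.linear scale "(*)" \<mu> by (rule normal_integral_linear)
  have "sw x (\<lambda>u v. \<mu> (u * S v)) = \<mu> (\<epsilon>\<^sub>t x)"
    by (simp flip: sw_linear[OF normal_integral_linear] add: sw_antipode_right)
  also have "\<dots> = (\<Sum>e\<in>E. \<epsilon> (e * x))"
    by (simp add: target_counital_sum \<mu>.sum \<mu>.scale normal_integral_E(3) cong: sum.cong)
  finally show ?thesis by (simp flip: \<epsilon>.sum add: sum_E_left)
qed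

lemma casimir_form_balanced:
  "sw x (\<lambda>u v. \<mu> (v * S y) *s u) = sw y (\<lambda>p q. \<mu> (x * S p) *s q)"
proof -
  note intros = lin_intros lin_normal_integral
  have by': "bilinear_map scale (\<lambda>p q. \<mu> (x * S p) *s q)" by (intro intros)
  have bx: "bilinear_map scale (\<lambda>u v. \<mu> (v * S y) *s u)" by (intro intros)
  have b\<mu>: "bilinear_map scale (\<lambda>u v. \<mu> v *s u)" by (intro intros)
  have "sw y (\<lambda>p q. \<mu> (x * S p) *s q) = (\<Sum>e\<in>E. sw y (\<lambda>p q. \<mu> (x * S (e * p)) *s (e * q)))"
    by (subst sum_sw_E_left[OF by', symmetric]) (rule sum.cong, simp_all add: sw_E_mult_both[OF _ by'])
  also have "\<dots> = (\<Sum>e\<in>E. sw y (\<lambda>p q. \<mu> (e * (x * S p)) *s (e * q)))"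
    by (rule sum.cong[OF refl]) (simp add: antipode_mult_E normal_integral_E(2) flip: mult.assoc)
  also have "\<dots> = sw y (\<lambda>p q. (\<Sum>e\<in>E. \<mu> (e * (x * S p)) *s e) * q)"
    by (simp add: sum_distrib_right scale_mult_left sw_sum)
  also have "\<dots> = sw y (\<lambda>p q. sw (x * S p) (\<lambda>u v. \<mu> v *s u) * q)"
    by (simp only: normal_integral_invariant)
  also have "\<dots> = sw y (\<lambda>p q. sw p (\<lambda>r t. sw x (\<lambda>u v. \<mu> (v * S r) *s (u * (S t * q)))))"
  proof -
    have "sw (x * S p) (\<lambda>u v. \<mu> v *s u) = sw p (\<lambda>r t. sw x (\<lambda>u v. \<mu> (v * S r) *s (u * S t)))" for p
    proof -
      have inner: "sw (S p) (\<lambda>r t. \<mu> (v * t) *s (u * r)) = sw p (\<lambda>r t. \<mu> (v * S r) *s (u * S t))" for u v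
        by (rule sw_antipode[where s = scale]) (intro intros)
      have "sw (x * S p) (\<lambda>u v. \<mu> v *s u) = sw x (\<lambda>u v. sw p (\<lambda>r t. \<mu> (v * S r) *s (u * S t)))"
        by (simp only: sw_mult[OF b\<mu>] inner)
      also have "\<dots> = sw p (\<lambda>r t. sw x (\<lambda>u v. \<mu> (v * S r) *s (u * S t)))" by (rule sw_swap)
      finally show ?thesis .
    qed
    then show ?thesis by (simp add: sw_mult_right scale_mult_left mult.assoc)
  qed
  also have "\<dots> = sw y (\<lambda>r c. sw c (\<lambda>t q. sw x (\<lambda>u v. \<mu> (v * S r) *s (u * (S t * q)))))"
    by (rule sw_coassoc[where s = scale]) (intro intros)
  also have "\<dots> = (\<Sum>e\<in>E. sw x (\<lambda>u v. \<mu> (v * S (y * e)) *s (u * e)))"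
    by (rule sw_antipode_cancel(2)[where s = scale]) (intro intros)
  also have "\<dots> = (\<Sum>e\<in>E. sw (x * e) (\<lambda>u v. \<mu> (v * S y) *s u))"
    by (rule sum.cong[OF refl]) (simp add: sw_mult_E_both[OF _ bx] antipode_mult_E mult.assoc)
  also have "\<dots> = sw x (\<lambda>u v. \<mu> (v * S y) *s u)" by (rule sum_sw_E_right[OF bx])
  finally show ?thesis by simp
qed

end


context weak_hopf_algebra
begin

definition conv :: "('h \<Rightarrow> 'k) \<Rightarrow> ('h \<Rightarrow> 'k) \<Rightarrow> 'h \<Rightarrow> 'k" where
  "conv \<phi> \<psi> h = sw h (\<lambda>x y. \<phi> x * \<psi> y)"

lemma conv_bilinear:
  assumes "lin (*) \<phi>" and "lin (*) \<psi>"
  shows "bilinear_map (*) (\<lambda>x y. \<phi> x * \<psi> y)"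
  using assms by (intro bilinear_mapI lin_const_times lin_times_const)

lemma conv_scale_left: "conv (\<lambda>h. c * \<phi> h) \<psi> = fun_scale c (conv \<phi> \<psi>)"
  by (simp add: fun_eq_iff conv_def fun_scale_def sw_mult_left mult.assoc)

lemma conv_add_left: "conv (\<phi> + \<chi>) \<psi> = conv \<phi> \<psi> + conv \<chi> \<psi>"
  by (simp add: fun_eq_iff conv_def sw_def distrib_right sum.distrib)

lemma conv_add_right: "conv \<phi> (\<psi> + \<chi>) = conv \<phi> \<psi> + conv \<phi> \<chi>"
  by (simp add: fun_eq_iff conv_def sw_def distrib_left sum.distrib)

lemma conv_sum_left: "conv (\<Sum>i\<in>I. \<phi> i) \<psi> = (\<Sum>i\<in>I. conv (\<phi> i) \<psi>)"
  by (simp add: fun_eq_iff conv_def sum_fun_apply sum_distrib_right sw_sum)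

lemma conv_sum_right: "conv \<phi> (\<Sum>i\<in>I. \<psi> i) = (\<Sum>i\<in>I. conv \<phi> (\<psi> i))"
  by (simp add: fun_eq_iff conv_def sum_fun_apply sum_distrib_left sw_sum)

lemma conv_zero: "conv \<phi> (\<lambda>_. 0) = (\<lambda>_. 0)"
  by (simp add: fun_eq_iff conv_def sw_def)

lemma conv_fun_linear: "Vector_Spaces.linear fun_scale fun_scale (\<lambda>\<chi>. conv \<chi> \<phi>)"
  by (simp add: Vector_Spaces.linear_iff vector_space_fun_scale conv_add_left)
    (simp add: fun_scale_def conv_def sw_mult_left mult.assoc fun_eq_iff)

lemma conv_linear:
  assumes "lin (*) \<phi>" and "lin (*) \<psi>"
  shows "lin (*) (conv \<phi> \<psi>)"
  using sw_bilinear_linear[OF conv_bilinear[OF assms]] by (simp add: conv_def[abs_def])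

lemma conv_assoc:
  assumes "lin (*) \<phi>" and "lin (*) \<psi>" and "lin (*) \<chi>"
  shows "conv (conv \<phi> \<psi>) \<chi> = conv \<phi> (conv \<psi> \<chi>)"
proof
  fix h
  have "conv (conv \<phi> \<psi>) \<chi> h = sw h (\<lambda>x y. sw x (\<lambda>u v. \<phi> u * \<psi> v * \<chi> y))"
    by (simp add: conv_def sw_mult_right)
  also have "\<dots> = sw h (\<lambda>x y. sw y (\<lambda>u v. \<phi> x * \<psi> u * \<chi> v))"
    by (rule sw_coassoc[where s = "(*)"]) (intro trilinear_mapI lin_const_times lin_times_const assms)
  also have "\<dots> = conv \<phi> (conv \<psi> \<chi>) h"
    by (simp add: conv_def sw_mult_left mult.assoc)
  finally show "conv (conv \<phi> \<psi>) \<chi> h = conv \<phi> (conv \<psi> \<chi>) h" .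
qed

lemma conv_counit:
  assumes \<phi>: "lin (*) \<phi>"
  shows "conv \<epsilon> \<phi> = \<phi>" and "conv \<phi> \<epsilon> = \<phi>"
proof -
  interpret \<phi>: Vector_Spaces.linear scale "(*)" \<phi> by (rule \<phi>)
  have "conv \<epsilon> \<phi> h = \<phi> h" for h
  proof -
    have "\<phi> (sw h (\<lambda>x y. \<epsilon> x *s y)) = conv \<epsilon> \<phi> h"
      unfolding sw_linear[OF \<phi>] conv_def by (simp add: \<phi>.scale)
    then show ?thesis by (simp add: sw_counit_left)
  qed
  then show "conv \<epsilon> \<phi> = \<phi>" by blast
  have "conv \<phi> \<epsilon> h = \<phi> h" for h
  proof -
    have "\<phi> (sw h (\<lambda>x y. \<epsilon> y *s x)) = conv \<phi> \<epsilon> h"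
      unfolding sw_linear[OF \<phi>] conv_def by (simp add: \<phi>.scale mult.commute)
    then show ?thesis by (simp add: sw_counit_right)
  qed
  then show "conv \<phi> \<epsilon> = \<phi>" by blast
qed

lemma dual_algebra_carrier: "\<phi> \<in> carrier dual_algebra \<longleftrightarrow> lin (*) \<phi>"
  by (simp add: dual_algebra_def)

lemma dual_algebra_mult:
  assumes "lin (*) \<phi>" and "lin (*) \<psi>"
  shows "\<phi> \<otimes>\<^bsub>dual_algebra\<^esub> \<psi> = conv \<phi> \<psi>"
  using lift2_comult[OF conv_bilinear[OF assms]]
  by (simp add: dual_algebra_def conv_def[abs_def] fun_eq_iff)

lemma dual_algebra_add: "\<phi> \<oplus>\<^bsub>dual_algebra\<^esub> \<psi> = (\<lambda>h. \<phi> h + \<psi> h)"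
  and dual_algebra_zero: "\<zero>\<^bsub>dual_algebra\<^esub> = (\<lambda>_. 0)"
  and dual_algebra_one: "\<one>\<^bsub>dual_algebra\<^esub> = \<epsilon>"
  by (simp_all add: dual_algebra_def)

lemma lin_add: "lin (*) \<phi> \<Longrightarrow> lin (*) \<psi> \<Longrightarrow> lin (*) (\<lambda>h. \<phi> h + \<psi> h)"
  by (simp add: Vector_Spaces.linear_iff algebra_simps)

lemma lin_uminus: "lin (*) \<phi> \<Longrightarrow> lin (*) (\<lambda>h. - \<phi> h)"
  by (simp add: Vector_Spaces.linear_iff)

lemma ring_dual_algebra: "ring dual_algebra"
proof (intro ringI abelian_groupI monoidI)
  fix \<phi> assume "\<phi> \<in> carrier dual_algebra"
  then have \<phi>: "lin (*) \<phi>" by (simp add: dual_algebra_carrier)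
  show "\<exists>\<psi>\<in>carrier dual_algebra. \<psi> \<oplus>\<^bsub>dual_algebra\<^esub> \<phi> = \<zero>\<^bsub>dual_algebra\<^esub>"
    by (rule bexI[of _ "\<lambda>h. - \<phi> h"])
      (simp_all add: dual_algebra_add dual_algebra_zero dual_algebra_carrier lin_uminus[OF \<phi>])
next
  show "\<zero>\<^bsub>dual_algebra\<^esub> \<in> carrier dual_algebra"
    by (simp add: dual_algebra_carrier dual_algebra_zero lin_zero vector_space_field)
next
  show "\<one>\<^bsub>dual_algebra\<^esub> \<in> carrier dual_algebra"
    by (simp add: dual_algebra_carrier dual_algebra_one linear_counit)
qed (simp_all add: dual_algebra_carrier dual_algebra_mult dual_algebra_add dual_algebra_zero dual_algebra_one
    lin_add conv_linear conv_assoc conv_counit linear_counit add_ac,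
    simp_all add: conv_def[abs_def] sw_def distrib_left distrib_right sum.distrib)

end

context semisimple_weak_hopf_algebra
begin

text \<open>The separability idempotent in the form \<open>\<Sum>b. casimir_left b \<otimes> casimir_right b\<close>.\<close>

definition casimir_left :: "'h \<Rightarrow> 'h \<Rightarrow> 'k" where
  "casimir_left b x = representation Basis x b"

definition casimir_right :: "'h \<Rightarrow> 'h \<Rightarrow> 'k" where
  "casimir_right b y = \<mu> (b * S y)"

lemma casimir_left_linear: "lin (*) (casimir_left b)"
  unfolding casimir_left_def[abs_def] by (rule representation_Basis_linear)

lemma casimir_right_linear: "lin (*) (casimir_right b)"
  unfolding casimir_right_def[abs_def] by (intro lin_normal_integral lin_intros)

lemma casimir_legs: "(\<Sum>b\<in>Basis. casimir_left b x * casimir_right b y) = \<mu> (x * S y)"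
proof -
  interpret \<mu>: Vector_Spaces.linear scale "(*)" \<mu> by (rule normal_integral_linear)
  have "\<mu> (x * S y) = \<mu> ((\<Sum>b\<in>Basis. representation Basis x b *s b) * S y)"
    by (simp only: representation_Basis_sum)
  then show ?thesis
    by (simp add: casimir_left_def casimir_right_def sum_distrib_right scale_mult_left \<mu>.sum \<mu>.scale)
qed

lemma casimir_conv: "(\<Sum>b\<in>Basis. conv (casimir_left b) (casimir_right b)) = \<epsilon>"
proof
  fix h
  have "(\<Sum>b\<in>Basis. conv (casimir_left b) (casimir_right b)) h = sw h (\<lambda>x y. \<mu> (x * S y))"
    by (simp add: sum_fun_apply conv_def casimir_legs flip: sw_sum)
  then show "(\<Sum>b\<in>Basis. conv (casimir_left b) (casimir_right b)) h = \<epsilon> h"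
    by (simp add: casimir_form_product)
qed

lemma casimir_balanced:
  assumes \<psi>: "lin (*) \<psi>"
  shows "(\<Sum>b\<in>Basis. casimir_left b x * conv (casimir_right b) \<psi> y) =
    (\<Sum>b\<in>Basis. conv \<psi> (casimir_left b) x * casimir_right b y)"
proof -
  interpret \<psi>: Vector_Spaces.linear scale "(*)" \<psi> by (rule \<psi>)
  have "(\<Sum>b\<in>Basis. casimir_left b x * conv (casimir_right b) \<psi> y) =
      sw y (\<lambda>p q. (\<Sum>b\<in>Basis. casimir_left b x * casimir_right b p) * \<psi> q)"
    by (simp add: conv_def sw_mult_left sum_distrib_right sw_sum)
  also have "\<dots> = \<psi> (sw y (\<lambda>p q. \<mu> (x * S p) *s q))"
    by (simp add: casimir_legs sw_linear[OF \<psi>] \<psi>.scale)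
  also have "\<dots> = \<psi> (sw x (\<lambda>u v. \<mu> (v * S y) *s u))"
    by (simp only: casimir_form_balanced)
  also have "\<dots> = sw x (\<lambda>u v. \<psi> u * (\<Sum>b\<in>Basis. casimir_left b v * casimir_right b y))"
    by (simp add: casimir_legs sw_linear[OF \<psi>] \<psi>.scale mult.commute)
  also have "\<dots> = (\<Sum>b\<in>Basis. conv \<psi> (casimir_left b) x * casimir_right b y)"
    by (simp add: conv_def sw_mult_right sum_distrib_left sw_sum)
  finally show ?thesis .
qed

text \<open>The balancing identity holds in the second factor for functionals, hence also after a linear map
  \<open>G\<close> is applied to that factor.\<close>

lemma casimir_transport:
  assumes \<psi>: "lin (*) \<psi>" and G: "Vector_Spaces.linear fun_scale fun_scale G"
  shows "(\<Sum>b\<in>Basis. conv (casimir_left b) (G (conv (casimir_right b) \<psi>))) =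
    (\<Sum>b\<in>Basis. conv (conv \<psi> (casimir_left b)) (G (casimir_right b)))"
proof
  fix h
  have scale: "G (fun_scale a \<chi>) = fun_scale a (G \<chi>)" for a \<chi>
    using G by (simp add: Vector_Spaces.linear_iff)
  have expand: "(\<Sum>b\<in>Basis. c b * G (\<chi> b) y) = G (\<lambda>z. \<Sum>b\<in>Basis. c b * \<chi> b z) y" for c \<chi> y
  proof -
    have "(\<lambda>z. \<Sum>b\<in>Basis. c b * \<chi> b z) = (\<Sum>b\<in>Basis. fun_scale (c b) (\<chi> b))"
      by (simp add: fun_eq_iff sum_fun_apply fun_scale_def)
    then have "G (\<lambda>z. \<Sum>b\<in>Basis. c b * \<chi> b z) = (\<Sum>b\<in>Basis. fun_scale (c b) (G (\<chi> b)))"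
      by (simp only: linear_sum'[OF G] scale)
    then show ?thesis by (simp add: sum_fun_apply fun_scale_def)
  qed
  have "(\<Sum>b\<in>Basis. conv (casimir_left b) (G (conv (casimir_right b) \<psi>))) h =
      sw h (\<lambda>x y. \<Sum>b\<in>Basis. casimir_left b x * G (conv (casimir_right b) \<psi>) y)"
    by (simp only: sum_fun_apply conv_def[of "casimir_left _"] sw_sum)
  also have "\<dots> = sw h (\<lambda>x y. \<Sum>b\<in>Basis. conv \<psi> (casimir_left b) x * G (casimir_right b) y)"
    by (simp only: expand casimir_balanced[OF \<psi>])
  also have "\<dots> = (\<Sum>b\<in>Basis. conv (conv \<psi> (casimir_left b)) (G (casimir_right b))) h"
    by (simp only: sum_fun_apply conv_def[of "conv \<psi> _"] sw_sum)
  finally show "(\<Sum>b\<in>Basis. conv (casimir_left b) (G (conv (casimir_right b) \<psi>))) h =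
      (\<Sum>b\<in>Basis. conv (conv \<psi> (casimir_left b)) (G (casimir_right b))) h" .
qed

text \<open>Maschke's argument for the dual algebra: a linear projection \<open>\<pi>\<close> onto a left ideal is averaged with the
  separability idempotent to a module homomorphism, whose kernel is a complement.\<close>

theorem dual_algebra_semisimple: "semisimple_ring dual_algebra"
proof (rule semisimple_ring.intro[OF ring_dual_algebra], unfold_locales)
  interpret D: ring dual_algebra by (rule ring_dual_algebra)
  fix I assume I: "left_ideal I dual_algebra"
  interpret I: additive_subgroup I dual_algebra using I by (simp add: left_ideal_def)
  have I_lin: "lin (*) \<phi>" if "\<phi> \<in> I" for \<phi>
    using that I.a_subset by (auto simp: dual_algebra_carrier)
  have I_conv: "conv \<psi> \<phi> \<in> I" if "lin (*) \<psi>" "\<phi> \<in> I" for \<psi> \<phi>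
    using I that by (metis left_ideal_def dual_algebra_mult I_lin dual_algebra_carrier)
  have I_add: "(\<lambda>h. \<phi> h + \<psi> h) \<in> I" if "\<phi> \<in> I" "\<psi> \<in> I" for \<phi> \<psi>
    using I.a_closed[OF that] by (simp add: dual_algebra_add)
  have I_zero: "(\<lambda>_. 0) \<in> I" using I.zero_closed by (simp add: dual_algebra_zero)
  interpret F: vector_space "fun_scale :: 'k \<Rightarrow> ('h \<Rightarrow> 'k) \<Rightarrow> _" by (rule vector_space_fun_scale)
  interpret FF: vector_space_pair "fun_scale :: 'k \<Rightarrow> ('h \<Rightarrow> 'k) \<Rightarrow> _" "fun_scale :: 'k \<Rightarrow> ('h \<Rightarrow> 'k) \<Rightarrow> _" ..
  have subI: "F.subspace I"
  proof (rule F.subspaceI)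
    show "0 \<in> I" using I_zero by (simp add: zero_fun_def)
    show "\<phi> + \<psi> \<in> I" if "\<phi> \<in> I" "\<psi> \<in> I" for \<phi> \<psi>
      using I_add[OF that] by (simp add: plus_fun_def)
    show "fun_scale c \<phi> \<in> I" if \<phi>: "\<phi> \<in> I" for c \<phi>
    proof -
      have "conv (\<lambda>h. c * \<epsilon> h) \<phi> = fun_scale c (conv \<epsilon> \<phi>)"
        by (rule conv_scale_left)
      moreover have "conv (\<lambda>h. c * \<epsilon> h) \<phi> \<in> I"
        by (rule I_conv[OF lin_const_times[OF linear_counit] \<phi>])
      ultimately show ?thesis by (simp only: conv_counit(1)[OF I_lin[OF \<phi>]])
    qed
  qed
  have "Vector_Spaces.linear fun_scale fun_scale (\<lambda>\<phi> :: 'h \<Rightarrow> 'k. \<phi>)"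
    by (simp add: Vector_Spaces.linear_iff F.vector_space_axioms)
  then obtain \<pi> where \<pi>: "Vector_Spaces.linear fun_scale fun_scale \<pi>" "range \<pi> \<subseteq> I" "\<And>\<phi>. \<phi> \<in> I \<Longrightarrow> \<pi> \<phi> = \<phi>"
    using FF.linear_exists_left_inverse_on[OF _ subI, of "\<lambda>\<phi>. \<phi>"] by (auto simp: inj_on_def)
  interpret \<pi>: Vector_Spaces.linear "fun_scale :: 'k \<Rightarrow> ('h \<Rightarrow> 'k) \<Rightarrow> _" "fun_scale :: 'k \<Rightarrow> ('h \<Rightarrow> 'k) \<Rightarrow> _" \<pi>
    by (rule \<pi>(1))
  define P where "P \<phi> = (\<Sum>b\<in>Basis. conv (casimir_left b) (\<pi> (conv (casimir_right b) \<phi>)))" for \<phi>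
  have \<pi>I: "\<pi> \<phi> \<in> I" for \<phi> using \<pi>(2) by blast
  have P_I: "P \<phi> \<in> I" for \<phi>
    unfolding P_def by (intro F.subspace_sum[OF subI] I_conv casimir_left_linear \<pi>I)
  have P_fix: "P \<phi> = \<phi>" if \<phi>: "\<phi> \<in> I" for \<phi>
  proof -
    have "P \<phi> = (\<Sum>b\<in>Basis. conv (conv (casimir_left b) (casimir_right b)) \<phi>)"
      by (simp only: P_def \<pi>(3)[OF I_conv[OF casimir_right_linear \<phi>]]
          conv_assoc[OF casimir_left_linear casimir_right_linear I_lin[OF \<phi>]])
    then show ?thesis
      by (simp only: conv_sum_left[symmetric] casimir_conv conv_counit(1)[OF I_lin[OF \<phi>]])
  qed
  have P_module: "P (conv \<psi> \<phi>) = conv \<psi> (P \<phi>)" if \<psi>: "lin (*) \<psi>" and \<phi>: "lin (*) \<phi>" for \<psi> \<phi>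
  proof -
    have G: "Vector_Spaces.linear fun_scale fun_scale (\<lambda>\<chi>. \<pi> (conv \<chi> \<phi>))"
      using Vector_Spaces.linear_compose[OF conv_fun_linear \<pi>(1)] by (simp only: o_def)
    have "P (conv \<psi> \<phi>) = (\<Sum>b\<in>Basis. conv (casimir_left b) (\<pi> (conv (conv (casimir_right b) \<psi>) \<phi>)))"
      by (simp only: P_def conv_assoc[OF casimir_right_linear \<psi> \<phi>])
    also have "\<dots> = (\<Sum>b\<in>Basis. conv (conv \<psi> (casimir_left b)) (\<pi> (conv (casimir_right b) \<phi>)))"
      by (rule casimir_transport[OF \<psi> G])
    also have "\<dots> = conv \<psi> (P \<phi>)"
      by (simp only: P_def conv_sum_right conv_assoc[OF \<psi> casimir_left_linear I_lin[OF \<pi>I]])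
    finally show ?thesis .
  qed
  have "P (\<phi> + \<psi>) = P \<phi> + P \<psi>" for \<phi> \<psi>
    by (simp only: P_def conv_add_right \<pi>.add sum.distrib)
  then have P_add: "P (\<lambda>h. \<phi> h + \<psi> h) = (\<lambda>h. P \<phi> h + P \<psi> h)" for \<phi> \<psi>
    unfolding plus_fun_def .
  have P_zero: "P (\<lambda>_. 0) = (\<lambda>_. 0)" using P_fix[OF I_zero] .
  have P_minus: "P (\<lambda>h. - \<phi> h) = (\<lambda>h. - P \<phi> h)" for \<phi>
    using P_add[of \<phi> "\<lambda>h. - \<phi> h"] P_zero by (simp add: fun_eq_iff eq_neg_iff_add_eq_0 add.commute)
  define J where "J = {\<phi>. lin (*) \<phi> \<and> P \<phi> = (\<lambda>_. 0)}"
  have minus: "\<ominus>\<^bsub>dual_algebra\<^esub> \<phi> = (\<lambda>h. - \<phi> h)" if "lin (*) \<phi>" for \<phi>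
    by (rule D.minus_equality) (use that in \<open>simp_all add: dual_algebra_add dual_algebra_zero dual_algebra_carrier lin_uminus\<close>)
  have "left_ideal J dual_algebra"
    unfolding left_ideal_def
  proof (intro conjI ballI additive_subgroup.intro D.add.subgroupI)
    show "J \<subseteq> carrier dual_algebra" by (auto simp: J_def dual_algebra_carrier)
    show "J \<noteq> {}" using P_zero lin_zero[OF vector_space_field] by (auto simp: J_def)
    show "\<ominus>\<^bsub>dual_algebra\<^esub> \<phi> \<in> J" if "\<phi> \<in> J" for \<phi>
      using that by (simp add: J_def minus lin_uminus P_minus)
    show "\<phi> \<oplus>\<^bsub>dual_algebra\<^esub> \<psi> \<in> J" if "\<phi> \<in> J" "\<psi> \<in> J" for \<phi> \<psi>
      using that by (simp add: J_def dual_algebra_add lin_add P_add)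
    show "\<psi> \<otimes>\<^bsub>dual_algebra\<^esub> \<phi> \<in> J" if "\<psi> \<in> carrier dual_algebra" "\<phi> \<in> J" for \<psi> \<phi>
      using that by (simp add: J_def dual_algebra_carrier dual_algebra_mult conv_linear P_module conv_zero)
  qed
  moreover have "I \<inter> J = {\<zero>\<^bsub>dual_algebra\<^esub>}"
    unfolding dual_algebra_zero
  proof (intro antisym subsetI)
    fix \<phi> assume "\<phi> \<in> I \<inter> J"
    then have "P \<phi> = \<phi>" "P \<phi> = (\<lambda>_. 0)" using P_fix unfolding J_def by blast+
    then show "\<phi> \<in> {\<lambda>_. 0}" by simp
  next
    fix \<phi> :: "'h \<Rightarrow> 'k" assume "\<phi> \<in> {\<lambda>_. 0}"
    then have \<phi>: "\<phi> = (\<lambda>_. 0)" by simp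
    show "\<phi> \<in> I \<inter> J"
      unfolding \<phi> J_def using I_zero P_zero lin_zero[OF vector_space_field] by blast
  qed
  moreover have "I <+>\<^bsub>dual_algebra\<^esub> J = carrier dual_algebra"
  proof
    show "I <+>\<^bsub>dual_algebra\<^esub> J \<subseteq> carrier dual_algebra"
      using lin_add I_lin by (auto simp: set_add_def set_mult_def dual_algebra_def J_def)
    show "carrier dual_algebra \<subseteq> I <+>\<^bsub>dual_algebra\<^esub> J"
    proof
      fix \<phi> assume "\<phi> \<in> carrier dual_algebra"
      then have \<phi>: "lin (*) \<phi>" by (simp add: dual_algebra_carrier)
      define \<psi> where "\<psi> = (\<lambda>h. \<phi> h + - P \<phi> h)"
      have "lin (*) \<psi>"
        unfolding \<psi>_def by (intro lin_add lin_uminus \<phi> I_lin P_I)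
      moreover have "P \<psi> = (\<lambda>_. 0)"
        unfolding \<psi>_def P_add P_minus P_fix[OF P_I] by simp
      ultimately have "\<psi> \<in> J" by (simp add: J_def)
      moreover have "\<phi> = P \<phi> \<oplus>\<^bsub>dual_algebra\<^esub> \<psi>" by (simp add: dual_algebra_add \<psi>_def)
      ultimately show "\<phi> \<in> I <+>\<^bsub>dual_algebra\<^esub> J"
        using P_I[of \<phi>] by (auto simp: set_add_def set_mult_def dual_algebra_add)
    qed
  qed
  ultimately show "\<exists>J. left_ideal J dual_algebra \<and> I \<inter> J = {\<zero>\<^bsub>dual_algebra\<^esub>} \<and>
      I <+>\<^bsub>dual_algebra\<^esub> J = carrier dual_algebra" by blast
qed

end

theorem theorem6p9:
  fixes scale :: "'k::{alg_closed_field, field_char_0} \<Rightarrow> 'h::{ring, monoid_mult} \<Rightarrow> 'h"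
    and \<Delta> :: "'h \<Rightarrow> ('k, 'h) tensor2"
    and \<epsilon> :: "'h \<Rightarrow> 'k"
    and S :: "'h \<Rightarrow> 'h"
  assumes "weak_hopf_algebra scale \<Delta> \<epsilon> S"
    and "semisimple_ring (ring_of_type :: 'h ring)"
    and "weak_hopf_algebra.target_base scale \<Delta> \<epsilon> = weak_hopf_algebra.source_base scale \<Delta> \<epsilon>"
  shows "semisimple_ring (weak_hopf_algebra.dual_algebra scale \<Delta> \<epsilon>)"
proof -
  interpret weak_hopf_algebra scale \<Delta> \<epsilon> S by (rule assms(1))
  interpret common_base_weak_hopf_algebra scale \<Delta> \<epsilon> S
    by unfold_locales (rule assms(3))
  obtain E where E: "orthogonal_idempotents E" "\<Sum>E = 1" "\<And>e. e \<in> E \<Longrightarrow> S e = e" "\<Delta> 1 = (\<Sum>e\<in>E. pure2 e e)"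
    using comult_one_diagonal by blast
  interpret diagonal_weak_hopf_algebra scale \<Delta> \<epsilon> S E
    by unfold_locales (fact E)+
  obtain \<Lambda> where \<Lambda>: "left_integral \<Lambda>" "\<And>e. e \<in> E \<Longrightarrow> \<epsilon> (e * \<Lambda> * e) = 1"
    using left_integral_exists[OF assms(2)] by blast
  have "\<Lambda> * e \<noteq> 0" if "e \<in> E" for e
    using \<Lambda>(2)[OF that] by (auto simp: mult.assoc \<epsilon>.zero)
  then have span: "span (leg_coeff \<Lambda> ` leg_basis \<Lambda>) = UNIV"
    by (rule integral_legs_span[OF \<Lambda>(1)])
  obtain B where B: "B \<subseteq> leg_coeff \<Lambda> ` leg_basis \<Lambda>" "independent B" "leg_coeff \<Lambda> ` leg_basis \<Lambda> \<subseteq> span B"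
    using maximal_independent_subset[of "leg_coeff \<Lambda> ` leg_basis \<Lambda>"] by metis
  have finite_B: "finite B" using B(1) finite_leg_basis[of \<Lambda>] finite_subset by blast
  have span_B: "span B = UNIV"
    using span_minimal[OF B(3) subspace_span] span by auto
  interpret R: semisimple_ring "ring_of_type :: 'h ring" by (rule assms(2))
  have "semisimple_weak_hopf_algebra scale \<Delta> \<epsilon> S E B \<Lambda>"
  proof unfold_locales
    show "finite B" by (rule finite_B)
    show "independent B" by (rule B(2))
    show "span B = UNIV" by (rule span_B)
    show "left_integral \<Lambda>" by (rule \<Lambda>(1))
    show "\<epsilon> (e * \<Lambda> * e) = 1" if "e \<in> E" for e using that by (rule \<Lambda>(2))
  qed
  then show ?thesis by (rule semisimple_weak_hopf_algebra.dual_algebra_semisimple)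
qed

end
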